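(* Let $\mu$ be a $\sigma$-finite measure on $[0,T]$, let $x_0\in\mathbb{R}^n$, and consider the coupled nonlinear FBSDE $$X_t = x_0 + \int_0^t b(s,X_s,Y_s,Z_s)\,ds + \int_0^t\sigma(s,X_s,Y_s,Z_s)\,dW_s,\qquad Y_t = g(X_T) + \int_t^T f(s,X_s,Y_s,Z_s)\,ds - \int_t^T Z_s\,dW_s. \quad(\ast)$$ Assume that, with $M=\mathbb{R}^n\times\mathbb{R}^m\times\mathbb{R}^{m\times d}$, $b\in L^2_{\mathcal{F}}(0,T;W^{1,\infty}(M;\mathbb{R}^n))$, $\sigma\in L^2_{\mathcal{F}}(0,T;W^{1,\infty}(M;\mathbb{R}^{n\times d}))$, $f\in L^2_{\mathcal{F}}(0,T;W^{1,\infty}(M;\mathbb{R}^m))$, $g\in L^2_{\mathcal{F}_T}(\Omega;W^{1,\infty}(\mathbb{R}^n;\mathbb{R}^m))$; that there are constants $L_0,L_g$ with $L_0L_g<1$ such that almost surely $|\sigma(t,x,y,\hat z)-\sigma(t,x,y,\check z)|\le L_0|\hat z-\check z|$ for a.e. $t$ and all $x,y,\hat z,\check z$, and $|g(\hat x)-g(\check x)|\le L_g|\hat x-\check x|$ for all $\hat x,\check x\in\mathbb{R}^n$; and that $T\in(0,T_0]$, where $T_0>0$ is a constant (which exists under the preceding assumptions) such that $(\ast)$ has a unique solution for every horizon in $(0,T_0]$ and every initial condition. Let $(X,Y,Z)$ be the unique solution of $(\ast)$. Let $(y^*,z^* )\in\mathcal{M}[0,T]$ be a minimizer of $\operatorname{BML}(\tilde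 y,\tilde z;\mu)$ over $(\tilde y,\tilde z)\in\mathcal{M}[0,T]$, and let $x^*$ be the solution of $x^*_t=x_0+\int_0^t b(s,x^*_s,y^*_s,z^*_s)\,ds+\int_0^t\sigma(s,x^*_s,y^*_s,z^*_s)\,dW_s$. Then: 1. $\operatorname{BML}(y^*,z^*;\mu)=0$, and in particular the system $$x^*_t = x_0+\int_0^t b(s,x^*_s,y^*_s,z^*_s)\,ds+\int_0^t\sigma(s,x^*_s,y^*_s,z^*_s)\,dW_s,\qquad y^*_t = g(x^*_T)+\int_t^T f(s,x^*_s,y^*_s,z^*_s)\,ds-\int_t^T z^*_s\,dW_s \quad(\ast\ast)$$ holds $d\mu\otimes d\mathbb{P}$-a.e. 2. If moreover $\mu$ is equivalent to the Lebesgue measure on $[0,T]$, then $\operatorname{dist}_\mu((y^*,z^* ),(Y,Z))=0$, and, for all $t\in[0,T]$, $(\ast\ast)$ holds almost surely, i.e. $(x^*,y^*,z^* )$ solves $(\ast)$.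
   Context: $T\in(0,\infty)$; $(\Omega,\mathcal{F},\mathbb{P})$ is a complete probability space carrying a $d$-dimensional standard Brownian motion $W$ with natural filtration $\mathbb{F}=\{\mathcal{F}_t\}_{0\le t\le T}$. Spaces. $L^2_{\mathcal{F}}(0,T;N)$: $\mathbb{F}$-adapted processes $X:\Omega\times[0,T]\to N$ with $\int_0^T\mathbb{E}|X(t)|^2dt<\infty$. $L^2_{\mathcal{F}}(\Omega;C[0,T];N)$: continuous $\mathbb{F}$-adapted processes with $\mathbb{E}\sup_{t\in[0,T]}|X(t)|^2<\infty$. $\mathcal{M}[0,T]=L^2_{\mathcal{F}}(\Omega;C[0,T];\mathbb{R}^m)\times L^2_{\mathcal{F}}(0,T;\mathbb{R}^{m\times d})$. $L^2_{\mathcal{F}_T}(\Omega;W^{1,\infty}(M;N))$: functions $g:\Omega\times M\to N$ that are Lipschitz in $\theta\in M$ with a deterministic constant (almost surely), $\mathcal{F}_T$-measurable for each fixed $\theta$, with $g(0)$ square integrable. $L^2_{\mathcal{F}}(0,T;W^{1,\infty}(M;N))$: functions $f:\Omega\times[0,T]\times M\to N$ that are Lipschitz in $\theta\in M$ with a deterministic constant uniform in $t$, $\mathbb{F}$-adapted for each fixed $\theta$, with $f(\cdot,0)\in L^2_{\mathcal{F}}(0,T;N)$. A solution of the FBSDE is a triple $(X,Y,Z)\in L^2_{\mathcal{F}}(\Omega;C[0,T];\mathbb{R}^n)\times\mathcal{M}[0,T]$ such that for every $t\in[0,T]$ both equations hold almost surely. Backward measurability loss (BML) of $(\tilde y,\tilde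 z)\in\mathcal{M}[0,T]$: $$\operatorname{BML}(\tilde y,\tilde z;\mu)=\int_0^T\mathbb{E}\Bigl|\tilde y_t-\Bigl(g(\widetilde X_T)+\int_t^T f(s,\widetilde X_s,\tilde y_s,\tilde z_s)\,ds-\int_t^T\tilde z_s\,dW_s\Bigr)\Bigr|^2\mu(dt),$$ where $\widetilde X$ solves $\widetilde X_t=x_0+\int_0^t b(s,\widetilde X_s,\tilde y_s,\tilde z_s)\,ds+\int_0^t\sigma(s,\widetilde X_s,\tilde y_s,\tilde z_s)\,dW_s$. Distance on $\mathcal{M}[0,T]$: $$\operatorname{dist}_\mu((\hat y,\hat z),(\check y,\check z))=\int_0^T\mathbb{E}\Bigl\{|\hat y_t-\check y_t|^2+\int_t^T|\hat z_s-\check z_s|^2\,ds\Bigr\}\mu(dt).$$ Two measures are equivalent if they are mutually absolutely continuous. *)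

theory Defs
  imports "HOL-Probability.Probability"
begin

section \<open>Brownian motion and its filtration\<close>

text \<open>The past \<open>\<sigma>(W u : u \<le> t)\<close>, as a set of events.\<close>

definition past_events ::
    "'a measure \<Rightarrow> (real \<Rightarrow> 'a \<Rightarrow> 'v::topological_space) \<Rightarrow> real \<Rightarrow> 'a set set" where
  "past_events M W t =
     sigma_sets (space M) {W u -` B \<inter> space M | u B. u \<in> {0..t} \<and> B \<in> sets borel}"

text \<open>The increment \<open>W t - W s\<close> has the density of the normal law \<open>N(0, (t - s) I)\<close>.\<close>

definition brownian_motion :: "'a measure \<Rightarrow> (real \<Rightarrow> 'a \<Rightarrow> real ^ 'd) \<Rightarrow> bool" where
  "brownian_motion M W \<longleftrightarrow>
     prob_space M \<and>
     (\<forall>t\<ge>0. W t \<in> borel_measurable M) \<and>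
     (AE \<omega> in M. W 0 \<omega> = 0) \<and>
     (AE \<omega> in M. continuous_on {0..} (\<lambda>t. W t \<omega>)) \<and>
     (\<forall>s t. 0 \<le> s \<and> s < t \<longrightarrow>
        distributed M lborel (\<lambda>\<omega>. W t \<omega> - W s \<omega>)
          (\<lambda>x. ennreal (\<Prod>i\<in>UNIV. normal_density 0 (sqrt (t - s)) (x $ i))) \<and>
        prob_space.indep_set M (past_events M W s)
          {(\<lambda>\<omega>. W t \<omega> - W s \<omega>) -` B \<inter> space M | B. B \<in> sets borel})"

text \<open>The natural filtration, augmented as usual by the null sets. Only the \<open>\<sigma>\<close>-algebra of this
  measure object matters.\<close>

definition brownian_filtration ::
    "'a measure \<Rightarrow> (real \<Rightarrow> 'a \<Rightarrow> 'v::topological_space) \<Rightarrow> real \<Rightarrow> 'a measure" where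
  "brownian_filtration M W t = sigma (space M) (past_events M W t \<union> null_sets M)"


section \<open>Spaces of processes, random maps and random fields\<close>

text \<open>Processes and coefficients are total in the time variable; only their values on
  \<open>{0..T}\<close> are relevant. Adapted processes are required to be jointly measurable, which is
  implicit in the use of their time integrals.\<close>

definition adapted_process ::
    "'a measure \<Rightarrow> (real \<Rightarrow> 'a \<Rightarrow> 'w::topological_space) \<Rightarrow> real \<Rightarrow>
     (real \<Rightarrow> 'a \<Rightarrow> 'v::topological_space) \<Rightarrow> bool" where
  "adapted_process M W T X \<longleftrightarrow>
     (\<lambda>(t, \<omega>). X t \<omega>) \<in> borel_measurable (restrict_space borel {0..T} \<Otimes>\<^sub>M M) \<and>
     (\<forall>t\<in>{0..T}. X t \<in> borel_measurable (brownian_filtration M W t))"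

definition L2F ::
    "'a measure \<Rightarrow> (real \<Rightarrow> 'a \<Rightarrow> 'w::topological_space) \<Rightarrow> real \<Rightarrow>
     (real \<Rightarrow> 'a \<Rightarrow> 'v::real_normed_vector) set" where
  "L2F M W T = {X. adapted_process M W T X \<and>
     (\<integral>\<^sup>+t\<in>{0..T}. (\<integral>\<^sup>+\<omega>. ennreal ((norm (X t \<omega>))\<^sup>2) \<partial>M) \<partial>lborel) < \<infinity>}"

definition L2F_cont ::
    "'a measure \<Rightarrow> (real \<Rightarrow> 'a \<Rightarrow> 'w::topological_space) \<Rightarrow> real \<Rightarrow>
     (real \<Rightarrow> 'a \<Rightarrow> 'v::real_normed_vector) set" where
  "L2F_cont M W T = {X. adapted_process M W T X \<and>
     (\<forall>\<omega>\<in>space M. continuous_on {0..T} (\<lambda>t. X t \<omega>)) \<and>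
     (\<integral>\<^sup>+\<omega>. (SUP t\<in>{0..T}. ennreal ((norm (X t \<omega>))\<^sup>2)) \<partial>M) < \<infinity>}"

definition M_space ::
    "'a measure \<Rightarrow> (real \<Rightarrow> 'a \<Rightarrow> real ^ 'd) \<Rightarrow> real \<Rightarrow>
     ((real \<Rightarrow> 'a \<Rightarrow> real ^ 'm) \<times> (real \<Rightarrow> 'a \<Rightarrow> real ^ 'd ^ 'm)) set" where
  "M_space M W T = L2F_cont M W T \<times> L2F M W T"

definition L2FT_Lip ::
    "'a measure \<Rightarrow> (real \<Rightarrow> 'a \<Rightarrow> 'w::topological_space) \<Rightarrow> real \<Rightarrow>
     ('a \<Rightarrow> 'p::real_normed_vector \<Rightarrow> 'v::real_normed_vector) set" where
  "L2FT_Lip M W T = {g.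
     (\<exists>L. AE \<omega> in M. lipschitz_on L UNIV (g \<omega>)) \<and>
     (\<forall>\<theta>. (\<lambda>\<omega>. g \<omega> \<theta>) \<in> borel_measurable (brownian_filtration M W T)) \<and>
     (\<integral>\<^sup>+\<omega>. ennreal ((norm (g \<omega> 0))\<^sup>2) \<partial>M) < \<infinity>}"

definition L2F_Lip ::
    "'a measure \<Rightarrow> (real \<Rightarrow> 'a \<Rightarrow> 'w::topological_space) \<Rightarrow> real \<Rightarrow>
     (real \<Rightarrow> 'a \<Rightarrow> 'p::real_normed_vector \<Rightarrow> 'v::real_normed_vector) set" where
  "L2F_Lip M W T = {f.
     (\<exists>L. AE \<omega> in M. \<forall>t\<in>{0..T}. lipschitz_on L UNIV (f t \<omega>)) \<and>
     (\<forall>\<theta>. adapted_process M W T (\<lambda>t \<omega>. f t \<omega> \<theta>)) \<and>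
     (\<lambda>t \<omega>. f t \<omega> 0) \<in> L2F M W T}"


section \<open>The Ito integral\<close>

text \<open>\<open>H\<close> is an elementary process, a finite sum of \<open>\<xi> i\<close> on \<open>(a i, b i]\<close> with \<open>\<xi> i\<close> bounded and
  known at time \<open>a i\<close>, and \<open>J\<close> is its pathwise integral against \<open>W\<close>. The intervals may overlap;
  refining them shows that this gives the same class as partitions do.\<close>

definition elementary_integral ::
    "'a measure \<Rightarrow> (real \<Rightarrow> 'a \<Rightarrow> real ^ 'd) \<Rightarrow>
     (real \<Rightarrow> 'a \<Rightarrow> real ^ 'd ^ 'k) \<Rightarrow> (real \<Rightarrow> 'a \<Rightarrow> real ^ 'k) \<Rightarrow> bool" where
  "elementary_integral M W H J \<longleftrightarrow>
     (\<exists>(N::nat) a b \<xi>.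
        (\<forall>i<N. 0 \<le> a i \<and> a i \<le> b i \<and>
           \<xi> i \<in> borel_measurable (brownian_filtration M W (a i)) \<and>
           (\<exists>C. \<forall>\<omega>\<in>space M. norm (\<xi> i \<omega>) \<le> C)) \<and>
        H = (\<lambda>t \<omega>. \<Sum>i<N. indicator {a i<..b i} t *\<^sub>R \<xi> i \<omega>) \<and>
        J = (\<lambda>t \<omega>. \<Sum>i<N. \<xi> i \<omega> *v (W (min t (b i)) \<omega> - W (min t (a i)) \<omega>)))"

text \<open>\<open>I\<close> is a continuous version on \<open>{0..T}\<close> of the Ito integral process of \<open>H\<close>: the mean square
  limit of the integrals of elementary processes approximating \<open>H\<close>.\<close>

definition is_ito_integral ::
    "'a measure \<Rightarrow> (real \<Rightarrow> 'a \<Rightarrow> real ^ 'd) \<Rightarrow> real \<Rightarrow>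
     (real \<Rightarrow> 'a \<Rightarrow> real ^ 'd ^ 'k) \<Rightarrow> (real \<Rightarrow> 'a \<Rightarrow> real ^ 'k) \<Rightarrow> bool" where
  "is_ito_integral M W T H I \<longleftrightarrow>
     adapted_process M W T I \<and>
     (\<forall>\<omega>\<in>space M. continuous_on {0..T} (\<lambda>t. I t \<omega>)) \<and>
     (\<exists>Hs Js.
        (\<forall>n. elementary_integral M W (Hs n) (Js n)) \<and>
        ((\<lambda>n::nat. \<integral>\<^sup>+t\<in>{0..T}. (\<integral>\<^sup>+\<omega>. ennreal ((norm (Hs n t \<omega> - H t \<omega>))\<^sup>2) \<partial>M) \<partial>lborel)
            \<longlonglongrightarrow> 0) \<and>
        (\<forall>t\<in>{0..T}. (\<lambda>n. \<integral>\<^sup>+\<omega>. ennreal ((norm (Js n t \<omega> - I t \<omega>))\<^sup>2) \<partial>M) \<longlonglongrightarrow> 0))"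

text \<open>The Ito integral \<open>\<integral>\<^sub>0\<^sup>t H dW\<close> is determined up to indistinguishability by the previous
  predicate; a version is chosen.\<close>

definition ito_integral ::
    "'a measure \<Rightarrow> (real \<Rightarrow> 'a \<Rightarrow> real ^ 'd) \<Rightarrow> real \<Rightarrow>
     (real \<Rightarrow> 'a \<Rightarrow> real ^ 'd ^ 'k) \<Rightarrow> real \<Rightarrow> 'a \<Rightarrow> real ^ 'k" where
  "ito_integral M W T H = (SOME I. is_ito_integral M W T H I)"


section \<open>Forward-backward equations\<close>

definition forward_rhs ::
    "'a measure \<Rightarrow> (real \<Rightarrow> 'a \<Rightarrow> real ^ 'd) \<Rightarrow> real \<Rightarrow> real ^ 'n \<Rightarrow>
     (real \<Rightarrow> 'a \<Rightarrow> (real ^ 'n) \<times> (real ^ 'm) \<times> (real ^ 'd ^ 'm) \<Rightarrow> real ^ 'n) \<Rightarrow>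
     (real \<Rightarrow> 'a \<Rightarrow> (real ^ 'n) \<times> (real ^ 'm) \<times> (real ^ 'd ^ 'm) \<Rightarrow> real ^ 'd ^ 'n) \<Rightarrow>
     (real \<Rightarrow> 'a \<Rightarrow> real ^ 'n) \<Rightarrow> (real \<Rightarrow> 'a \<Rightarrow> real ^ 'm) \<Rightarrow> (real \<Rightarrow> 'a \<Rightarrow> real ^ 'd ^ 'm) \<Rightarrow>
     real \<Rightarrow> 'a \<Rightarrow> real ^ 'n" where
  "forward_rhs M W T x0 b \<sigma> X Y Z t \<omega> =
     x0 + (LINT s:{0..t}|lborel. b s \<omega> (X s \<omega>, Y s \<omega>, Z s \<omega>))
        + ito_integral M W T (\<lambda>s \<omega>. \<sigma> s \<omega> (X s \<omega>, Y s \<omega>, Z s \<omega>)) t \<omega>"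

definition backward_rhs ::
    "'a measure \<Rightarrow> (real \<Rightarrow> 'a \<Rightarrow> real ^ 'd) \<Rightarrow> real \<Rightarrow>
     (real \<Rightarrow> 'a \<Rightarrow> (real ^ 'n) \<times> (real ^ 'm) \<times> (real ^ 'd ^ 'm) \<Rightarrow> real ^ 'm) \<Rightarrow>
     ('a \<Rightarrow> real ^ 'n \<Rightarrow> real ^ 'm) \<Rightarrow>
     (real \<Rightarrow> 'a \<Rightarrow> real ^ 'n) \<Rightarrow> (real \<Rightarrow> 'a \<Rightarrow> real ^ 'm) \<Rightarrow> (real \<Rightarrow> 'a \<Rightarrow> real ^ 'd ^ 'm) \<Rightarrow>
     real \<Rightarrow> 'a \<Rightarrow> real ^ 'm" where
  "backward_rhs M W T f g X Y Z t \<omega> =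
     g \<omega> (X T \<omega>) + (LINT s:{t..T}|lborel. f s \<omega> (X s \<omega>, Y s \<omega>, Z s \<omega>))
       - (ito_integral M W T Z T \<omega> - ito_integral M W T Z t \<omega>)"

text \<open>\<open>X\<close> solves the forward equation driven by the given pair \<open>(Y, Z)\<close>.\<close>

definition forward_solution ::
    "'a measure \<Rightarrow> (real \<Rightarrow> 'a \<Rightarrow> real ^ 'd) \<Rightarrow> real \<Rightarrow> real ^ 'n \<Rightarrow>
     (real \<Rightarrow> 'a \<Rightarrow> (real ^ 'n) \<times> (real ^ 'm) \<times> (real ^ 'd ^ 'm) \<Rightarrow> real ^ 'n) \<Rightarrow>
     (real \<Rightarrow> 'a \<Rightarrow> (real ^ 'n) \<times> (real ^ 'm) \<times> (real ^ 'd ^ 'm) \<Rightarrow> real ^ 'd ^ 'n) \<Rightarrow>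
     (real \<Rightarrow> 'a \<Rightarrow> real ^ 'm) \<Rightarrow> (real \<Rightarrow> 'a \<Rightarrow> real ^ 'd ^ 'm) \<Rightarrow>
     (real \<Rightarrow> 'a \<Rightarrow> real ^ 'n) \<Rightarrow> bool" where
  "forward_solution M W T x0 b \<sigma> Y Z X \<longleftrightarrow>
     X \<in> L2F_cont M W T \<and>
     (\<forall>t\<in>{0..T}. AE \<omega> in M. X t \<omega> = forward_rhs M W T x0 b \<sigma> X Y Z t \<omega>)"

definition fbsde_solution ::
    "'a measure \<Rightarrow> (real \<Rightarrow> 'a \<Rightarrow> real ^ 'd) \<Rightarrow> real \<Rightarrow> real ^ 'n \<Rightarrow>
     (real \<Rightarrow> 'a \<Rightarrow> (real ^ 'n) \<times> (real ^ 'm) \<times> (real ^ 'd ^ 'm) \<Rightarrow> real ^ 'n) \<Rightarrow>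
     (real \<Rightarrow> 'a \<Rightarrow> (real ^ 'n) \<times> (real ^ 'm) \<times> (real ^ 'd ^ 'm) \<Rightarrow> real ^ 'd ^ 'n) \<Rightarrow>
     (real \<Rightarrow> 'a \<Rightarrow> (real ^ 'n) \<times> (real ^ 'm) \<times> (real ^ 'd ^ 'm) \<Rightarrow> real ^ 'm) \<Rightarrow>
     ('a \<Rightarrow> real ^ 'n \<Rightarrow> real ^ 'm) \<Rightarrow>
     (real \<Rightarrow> 'a \<Rightarrow> real ^ 'n) \<Rightarrow> (real \<Rightarrow> 'a \<Rightarrow> real ^ 'm) \<Rightarrow> (real \<Rightarrow> 'a \<Rightarrow> real ^ 'd ^ 'm) \<Rightarrow>
     bool" where
  "fbsde_solution M W T x0 b \<sigma> f g X Y Z \<longleftrightarrow>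
     X \<in> L2F_cont M W T \<and> (Y, Z) \<in> M_space M W T \<and>
     (\<forall>t\<in>{0..T}. AE \<omega> in M.
        X t \<omega> = forward_rhs M W T x0 b \<sigma> X Y Z t \<omega> \<and>
        Y t \<omega> = backward_rhs M W T f g X Y Z t \<omega>)"

text \<open>Uniqueness is understood in the solution space: up to indistinguishability for the
  continuous components, and up to \<open>dt \<otimes> dP\<close>-null sets for \<open>Z\<close>.\<close>

definition fbsde_uniquely_solvable ::
    "'a measure \<Rightarrow> (real \<Rightarrow> 'a \<Rightarrow> real ^ 'd) \<Rightarrow> real \<Rightarrow> real ^ 'n \<Rightarrow>
     (real \<Rightarrow> 'a \<Rightarrow> (real ^ 'n) \<times> (real ^ 'm) \<times> (real ^ 'd ^ 'm) \<Rightarrow> real ^ 'n) \<Rightarrow>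
     (real \<Rightarrow> 'a \<Rightarrow> (real ^ 'n) \<times> (real ^ 'm) \<times> (real ^ 'd ^ 'm) \<Rightarrow> real ^ 'd ^ 'n) \<Rightarrow>
     (real \<Rightarrow> 'a \<Rightarrow> (real ^ 'n) \<times> (real ^ 'm) \<times> (real ^ 'd ^ 'm) \<Rightarrow> real ^ 'm) \<Rightarrow>
     ('a \<Rightarrow> real ^ 'n \<Rightarrow> real ^ 'm) \<Rightarrow> bool" where
  "fbsde_uniquely_solvable M W T x0 b \<sigma> f g \<longleftrightarrow>
     (\<exists>X Y Z. fbsde_solution M W T x0 b \<sigma> f g X Y Z) \<and>
     (\<forall>X Y Z X' Y' Z'.
        fbsde_solution M W T x0 b \<sigma> f g X Y Z \<and> fbsde_solution M W T x0 b \<sigma> f g X' Y' Z' \<longrightarrow>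
        (AE \<omega> in M. \<forall>t\<in>{0..T}. X t \<omega> = X' t \<omega> \<and> Y t \<omega> = Y' t \<omega>) \<and>
        (AE (t, \<omega>) in restrict_space lborel {0..T} \<Otimes>\<^sub>M M. Z t \<omega> = Z' t \<omega>))"

text \<open>The standing assumptions on the coefficients for the horizon \<open>T\<close>.\<close>

definition fbsde_coefficients ::
    "'a measure \<Rightarrow> (real \<Rightarrow> 'a \<Rightarrow> real ^ 'd) \<Rightarrow> real \<Rightarrow> real \<Rightarrow> real \<Rightarrow>
     (real \<Rightarrow> 'a \<Rightarrow> (real ^ 'n) \<times> (real ^ 'm) \<times> (real ^ 'd ^ 'm) \<Rightarrow> real ^ 'n) \<Rightarrow>
     (real \<Rightarrow> 'a \<Rightarrow> (real ^ 'n) \<times> (real ^ 'm) \<times> (real ^ 'd ^ 'm) \<Rightarrow> real ^ 'd ^ 'n) \<Rightarrow>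
     (real \<Rightarrow> 'a \<Rightarrow> (real ^ 'n) \<times> (real ^ 'm) \<times> (real ^ 'd ^ 'm) \<Rightarrow> real ^ 'm) \<Rightarrow>
     ('a \<Rightarrow> real ^ 'n \<Rightarrow> real ^ 'm) \<Rightarrow> bool" where
  "fbsde_coefficients M W T L0 Lg b \<sigma> f g \<longleftrightarrow>
     b \<in> L2F_Lip M W T \<and> \<sigma> \<in> L2F_Lip M W T \<and> f \<in> L2F_Lip M W T \<and> g \<in> L2FT_Lip M W T \<and>
     L0 * Lg < 1 \<and>
     (AE \<omega> in M. AE t in lborel. t \<in> {0..T} \<longrightarrow>
        (\<forall>x y z z'. norm (\<sigma> t \<omega> (x, y, z) - \<sigma> t \<omega> (x, y, z')) \<le> L0 * norm (z - z'))) \<and>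
     (AE \<omega> in M. \<forall>x x'. norm (g \<omega> x - g \<omega> x') \<le> Lg * norm (x - x'))"


section \<open>Backward measurability loss and distance\<close>

text \<open>The state process is unique up to indistinguishability, so the value of the loss does not
  depend on the choice made here.\<close>

definition BML ::
    "'a measure \<Rightarrow> (real \<Rightarrow> 'a \<Rightarrow> real ^ 'd) \<Rightarrow> real \<Rightarrow> real ^ 'n \<Rightarrow>
     (real \<Rightarrow> 'a \<Rightarrow> (real ^ 'n) \<times> (real ^ 'm) \<times> (real ^ 'd ^ 'm) \<Rightarrow> real ^ 'n) \<Rightarrow>
     (real \<Rightarrow> 'a \<Rightarrow> (real ^ 'n) \<times> (real ^ 'm) \<times> (real ^ 'd ^ 'm) \<Rightarrow> real ^ 'd ^ 'n) \<Rightarrow>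
     (real \<Rightarrow> 'a \<Rightarrow> (real ^ 'n) \<times> (real ^ 'm) \<times> (real ^ 'd ^ 'm) \<Rightarrow> real ^ 'm) \<Rightarrow>
     ('a \<Rightarrow> real ^ 'n \<Rightarrow> real ^ 'm) \<Rightarrow> real measure \<Rightarrow>
     (real \<Rightarrow> 'a \<Rightarrow> real ^ 'm) \<times> (real \<Rightarrow> 'a \<Rightarrow> real ^ 'd ^ 'm) \<Rightarrow> ennreal" where
  "BML M W T x0 b \<sigma> f g \<mu> = (\<lambda>(y, z).
     let X = (SOME X. forward_solution M W T x0 b \<sigma> y z X) in
     \<integral>\<^sup>+t. (\<integral>\<^sup>+\<omega>. ennreal ((norm (y t \<omega> - backward_rhs M W T f g X y z t \<omega>))\<^sup>2) \<partial>M) \<partial>\<mu>)"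

definition dist_M ::
    "'a measure \<Rightarrow> real \<Rightarrow> real measure \<Rightarrow>
     (real \<Rightarrow> 'a \<Rightarrow> real ^ 'm) \<times> (real \<Rightarrow> 'a \<Rightarrow> real ^ 'd ^ 'm) \<Rightarrow>
     (real \<Rightarrow> 'a \<Rightarrow> real ^ 'm) \<times> (real \<Rightarrow> 'a \<Rightarrow> real ^ 'd ^ 'm) \<Rightarrow> ennreal" where
  "dist_M M T \<mu> = (\<lambda>(y, z) (y', z').
     \<integral>\<^sup>+t. (\<integral>\<^sup>+\<omega>. ennreal ((norm (y t \<omega> - y' t \<omega>))\<^sup>2) +
       (\<integral>\<^sup>+s\<in>{t..T}. ennreal ((norm (z s \<omega> - z' s \<omega>))\<^sup>2) \<partial>lborel) \<partial>M) \<partial>\<mu>)"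

end

theory Submission
  imports Defs
begin

text \<open>The solution \<open>(Y, Z)\<close> of the coupled system makes the loss vanish, provided that the state process
  chosen in \<^const>\<open>BML\<close> agrees with \<open>X\<close>; so a minimizer has loss zero, and its backward residual, which is
  continuous in time, vanishes almost everywhere. If \<open>\<mu>\<close> charges every set of positive Lebesgue measure,
  continuity makes the residual vanish at all times and the uniqueness hypothesis identifies the minimizer.

  The agreement of state processes is forward uniqueness by Gronwall's lemma, for which the Ito integral must
  exist: otherwise the choice in \<^const>\<open>ito_integral\<close> is arbitrary. Elementary processes are dense even though
  the integrand is only measurable and adapted, because for a suitable offset \<open>s\<close> the values on the grid
  \<open>s + k h\<close> approximate it. A continuous version is obtained from a maximal inequality and
  the Borel-Cantelli lemma.\<close>

section \<open>Brownian filtration and increments\<close>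

text \<open>Two obstacles shape the details. The first is the approximation of the integrand.
  Averages over a preceding interval are adapted only under progressive measurability, whereas a
  sampled value \<open>H (p k)\<close> is known at time \<open>p k\<close> by adaptedness alone.
  Sampling on one fixed grid can fail, since the values at grid times form a null set that says
  nothing about the process; averaging over the offset excludes this. The second obstacle is that
  the coefficients are Lipschitz only off a null set. Compositions are therefore set to 0 there, and
  they stay adapted because the filtration contains every null set. The price is that the
  independence of increments from the augmented past has to be derived from the one for the raw
  past. Energies are kept in \<open>ennreal\<close>, so that comparing them needs no integrability.
  The factors 3, 6 and 27 come from splitting squared norms by the triangle inequality; Gronwall's
  lemma tolerates any finite constant.\<close>

abbreviation sqn :: "'v::real_normed_vector \<Rightarrow> ennreal" where
  "sqn x \<equiv> ennreal ((norm x)\<^sup>2)"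

abbreviation msq :: "'a measure \<Rightarrow> ('a \<Rightarrow> 'v::real_normed_vector) \<Rightarrow> ennreal" where
  "msq M X \<equiv> \<integral>\<^sup>+\<omega>. sqn (X \<omega>) \<partial>M"

abbreviation jointly_measurable ::
    "'a measure \<Rightarrow> real \<Rightarrow> (real \<Rightarrow> 'a \<Rightarrow> 'v::topological_space) \<Rightarrow> bool" where
  "jointly_measurable M T X \<equiv>
     (\<lambda>(t, \<omega>). X t \<omega>) \<in> borel_measurable (restrict_space borel {0..T} \<Otimes>\<^sub>M M)"

section \<open>Integrals of product functions on Euclidean space\<close>

lemma
  fixes h :: "'d::finite \<Rightarrow> real \<Rightarrow> real"
  assumes h: "\<And>i. integrable lborel (h i)"
  shows integrable_lborel_vec_prod: "integrable lborel (\<lambda>x::real^'d. \<Prod>i\<in>UNIV. h i (x $ i))"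
    and integral_lborel_vec_prod:
      "(\<integral>x. (\<Prod>i\<in>UNIV. h i (x $ i)) \<partial>(lborel :: (real^'d) measure)) = (\<Prod>i\<in>UNIV. integral\<^sup>L lborel (h i))"
proof -
  interpret product_sigma_finite "\<lambda>_::real^'d. lborel::real measure"
    by unfold_locales
  \<comment> \<open>Lebesgue measure on \<open>real^'d\<close> is the image of a product measure
    indexed by \<open>Basis\<close>, not by \<open>'d\<close>. The family is moved to basis vectors;
    the choice is harmless because \<open>axis i 1\<close> determines \<open>i\<close>.\<close>
  define h' where "h' = (\<lambda>b::real^'d. h (SOME i. b = axis i 1))"
  have h'_axis: "h' (axis i 1) = h i" for i
  proof -
    have "(SOME j. axis i (1::real) = axis j 1) = i"
      by (rule some_equality) (auto simp: axis_eq_axis)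
    then show ?thesis by (simp add: h'_def)
  qed
  have B: "(Basis :: (real^'d) set) = (\<lambda>i. axis i 1) ` UNIV"
    by (auto simp: Basis_vec_def)
  have inj: "inj (\<lambda>i. axis i 1 :: real^'d)"
    by (auto simp: inj_on_def axis_eq_axis)
  have reidx: "(\<Prod>i\<in>UNIV. F (axis i 1 :: real^'d)) = (\<Prod>b\<in>Basis. F b)" for F :: "real^'d \<Rightarrow> real"
    unfolding B by (subst prod.reindex[OF inj]) simp
  have comp: "(\<Sum>b\<in>Basis. f b *\<^sub>R b) $ i = f (axis i 1)" for f and i :: 'd
  proof -
    have "(\<Sum>b\<in>Basis. f b *\<^sub>R b) $ i = (\<Sum>j\<in>UNIV. (f (axis j 1) *\<^sub>R axis j 1 :: real^'d)) $ i"
      unfolding B by (subst sum.reindex[OF inj]) simp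
    also have "\<dots> = (\<Sum>j\<in>UNIV. if j = i then f (axis j 1) else 0)"
      unfolding sum_component by (intro sum.cong) (auto simp: axis_def)
    finally show ?thesis by simp
  qed
  have eq: "(\<Prod>i\<in>UNIV. h i ((\<Sum>b\<in>Basis. f b *\<^sub>R b :: real^'d) $ i)) = (\<Prod>b\<in>Basis. h' b (f b))" for f
    unfolding comp by (simp add: reidx[symmetric] h'_axis)
  have int': "b \<in> Basis \<Longrightarrow> integrable lborel (h' b)" for b
    by (auto simp: B h'_axis h)
  have meas: "(\<lambda>f. \<Sum>b\<in>Basis. f b *\<^sub>R b :: real^'d) \<in> borel_measurable (Pi\<^sub>M Basis (\<lambda>_. lborel))"
    by measurable
  have hm[measurable]: "h i \<in> borel_measurable borel" for i
    using h[of i] by auto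
  have meas2: "(\<lambda>x::real^'d. \<Prod>i\<in>UNIV. h i (x $ i)) \<in> borel_measurable borel"
    by measurable
  show "integrable lborel (\<lambda>x::real^'d. \<Prod>i\<in>UNIV. h i (x $ i))"
    unfolding lborel_eq[where 'a="real^'d"]
    by (subst integrable_distr_eq[OF meas meas2])
       (unfold eq, rule product_integrable_prod, use int' in auto)
  show "(\<integral>x. (\<Prod>i\<in>UNIV. h i (x $ i)) \<partial>(lborel :: (real^'d) measure)) = (\<Prod>i\<in>UNIV. integral\<^sup>L lborel (h i))"
    unfolding lborel_eq[where 'a="real^'d"]
    by (subst integral_distr[OF meas meas2])
       (unfold eq, subst product_integral_prod, use int' in \<open>auto simp: reidx[symmetric] h'_axis\<close>)
qed

lemma Int_stable_vimage: "Int_stable {f -` A \<inter> S |A. A \<in> sets N}"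
proof (rule Int_stableI)
  fix a b assume "a \<in> {f -` A \<inter> S |A. A \<in> sets N}" "b \<in> {f -` A \<inter> S |A. A \<in> sets N}"
  then obtain A B where "A \<in> sets N" "B \<in> sets N" "a = f -` A \<inter> S" "b = f -` B \<inter> S" by auto
  then show "a \<inter> b \<in> {f -` A \<inter> S |A. A \<in> sets N}"
    by (auto intro!: exI[of _ "A \<inter> B"])
qed

section \<open>The augmented filtration and the increments of Brownian motion\<close>

locale brownian_space = prob_space M for M :: "'a measure" +
  fixes W :: "real \<Rightarrow> 'a \<Rightarrow> real ^ 'd"
  assumes brownian: "brownian_motion M W"
begin

abbreviation F :: "real \<Rightarrow> 'a measure" where "F \<equiv> brownian_filtration M W"

lemma W_measurable[measurable]: "0 \<le> t \<Longrightarrow> W t \<in> borel_measurable M"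
  using brownian by (auto simp: brownian_motion_def)

lemma space_F[simp]: "space (F t) = space M"
  by (simp add: brownian_filtration_def space_measure_of_conv)

lemma past_events_sets: "past_events M W t \<subseteq> sets M"
  unfolding past_events_def
  by (rule sets.sigma_sets_subset) (auto intro!: measurable_sets)

lemma sets_F: "sets (F t) = sigma_sets (space M) (past_events M W t \<union> null_sets M)"
proof -
  have "past_events M W t \<union> null_sets M \<subseteq> Pow (space M)"
    using past_events_sets[of t] sets.space_closed by (auto dest: null_setsD2 sets.sets_into_space)
  then show ?thesis
    by (simp add: brownian_filtration_def)
qed

lemma sets_F_subset: "sets (F t) \<subseteq> sets M"
  unfolding sets_F using past_events_sets by (intro sets.sigma_sets_subset) (auto dest: null_setsD2)

lemma past_events_mono: "s \<le> t \<Longrightarrow> past_events M W s \<subseteq> past_events M W t"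
  unfolding past_events_def by (rule sigma_sets_mono') force

lemma sets_F_mono: "s \<le> t \<Longrightarrow> sets (F s) \<subseteq> sets (F t)"
  unfolding sets_F using past_events_mono[of s t] by (intro sigma_sets_mono') auto

lemma null_sets_F: "N \<in> null_sets M \<Longrightarrow> N \<in> sets (F t)"
  unfolding sets_F by (auto intro: sigma_sets.Basic)

lemma measurable_F_M: "X \<in> borel_measurable (F t) \<Longrightarrow> X \<in> borel_measurable M"
  using measurable_mono[of borel borel "F t" M] sets_F_subset by auto

lemma measurable_F_mono: "X \<in> borel_measurable (F s) \<Longrightarrow> s \<le> t \<Longrightarrow> X \<in> borel_measurable (F t)"
  using measurable_mono[of borel borel "F s" "F t"] sets_F_mono by auto

lemma W_measurable_F:
  assumes "0 \<le> s" "s \<le> t"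
  shows "W s \<in> borel_measurable (F t)"
proof (rule measurableI)
  fix A :: "(real^'d) set" assume A: "A \<in> sets borel"
  have "W s -` A \<inter> space M \<in> past_events M W t"
    unfolding past_events_def using A assms by (intro sigma_sets.Basic) auto
  then show "W s -` A \<inter> space (F t) \<in> sets (F t)"
    unfolding sets_F by (auto intro: sigma_sets.Basic)
qed simp

text \<open>Null sets can be added to the past without destroying the independence of the increments.\<close>

lemma F_event_past:
  assumes "A \<in> sets (F t)"
  shows "\<exists>B\<in>past_events M W t. AE \<omega> in M. \<omega> \<in> A \<longleftrightarrow> \<omega> \<in> B"
  using assms unfolding sets_F
proof (induction rule: sigma_sets.induct)
  case (Basic a)
  show ?case
  proof (cases "a \<in> past_events M W t")
    case False
    with Basic have "a \<in> null_sets M" by auto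
    then have "AE \<omega> in M. \<omega> \<in> a \<longleftrightarrow> \<omega> \<in> {}"
      by (auto dest: AE_not_in)
    moreover have "{} \<in> past_events M W t"
      unfolding past_events_def by (rule sigma_sets.Empty)
    ultimately show ?thesis by blast
  qed (auto intro!: bexI[of _ a])
next
  case Empty
  show ?case
    by (rule bexI[of _ "{}"]) (auto simp: past_events_def intro: sigma_sets.Empty)
next
  case (Compl a)
  then obtain B where B: "B \<in> past_events M W t" "AE \<omega> in M. \<omega> \<in> a \<longleftrightarrow> \<omega> \<in> B" by blast
  show ?case
    using B by (intro bexI[of _ "space M - B"]) (auto simp: past_events_def intro: sigma_sets.Compl)
next
  case (Union a)
  then obtain B where B: "\<And>i::nat. B i \<in> past_events M W t" "\<And>i. AE \<omega> in M. \<omega> \<in> a i \<longleftrightarrow> \<omega> \<in> B i"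
    by metis
  have "AE \<omega> in M. \<forall>i. \<omega> \<in> a i \<longleftrightarrow> \<omega> \<in> B i"
    using B(2) by (simp add: AE_all_countable)
  then show ?case
    using B(1) by (intro bexI[of _ "\<Union>i. B i"]) (auto simp: past_events_def intro: sigma_sets.Union)
qed

text \<open>Brownian motion is only assumed to have increments independent of the raw past. An event
  of \<open>F s\<close> agrees almost surely with a raw one, so the product rule for probabilities
  carries over; the preimages of Borel sets are closed under intersection, hence generate
  independent \<sigma>-algebras.\<close>

lemma indep_var_increment:
  fixes U :: "'a \<Rightarrow> real" and \<phi> :: "real ^ 'd \<Rightarrow> real"
  assumes st: "0 \<le> s" "s < t" and U: "U \<in> borel_measurable (F s)"
    and \<phi>[measurable]: "\<phi> \<in> borel_measurable borel"
  shows "indep_var borel U borel (\<lambda>\<omega>. \<phi> (W t \<omega> - W s \<omega>))"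
  unfolding indep_var_eq
proof (intro conjI)
  have Um: "random_variable borel U" using U by (rule measurable_F_M)
  have [measurable]: "random_variable borel (W t)" "random_variable borel (W s)"
    using st by auto
  have Vm: "random_variable borel (\<lambda>\<omega>. \<phi> (W t \<omega> - W s \<omega>))" by measurable
  show "random_variable borel U" "random_variable borel (\<lambda>\<omega>. \<phi> (W t \<omega> - W s \<omega>))" by fact+
  let ?V = "{(\<lambda>\<omega>. \<phi> (W t \<omega> - W s \<omega>)) -` A \<inter> space M |A. A \<in> sets borel}"
  have ind: "indep_set (past_events M W s) {(\<lambda>\<omega>. W t \<omega> - W s \<omega>) -` A \<inter> space M |A. A \<in> sets borel}"
    using brownian st by (auto simp: brownian_motion_def)
  have V_sub: "?V \<subseteq> {(\<lambda>\<omega>. W t \<omega> - W s \<omega>) -` A \<inter> space M |A. A \<in> sets borel}"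
  proof safe
    fix A :: "real set" assume "A \<in> sets borel"
    then have "\<phi> -` A \<in> sets borel" using measurable_sets[OF \<phi>, of A] by simp
    then show "\<exists>A'. (\<lambda>\<omega>. \<phi> (W t \<omega> - W s \<omega>)) -` A \<inter> space M =
        (\<lambda>\<omega>. W t \<omega> - W s \<omega>) -` A' \<inter> space M \<and> A' \<in> sets borel"
      by (intro exI[of _ "\<phi> -` A"]) auto
  qed
  show "indep_set (sigma_sets (space M) {U -` A \<inter> space M |A. A \<in> sets borel}) (sigma_sets (space M) ?V)"
  proof (intro indep_set_sigma_sets)
    show "Int_stable {U -` A \<inter> space M |A. A \<in> sets borel}" "Int_stable ?V"
      by (rule Int_stable_vimage)+
    show "indep_set {U -` A \<inter> space M |A. A \<in> sets borel} ?V"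
    proof (rule indep_setI)
      show "{U -` A \<inter> space M |A. A \<in> sets borel} \<subseteq> events" "?V \<subseteq> events"
        using Um Vm by (auto intro: measurable_sets)
      fix a c assume "a \<in> {U -` A \<inter> space M |A. A \<in> sets borel}" and c: "c \<in> ?V"
      then have aF: "a \<in> sets (F s)" using U by (auto dest: measurable_sets)
      obtain B where B: "B \<in> past_events M W s" "AE \<omega> in M. \<omega> \<in> a \<longleftrightarrow> \<omega> \<in> B"
        using F_event_past[OF aF] by blast
      have [measurable]: "B \<in> events" "a \<in> events" "c \<in> events"
        using B past_events_sets aF sets_F_subset c Vm by (auto intro: measurable_sets)
      have "prob (a \<inter> c) = prob (B \<inter> c)"
        using B(2) by (intro measure_eq_AE) auto
      also have "\<dots> = prob B * prob c"
        by (rule indep_setD[OF ind B(1) subsetD[OF V_sub c]])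
      also have "prob B = prob a"
        using B(2) by (intro measure_eq_AE) auto
      finally show "prob (a \<inter> c) = prob a * prob c" .
    qed
  qed
qed

text \<open>Under the product density the expectation of a monomial in the coordinates factors into
  moments of the one-dimensional normal law, of which only those of order 0, 1 and 2 occur.\<close>

lemma
  assumes st: "0 \<le> s" "s < t"
  shows integrable_increment: "integrable M (\<lambda>\<omega>. (W t \<omega> - W s \<omega>) $ i)"
    and expectation_increment: "expectation (\<lambda>\<omega>. (W t \<omega> - W s \<omega>) $ i) = 0"
    and integrable_increment_mult:
      "integrable M (\<lambda>\<omega>. (W t \<omega> - W s \<omega>) $ i * (W t \<omega> - W s \<omega>) $ j)"
    and expectation_increment_mult:
      "expectation (\<lambda>\<omega>. (W t \<omega> - W s \<omega>) $ i * (W t \<omega> - W s \<omega>) $ j) = (if i = j then t - s else 0)"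
proof -
  let ?D = "\<lambda>x::real^'d. \<Prod>i\<in>UNIV. normal_density 0 (sqrt (t - s)) (x $ i)"
  have sg: "0 < sqrt (t - s)" using st by simp
  have D: "distributed M lborel (\<lambda>\<omega>. W t \<omega> - W s \<omega>) (\<lambda>x. ennreal (?D x))"
    using brownian st by (auto simp: brownian_motion_def)
  have Dn: "0 \<le> ?D x" for x by (intro prod_nonneg) simp
  define m :: "nat \<Rightarrow> real" where "m k = integral\<^sup>L lborel (\<lambda>x. normal_density 0 (sqrt (t - s)) x * x ^ k)" for k
  have m0: "m 0 = 1" using integral_normal_density[OF sg] by (simp add: m_def)
  have m1: "m 1 = 0" using integral_normal_moment_nz_1[OF sg] by (simp add: m_def)
  have m2: "m 2 = t - s" using integral_normal_moment_even[OF sg, of 0 1] st by (simp add: m_def fact_numeral)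
  have intk: "integrable lborel (\<lambda>x. normal_density 0 (sqrt (t - s)) x * x ^ k)" for k
    using integrable_normal_moment[OF sg, of 0 k] by simp
  \<comment> \<open>The monomial is coded by its exponents \<open>k\<close>. A coordinate and a
    product of two coordinates are the cases \<open>of_bool (l = i)\<close> and
    \<open>of_bool (l = i) + of_bool (l = j)\<close>, the latter covering \<open>i = j\<close>
    too.\<close>
  have gen: "integrable M (\<lambda>\<omega>. \<Prod>l\<in>UNIV. ((W t \<omega> - W s \<omega>) $ l) ^ k l)"
       "expectation (\<lambda>\<omega>. \<Prod>l\<in>UNIV. ((W t \<omega> - W s \<omega>) $ l) ^ k l) = (\<Prod>l\<in>UNIV. m (k l))" for k :: "'d \<Rightarrow> nat"
  proof -
    let ?g = "\<lambda>x::real^'d. \<Prod>l\<in>UNIV. (x $ l) ^ k l"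
    have gm: "?g \<in> borel_measurable lborel" by measurable
    have e: "?D x * ?g x = (\<Prod>l\<in>UNIV. normal_density 0 (sqrt (t - s)) (x $ l) * (x $ l) ^ k l)" for x
      by (simp add: prod.distrib)
    show "integrable M (\<lambda>\<omega>. \<Prod>l\<in>UNIV. ((W t \<omega> - W s \<omega>) $ l) ^ k l)"
      using distributed_integrable[OF D gm] Dn
        integrable_lborel_vec_prod[of "\<lambda>l x. normal_density 0 (sqrt (t - s)) x * x ^ k l", OF intk]
      by (simp add: e)
    show "expectation (\<lambda>\<omega>. \<Prod>l\<in>UNIV. ((W t \<omega> - W s \<omega>) $ l) ^ k l) = (\<Prod>l\<in>UNIV. m (k l))"
      using distributed_integral[OF D gm] Dn
        integral_lborel_vec_prod[of "\<lambda>l x. normal_density 0 (sqrt (t - s)) x * x ^ k l", OF intk]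
      by (simp add: e m_def)
  qed
  \<comment> \<open>Factors with exponent 0 are 1, so only the one at \<open>i\<close>
    survives.\<close>
  have p1: "(\<Prod>l\<in>UNIV. G l (of_bool (l = i))) = G i 1"
    if "\<And>l. G l 0 = 1" for G :: "'d \<Rightarrow> nat \<Rightarrow> real" and i
  proof -
    have "(\<Prod>l\<in>UNIV. G l (of_bool (l = i))) = (\<Prod>l\<in>UNIV. if l = i then G l 1 else 1)"
      by (intro prod.cong) (auto simp: that)
    then show ?thesis by simp
  qed
  show "integrable M (\<lambda>\<omega>. (W t \<omega> - W s \<omega>) $ i)" "expectation (\<lambda>\<omega>. (W t \<omega> - W s \<omega>) $ i) = 0"
    using gen[of "\<lambda>l. of_bool (l = i)"] p1[of "\<lambda>l k. m k" i] p1[of "\<lambda>l k. ((W t \<omega> - W s \<omega>) $ l) ^ k" i for \<omega>]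
    by (simp_all add: m0 m1[unfolded One_nat_def])
  show "integrable M (\<lambda>\<omega>. (W t \<omega> - W s \<omega>) $ i * (W t \<omega> - W s \<omega>) $ j)"
    using gen(1)[of "\<lambda>l. of_bool (l = i) + of_bool (l = j)"]
      p1[of "\<lambda>l k. ((W t \<omega> - W s \<omega>) $ l) ^ k" for \<omega>]
    by (simp add: power_add prod.distrib)
  have "expectation (\<lambda>\<omega>. (W t \<omega> - W s \<omega>) $ i * (W t \<omega> - W s \<omega>) $ j)
     = (\<Prod>l\<in>UNIV. m (of_bool (l = i) + of_bool (l = j)))"
    using gen(2)[of "\<lambda>l. of_bool (l = i) + of_bool (l = j)"]
      p1[of "\<lambda>l k. ((W t \<omega> - W s \<omega>) $ l) ^ k" for \<omega>]
    by (simp add: power_add prod.distrib)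
  also have "\<dots> = (if i = j then t - s else 0)"
  proof (cases "i = j")
    case True
    then have "(\<Prod>l\<in>UNIV. m (of_bool (l = i) + of_bool (l = j))) = (\<Prod>l\<in>UNIV. if l = i then m 2 else 1)"
      by (intro prod.cong) (auto simp: m0 numeral_2_eq_2)
    then show ?thesis using True by (simp add: m2)
  next
    case False
    then have "\<exists>l\<in>UNIV. m (of_bool (l = i) + of_bool (l = j)) = 0"
      using m1 by (intro bexI[of _ i]) auto
    then show ?thesis using False by (simp add: prod_zero_iff)
  qed
  finally show "expectation (\<lambda>\<omega>. (W t \<omega> - W s \<omega>) $ i * (W t \<omega> - W s \<omega>) $ j) = (if i = j then t - s else 0)" .
qed

text \<open>By independence the expectations factor. The normal law is available only for
  \<open>s < t\<close>; for \<open>s = t\<close> the increment is 0.\<close>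

lemma
  assumes st: "0 \<le> s" "s \<le> t" and U: "U \<in> borel_measurable (F s)" "integrable M (U :: 'a \<Rightarrow> real)"
  shows integrable_times_increment: "integrable M (\<lambda>\<omega>. U \<omega> * (W t \<omega> - W s \<omega>) $ i)"
    and expectation_times_increment: "expectation (\<lambda>\<omega>. U \<omega> * (W t \<omega> - W s \<omega>) $ i) = 0"
    and integrable_times_increment_mult:
      "integrable M (\<lambda>\<omega>. U \<omega> * ((W t \<omega> - W s \<omega>) $ i * (W t \<omega> - W s \<omega>) $ j))"
    and expectation_times_increment_mult:
      "expectation (\<lambda>\<omega>. U \<omega> * ((W t \<omega> - W s \<omega>) $ i * (W t \<omega> - W s \<omega>) $ j)) =
        (if i = j then (t - s) * expectation U else 0)"
proof -
  let ?V = "\<lambda>\<omega>. W t \<omega> - W s \<omega>"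
  have "integrable M (\<lambda>\<omega>. U \<omega> * ?V \<omega> $ i) \<and> expectation (\<lambda>\<omega>. U \<omega> * ?V \<omega> $ i) = 0 \<and>
    integrable M (\<lambda>\<omega>. U \<omega> * (?V \<omega> $ i * ?V \<omega> $ j)) \<and>
    expectation (\<lambda>\<omega>. U \<omega> * (?V \<omega> $ i * ?V \<omega> $ j)) = (if i = j then (t - s) * expectation U else 0)"
  proof (cases "s = t")
    case False
    with st have st': "s < t" by simp
    have i1: "indep_var borel U borel (\<lambda>\<omega>. ?V \<omega> $ i)"
      using indep_var_increment[OF st(1) st' U(1), of "\<lambda>x. x $ i"] by simp
    have i2: "indep_var borel U borel (\<lambda>\<omega>. ?V \<omega> $ i * ?V \<omega> $ j)"
      using indep_var_increment[OF st(1) st' U(1), of "\<lambda>x. x $ i * x $ j"] by simp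
    note st2 = st(1) st'
    show ?thesis
      using indep_var_integrable[OF i1 U(2) integrable_increment[OF st2]]
        indep_var_lebesgue_integral[OF i1 U(2) integrable_increment[OF st2]]
        indep_var_integrable[OF i2 U(2) integrable_increment_mult[OF st2]]
        indep_var_lebesgue_integral[OF i2 U(2) integrable_increment_mult[OF st2]]
      by (simp add: expectation_increment[OF st2, simplified] expectation_increment_mult[OF st2, simplified])
  qed simp
  then show "integrable M (\<lambda>\<omega>. U \<omega> * ?V \<omega> $ i)" "expectation (\<lambda>\<omega>. U \<omega> * ?V \<omega> $ i) = 0"
    "integrable M (\<lambda>\<omega>. U \<omega> * (?V \<omega> $ i * ?V \<omega> $ j))"
    "expectation (\<lambda>\<omega>. U \<omega> * (?V \<omega> $ i * ?V \<omega> $ j)) = (if i = j then (t - s) * expectation U else 0)"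
    by auto
qed

end

section \<open>Discrete stochastic sums\<close>

lemma borel_measurable_matrix_vector_mult[measurable]:
  fixes A :: "'a \<Rightarrow> real^'d^'k" and v :: "'a \<Rightarrow> real^'d"
  assumes [measurable]: "A \<in> borel_measurable N" "v \<in> borel_measurable N"
  shows "(\<lambda>x. A x *v v x) \<in> borel_measurable N"
proof (rule borel_measurable_continuous_Pair[where H="(*v)"])
  show "continuous_on UNIV (\<lambda>x::(real^'d^'k) \<times> (real^'d). fst x *v snd x)"
    unfolding matrix_vector_mult_def by (intro continuous_intros)
qed fact+

lemma norm_matrix_sq: "(norm (A :: real^'d^'k))\<^sup>2 = (\<Sum>i\<in>UNIV. \<Sum>j\<in>UNIV. (A $ i $ j)\<^sup>2)"
  unfolding power2_norm_eq_inner inner_vec_def by (simp add: power2_eq_square)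

lemma borel_measurable_vec_nth_compose[measurable]:
  "A \<in> borel_measurable N \<Longrightarrow> (\<lambda>x. A x $ i) \<in> borel_measurable N"
  for A :: "'a \<Rightarrow> 'b::topological_space ^ 'k"
  by (rule measurable_compose[of A N borel]) (auto intro!: borel_measurable_continuous_onI continuous_on_component continuous_on_id)

section \<open>Isometry and maximal inequality for sums over a grid\<close>

context brownian_space
begin

text \<open>The grid is an infinite nondecreasing sequence. A finite partition is coded by an
  eventually constant \<open>p\<close>, whose further increments vanish, so no length has to be
  carried along. The sums formed from it are martingale transforms of the Brownian
  increments.\<close>

definition simple_integrand :: "(nat \<Rightarrow> real) \<Rightarrow> (nat \<Rightarrow> 'a \<Rightarrow> real ^ 'd ^ 'k) \<Rightarrow> bool" where
  "simple_integrand p \<eta> \<longleftrightarrow> (\<forall>k. 0 \<le> p k \<and> p k \<le> p (Suc k) \<and> \<eta> k \<in> borel_measurable (F (p k)) \<and>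
     (\<exists>C. \<forall>\<omega>\<in>space M. norm (\<eta> k \<omega>) \<le> C))"

definition simple_sum :: "(nat \<Rightarrow> real) \<Rightarrow> (nat \<Rightarrow> 'a \<Rightarrow> real ^ 'd ^ 'k) \<Rightarrow> nat \<Rightarrow> 'a \<Rightarrow> real ^ 'k" where
  "simple_sum p \<eta> n \<omega> = (\<Sum>k<n. \<eta> k \<omega> *v (W (p (Suc k)) \<omega> - W (p k) \<omega>))"

text \<open>Expanding the squared norm in coordinates leaves products of two coordinates of the
  increment, with covariance \<open>t - s\<close> on the diagonal and 0 off it. What remains is the
  sum of squared entries, which is the squared norm of the matrix.\<close>

lemma
  fixes \<xi> :: "'a \<Rightarrow> real ^ 'd ^ 'k"
  assumes st: "0 \<le> s" "s \<le> t" and \<xi>: "\<xi> \<in> borel_measurable (F s)" "\<And>\<omega>. \<omega> \<in> space M \<Longrightarrow> norm (\<xi> \<omega>) \<le> C"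
  shows integrable_transformed_increment: "integrable M (\<lambda>\<omega>. (norm (\<xi> \<omega> *v (W t \<omega> - W s \<omega>)))\<^sup>2)"
    and expectation_transformed_increment:
      "expectation (\<lambda>\<omega>. (norm (\<xi> \<omega> *v (W t \<omega> - W s \<omega>)))\<^sup>2) = (t - s) * expectation (\<lambda>\<omega>. (norm (\<xi> \<omega>))\<^sup>2)"
proof -
  let ?V = "\<lambda>\<omega>. W t \<omega> - W s \<omega>"
  have cm: "(\<lambda>\<omega>. \<xi> \<omega> $ i $ j * \<xi> \<omega> $ i $ l) \<in> borel_measurable (F s)" for i j l
    using \<xi>(1) by measurable
  have bd: "\<bar>\<xi> \<omega> $ i $ j\<bar> \<le> C" if "\<omega> \<in> space M" for i j \<omega>
    using component_le_norm_cart[of "\<xi> \<omega> $ i" j] Finite_Cartesian_Product.norm_nth_le[of "\<xi> \<omega>" i] \<xi>(2)[OF that] by linarith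
  have ci: "integrable M (\<lambda>\<omega>. \<xi> \<omega> $ i $ j * \<xi> \<omega> $ i $ l)" for i j l
  proof (rule integrable_const_bound[where B="C * C"])
    show "AE \<omega> in M. norm (\<xi> \<omega> $ i $ j * \<xi> \<omega> $ i $ l) \<le> C * C"
      using bd by (intro AE_I2) (auto simp: abs_mult intro!: mult_mono intro: order_trans[OF abs_ge_zero])
  qed (use cm in \<open>rule measurable_F_M\<close>)
  have e: "(norm (\<xi> \<omega> *v ?V \<omega>))\<^sup>2 =
      (\<Sum>i\<in>UNIV. \<Sum>j\<in>UNIV. \<Sum>l\<in>UNIV. (\<xi> \<omega> $ i $ j * \<xi> \<omega> $ i $ l) * (?V \<omega> $ j * ?V \<omega> $ l))" for \<omega>
    by (simp add: power2_norm_eq_inner inner_vec_def matrix_vector_mult_def sum_product mult_ac)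
  note I = integrable_times_increment_mult[OF st cm ci] expectation_times_increment_mult[OF st cm ci]
  show "integrable M (\<lambda>\<omega>. (norm (\<xi> \<omega> *v ?V \<omega>))\<^sup>2)"
    unfolding e by (intro Bochner_Integration.integrable_sum I)
  have "expectation (\<lambda>\<omega>. (norm (\<xi> \<omega> *v ?V \<omega>))\<^sup>2) =
      (\<Sum>i\<in>UNIV. \<Sum>j\<in>UNIV. \<Sum>l\<in>UNIV. expectation (\<lambda>\<omega>. (\<xi> \<omega> $ i $ j * \<xi> \<omega> $ i $ l) * (?V \<omega> $ j * ?V \<omega> $ l)))"
    unfolding e by (subst Bochner_Integration.integral_sum | intro Bochner_Integration.integrable_sum I(1) refl sum.cong)+
  also have "\<dots> = (\<Sum>i\<in>UNIV. \<Sum>j\<in>UNIV. (t - s) * expectation (\<lambda>\<omega>. (\<xi> \<omega> $ i $ j)\<^sup>2))"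
    by (subst I(2)) (simp add: power2_eq_square)
  also have "\<dots> = (t - s) * (\<Sum>i\<in>UNIV. \<Sum>j\<in>UNIV. expectation (\<lambda>\<omega>. (\<xi> \<omega> $ i $ j)\<^sup>2))"
    by (simp add: sum_distrib_left)
  also have "(\<Sum>i\<in>UNIV. \<Sum>j\<in>UNIV. expectation (\<lambda>\<omega>. (\<xi> \<omega> $ i $ j)\<^sup>2)) = expectation (\<lambda>\<omega>. (norm (\<xi> \<omega>))\<^sup>2)"
    unfolding power2_eq_square norm_matrix_sq[unfolded power2_eq_square]
    by (subst Bochner_Integration.integral_sum | intro Bochner_Integration.integrable_sum ci refl sum.cong)+
  finally show "expectation (\<lambda>\<omega>. (norm (\<xi> \<omega> *v ?V \<omega>))\<^sup>2) = (t - s) * expectation (\<lambda>\<omega>. (norm (\<xi> \<omega>))\<^sup>2)" .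
qed

text \<open>The orthogonality behind the isometry: \<open>\<zeta>\<close> will be the sum
  accumulated up to time \<open>s\<close> and the other factor the next summand. Each coefficient of
  a coordinate of the increment is known at \<open>s\<close> and integrable, and the increment has
  mean 0.\<close>

lemma
  fixes \<xi> :: "'a \<Rightarrow> real ^ 'd ^ 'k"
  assumes st: "0 \<le> s" "s \<le> t" and \<xi>: "\<xi> \<in> borel_measurable (F s)" "\<And>\<omega>. \<omega> \<in> space M \<Longrightarrow> norm (\<xi> \<omega>) \<le> C"
    and \<zeta>: "\<zeta> \<in> borel_measurable (F s)" "integrable M (\<lambda>\<omega>. (norm (\<zeta> \<omega>))\<^sup>2)"
  shows integrable_inner_increment: "integrable M (\<lambda>\<omega>. \<zeta> \<omega> \<bullet> (\<xi> \<omega> *v (W t \<omega> - W s \<omega>)))"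
    and expectation_inner_increment: "expectation (\<lambda>\<omega>. \<zeta> \<omega> \<bullet> (\<xi> \<omega> *v (W t \<omega> - W s \<omega>))) = 0"
proof -
  let ?V = "\<lambda>\<omega>. W t \<omega> - W s \<omega>"
  have cm: "(\<lambda>\<omega>. \<zeta> \<omega> $ i * \<xi> \<omega> $ i $ j) \<in> borel_measurable (F s)" for i j
    using \<xi>(1) \<zeta>(1) by measurable
  have bd: "\<bar>\<xi> \<omega> $ i $ j\<bar> \<le> C" if "\<omega> \<in> space M" for i j \<omega>
    using component_le_norm_cart[of "\<xi> \<omega> $ i" j] Finite_Cartesian_Product.norm_nth_le[of "\<xi> \<omega>" i] \<xi>(2)[OF that] by linarith
  have ci: "integrable M (\<lambda>\<omega>. \<zeta> \<omega> $ i * \<xi> \<omega> $ i $ j)" for i j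
  proof (rule Bochner_Integration.integrable_bound)
    show "integrable M (\<lambda>\<omega>. C * (1 + (norm (\<zeta> \<omega>))\<^sup>2))" using \<zeta>(2) by simp
    show "(\<lambda>\<omega>. \<zeta> \<omega> $ i * \<xi> \<omega> $ i $ j) \<in> borel_measurable M" using cm by (rule measurable_F_M)
    show "AE \<omega> in M. norm (\<zeta> \<omega> $ i * \<xi> \<omega> $ i $ j) \<le> norm (C * (1 + (norm (\<zeta> \<omega>))\<^sup>2))"
    proof (rule AE_I2)
      fix \<omega> assume \<omega>: "\<omega> \<in> space M"
      have C: "0 \<le> C" using bd[OF \<omega>] abs_ge_zero order_trans by blast
      have "\<bar>\<zeta> \<omega> $ i\<bar> \<le> norm (\<zeta> \<omega>)" by (rule component_le_norm_cart)
      \<comment> \<open>This trades the norm for its square, whose integrability is all that is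
        known of \<open>\<zeta>\<close>.\<close>
      also have "\<dots> \<le> 1 + (norm (\<zeta> \<omega>))\<^sup>2"
        using sum_squares_bound[of 1 "norm (\<zeta> \<omega>)"] norm_ge_zero[of "\<zeta> \<omega>"]
        unfolding one_power2 by linarith
      finally have "\<bar>\<zeta> \<omega> $ i\<bar> * \<bar>\<xi> \<omega> $ i $ j\<bar> \<le> (1 + (norm (\<zeta> \<omega>))\<^sup>2) * C"
        using bd[OF \<omega>] by (intro mult_mono) auto
      then show "norm (\<zeta> \<omega> $ i * \<xi> \<omega> $ i $ j) \<le> norm (C * (1 + (norm (\<zeta> \<omega>))\<^sup>2))"
        using C by (simp add: abs_mult mult.commute)
    qed
  qed
  have e: "\<zeta> \<omega> \<bullet> (\<xi> \<omega> *v ?V \<omega>) = (\<Sum>i\<in>UNIV. \<Sum>j\<in>UNIV. (\<zeta> \<omega> $ i * \<xi> \<omega> $ i $ j) * ?V \<omega> $ j)" for \<omega>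
    by (simp add: inner_vec_def matrix_vector_mult_def sum_distrib_left mult_ac)
  note I = integrable_times_increment[OF st cm ci] expectation_times_increment[OF st cm ci]
  show "integrable M (\<lambda>\<omega>. \<zeta> \<omega> \<bullet> (\<xi> \<omega> *v ?V \<omega>))"
    unfolding e by (intro Bochner_Integration.integrable_sum I)
  have "expectation (\<lambda>\<omega>. \<zeta> \<omega> \<bullet> (\<xi> \<omega> *v ?V \<omega>)) =
      (\<Sum>i\<in>UNIV. \<Sum>j\<in>UNIV. expectation (\<lambda>\<omega>. (\<zeta> \<omega> $ i * \<xi> \<omega> $ i $ j) * ?V \<omega> $ j))"
    unfolding e by (subst Bochner_Integration.integral_sum | intro Bochner_Integration.integrable_sum I(1) refl sum.cong)+
  also have "\<dots> = 0" by (subst I(2)) simp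
  finally show "expectation (\<lambda>\<omega>. \<zeta> \<omega> \<bullet> (\<xi> \<omega> *v ?V \<omega>)) = 0" .
qed

lemma simple_integrand_mono: "simple_integrand p \<eta> \<Longrightarrow> j \<le> k \<Longrightarrow> p j \<le> p k"
  by (rule lift_Suc_mono_le) (auto simp: simple_integrand_def)

lemma simple_integrand_integrable:
  assumes "simple_integrand p \<eta>"
  shows "integrable M (\<lambda>\<omega>. (norm (\<eta> k \<omega>))\<^sup>2)"
proof -
  have "\<exists>C. \<forall>\<omega>\<in>space M. norm (\<eta> k \<omega>) \<le> C" and m: "\<eta> k \<in> borel_measurable (F (p k))"
    using assms by (auto simp: simple_integrand_def)
  then obtain C where "\<And>\<omega>. \<omega> \<in> space M \<Longrightarrow> norm (\<eta> k \<omega>) \<le> C" by blast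
  moreover have [measurable]: "\<eta> k \<in> borel_measurable M"
    using m by (rule measurable_F_M)
  ultimately show ?thesis
    by (intro integrable_const_bound[where B="C\<^sup>2"]) (auto intro!: AE_I2 power_mono)
qed

lemma simple_sum_measurable_F:
  assumes p: "simple_integrand p \<eta>" and "n \<le> m"
  shows "simple_sum p \<eta> n \<in> borel_measurable (F (p m))"
  unfolding simple_sum_def[abs_def]
proof (intro borel_measurable_sum borel_measurable_matrix_vector_mult borel_measurable_diff)
  fix k assume "k \<in> {..<n}"
  with assms have k: "k \<le> m" "Suc k \<le> m" by auto
  show "\<eta> k \<in> borel_measurable (F (p m))"
    using p simple_integrand_mono[OF p k(1)] by (auto simp: simple_integrand_def intro: measurable_F_mono)
  show "W (p (Suc k)) \<in> borel_measurable (F (p m))" "W (p k) \<in> borel_measurable (F (p m))"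
    using p simple_integrand_mono[OF p k(1)] simple_integrand_mono[OF p k(2)]
    by (auto simp: simple_integrand_def intro!: W_measurable_F)
qed

text \<open>Each new summand is orthogonal to the sum before it, so the squares add up. Square
  integrability is proved in the same induction because the orthogonality of the next summand
  requires it.\<close>

lemma simple_sum_isometry:
  assumes p: "simple_integrand p \<eta>"
  shows "integrable M (\<lambda>\<omega>. (norm (simple_sum p \<eta> n \<omega>))\<^sup>2) \<and>
    expectation (\<lambda>\<omega>. (norm (simple_sum p \<eta> n \<omega>))\<^sup>2) =
      (\<Sum>k<n. (p (Suc k) - p k) * expectation (\<lambda>\<omega>. (norm (\<eta> k \<omega>))\<^sup>2))"
proof (induction n)
  case 0
  then show ?case by (simp add: simple_sum_def)
next
  case (Suc n)
  let ?V = "\<lambda>\<omega>. \<eta> n \<omega> *v (W (p (Suc n)) \<omega> - W (p n) \<omega>)"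
  obtain C where st: "0 \<le> p n" "p n \<le> p (Suc n)" and \<xi>: "\<eta> n \<in> borel_measurable (F (p n))"
      and C: "\<And>\<omega>. \<omega> \<in> space M \<Longrightarrow> norm (\<eta> n \<omega>) \<le> C"
    using p unfolding simple_integrand_def by metis
  have e: "(norm (simple_sum p \<eta> (Suc n) \<omega>))\<^sup>2 = (norm (simple_sum p \<eta> n \<omega>))\<^sup>2
      + 2 * (simple_sum p \<eta> n \<omega> \<bullet> ?V \<omega>) + (norm (?V \<omega>))\<^sup>2" for \<omega>
    by (simp add: simple_sum_def power2_norm_eq_inner inner_add_left inner_add_right inner_commute)
  note I1 = Suc[THEN conjunct1]
  note I2 = integrable_inner_increment[OF st \<xi> C simple_sum_measurable_F[OF p order_refl] I1]
    expectation_inner_increment[OF st \<xi> C simple_sum_measurable_F[OF p order_refl] I1]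
  note I3 = integrable_transformed_increment[OF st \<xi> C] expectation_transformed_increment[OF st \<xi> C]
  show ?case
    unfolding e using I1 I2 I3 Suc by simp
qed

text \<open>Freezing the integrand at the first passage time gives a sum that has already passed the level
  at the final time, so that the isometry alone yields the maximal inequality.\<close>

lemma simple_sum_maximal:
  assumes p: "simple_integrand p \<eta>" and c: "0 < c"
  shows "c\<^sup>2 * prob {\<omega>\<in>space M. \<exists>k\<le>n. c \<le> norm (simple_sum p \<eta> k \<omega>)} \<le>
    (\<Sum>k<n. (p (Suc k) - p k) * expectation (\<lambda>\<omega>. (norm (\<eta> k \<omega>))\<^sup>2))"
proof -
  let ?A = "{\<omega>\<in>space M. \<exists>k\<le>n. c \<le> norm (simple_sum p \<eta> k \<omega>)}"
  \<comment> \<open>The test at index \<open>k\<close> looks only at sums up to \<open>k\<close>,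
    all known at time \<open>p k\<close>, so the stopped coefficients remain adapted.\<close>
  define \<eta>' where "\<eta>' = (\<lambda>k \<omega>. if \<forall>j\<le>k. norm (simple_sum p \<eta> j \<omega>) < c then \<eta> k \<omega> else 0)"
  have p': "simple_integrand p \<eta>'"
    unfolding simple_integrand_def
  proof (intro allI conjI)
    fix k
    have [measurable]: "\<eta> k \<in> borel_measurable (F (p k))"
      using p by (auto simp: simple_integrand_def)
    have "{\<omega>\<in>space (F (p k)). \<forall>j\<in>{..k}. norm (simple_sum p \<eta> j \<omega>) < c} \<in> sets (F (p k))"
    proof (rule sets.sets_Collect_finite_All)
      fix j assume "j \<in> {..k}"
      then have "j \<le> k" by simp
      note [measurable] = simple_sum_measurable_F[OF p this]
      show "{\<omega>\<in>space (F (p k)). norm (simple_sum p \<eta> j \<omega>) < c} \<in> sets (F (p k))"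
        by measurable
    qed auto
    then have "{\<omega>\<in>space (F (p k)). \<forall>j\<le>k. norm (simple_sum p \<eta> j \<omega>) < c} \<in> sets (F (p k))"
      by (simp only: Ball_def atMost_iff)
    then show "\<eta>' k \<in> borel_measurable (F (p k))"
      unfolding \<eta>'_def by (rule measurable_If[rotated 2]) measurable
    show "\<exists>C. \<forall>\<omega>\<in>space M. norm (\<eta>' k \<omega>) \<le> C"
    proof -
      have "\<exists>C. \<forall>\<omega>\<in>space M. norm (\<eta> k \<omega>) \<le> C"
        using p by (simp add: simple_integrand_def)
      then obtain C where C: "\<And>\<omega>. \<omega> \<in> space M \<Longrightarrow> norm (\<eta> k \<omega>) \<le> C" by blast
      have "norm (\<eta>' k \<omega>) \<le> norm (\<eta> k \<omega>)" for \<omega> by (simp add: \<eta>'_def)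
      with C have "\<forall>\<omega>\<in>space M. norm (\<eta>' k \<omega>) \<le> C" by (meson order_trans)
      then show ?thesis ..
    qed
    show "0 \<le> p k" "p k \<le> p (Suc k)" using p by (auto simp: simple_integrand_def)
  qed
  have passed: "c \<le> norm (simple_sum p \<eta>' n \<omega>)" if "\<omega> \<in> ?A" for \<omega>
  proof -
    \<comment> \<open>The first passage index. From \<open>\<tau>\<close> on the stopped
      coefficients vanish and before it they are the original ones, so the full stopped sum is the
      original sum at \<open>\<tau>\<close>.\<close>
    define \<tau> where "\<tau> = (LEAST k. c \<le> norm (simple_sum p \<eta> k \<omega>))"
    from that have "\<exists>k\<le>n. c \<le> norm (simple_sum p \<eta> k \<omega>)" by simp
    then obtain k where k: "k \<le> n" "c \<le> norm (simple_sum p \<eta> k \<omega>)" by blast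
    have \<tau>: "c \<le> norm (simple_sum p \<eta> \<tau> \<omega>)" unfolding \<tau>_def using k(2) by (rule LeastI)
    have before: "norm (simple_sum p \<eta> j \<omega>) < c" if "j < \<tau>" for j
      using not_less_Least[OF that[unfolded \<tau>_def]] by simp
    have "\<tau> \<le> n" using Least_le[of "\<lambda>k. c \<le> norm (simple_sum p \<eta> k \<omega>)", OF k(2)] k(1) by (simp add: \<tau>_def)
    then have "simple_sum p \<eta>' n \<omega> = (\<Sum>k<\<tau>. \<eta>' k \<omega> *v (W (p (Suc k)) \<omega> - W (p k) \<omega>))"
      unfolding simple_sum_def using \<tau>
      by (intro sum.mono_neutral_right) (auto simp: \<eta>'_def matrix_vector_mult_def zero_vec_def not_less)
    also have "\<dots> = simple_sum p \<eta> \<tau> \<omega>"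
      unfolding simple_sum_def using before by (intro sum.cong) (auto simp: \<eta>'_def)
    finally show ?thesis using \<tau> by simp
  qed
  have [measurable]: "simple_sum p \<eta> k \<in> borel_measurable M" for k
    using simple_sum_measurable_F[OF p order_refl] by (rule measurable_F_M)
  have A: "?A \<in> events" by measurable
  note iso' = simple_sum_isometry[OF p']
  have "c\<^sup>2 * prob ?A = expectation (\<lambda>\<omega>. c\<^sup>2 * indicator ?A \<omega>)"
    using A by (simp only: integral_mult_right_zero integral_indicator) (auto simp: sets.Int_space_eq2)
  also have "\<dots> \<le> expectation (\<lambda>\<omega>. (norm (simple_sum p \<eta>' n \<omega>))\<^sup>2)"
  proof (rule integral_mono)
    show "integrable M (\<lambda>\<omega>. c\<^sup>2 * indicator ?A \<omega>)"
      using A by (intro integrable_mult_right integrable_real_indicator) (auto simp: emeasure_eq_measure)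
    show "c\<^sup>2 * indicator ?A \<omega> \<le> (norm (simple_sum p \<eta>' n \<omega>))\<^sup>2" for \<omega>
      using passed[of \<omega>] c by (auto simp: indicator_def intro: power_mono)
  qed (use iso' in auto)
  also have "\<dots> = (\<Sum>k<n. (p (Suc k) - p k) * expectation (\<lambda>\<omega>. (norm (\<eta>' k \<omega>))\<^sup>2))"
    using iso' by blast
  also have "\<dots> \<le> (\<Sum>k<n. (p (Suc k) - p k) * expectation (\<lambda>\<omega>. (norm (\<eta> k \<omega>))\<^sup>2))"
  proof (intro sum_mono mult_left_mono integral_mono)
    fix k
    show "integrable M (\<lambda>\<omega>. (norm (\<eta>' k \<omega>))\<^sup>2)" "integrable M (\<lambda>\<omega>. (norm (\<eta> k \<omega>))\<^sup>2)"
      using p p' by (auto intro: simple_integrand_integrable)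
    show "(norm (\<eta>' k \<omega>))\<^sup>2 \<le> (norm (\<eta> k \<omega>))\<^sup>2" for \<omega> by (simp add: \<eta>'_def)
    show "0 \<le> p (Suc k) - p k" using p by (simp add: simple_integrand_def)
  qed
  finally show ?thesis .
qed

section \<open>Elementary processes and their integrals\<close>

lemma elementary_integral_diff:
  assumes "elementary_integral M W H J" "elementary_integral M W H' J'"
  shows "elementary_integral M W (\<lambda>t \<omega>. H t \<omega> - H' t \<omega>) (\<lambda>t \<omega>. J t \<omega> - J' t \<omega>)"
proof -
  obtain N a b \<xi> where 1: "\<And>i. i < (N::nat) \<Longrightarrow> 0 \<le> a i \<and> a i \<le> b i \<and> \<xi> i \<in> borel_measurable (F (a i)) \<and>
        (\<exists>C. \<forall>\<omega>\<in>space M. norm (\<xi> i \<omega>) \<le> C)"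
      and H: "H = (\<lambda>t \<omega>. \<Sum>i<N. indicator {a i<..b i} t *\<^sub>R \<xi> i \<omega>)"
      and J: "J = (\<lambda>t \<omega>. \<Sum>i<N. \<xi> i \<omega> *v (W (min t (b i)) \<omega> - W (min t (a i)) \<omega>))"
    using assms(1) unfolding elementary_integral_def by blast
  obtain N' a' b' \<xi>' where 2: "\<And>i. i < (N'::nat) \<Longrightarrow> 0 \<le> a' i \<and> a' i \<le> b' i \<and> \<xi>' i \<in> borel_measurable (F (a' i)) \<and>
        (\<exists>C. \<forall>\<omega>\<in>space M. norm (\<xi>' i \<omega>) \<le> C)"
      and H': "H' = (\<lambda>t \<omega>. \<Sum>i<N'. indicator {a' i<..b' i} t *\<^sub>R \<xi>' i \<omega>)"
      and J': "J' = (\<lambda>t \<omega>. \<Sum>i<N'. \<xi>' i \<omega> *v (W (min t (b' i)) \<omega> - W (min t (a' i)) \<omega>))"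
    using assms(2) unfolding elementary_integral_def by blast
  \<comment> \<open>Overlapping intervals are allowed, so the two families are simply concatenated,
    the second one with its sign reversed and its indices shifted by \<open>N\<close>.\<close>
  define A where "A i = (if i < N then a i else a' (i - N))" for i
  define B where "B i = (if i < N then b i else b' (i - N))" for i
  define \<Xi> where "\<Xi> i = (if i < N then \<xi> i else (\<lambda>\<omega>. - \<xi>' (i - N) \<omega>))" for i
  have split: "(\<Sum>i<N + N'. G i) = (\<Sum>i<N. G i) + (\<Sum>i<N'. G (i + N))" for G :: "nat \<Rightarrow> 'z::comm_monoid_add"
  proof -
    have "{..<N + N'} = {..<N} \<union> {N..<N + N'}" by auto
    then have "(\<Sum>i<N + N'. G i) = (\<Sum>i<N. G i) + (\<Sum>i=N..<N + N'. G i)"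
      by (simp add: sum.union_disjoint ivl_disj_int)
    also have "(\<Sum>i=N..<N + N'. G i) = (\<Sum>i<N'. G (i + N))"
      using sum.shift_bounds_nat_ivl[of G 0 N N'] by (simp add: lessThan_atLeast0 add.commute)
    finally show ?thesis .
  qed
  have neg: "(- x) *v v = - (x *v v)" for x :: "real^'d^'b" and v
    by (simp add: matrix_vector_mult_def vec_eq_iff sum_negf)
  show ?thesis
    unfolding elementary_integral_def
  proof (intro exI conjI)
    show "\<forall>i<N + N'. 0 \<le> A i \<and> A i \<le> B i \<and> \<Xi> i \<in> borel_measurable (F (A i)) \<and>
        (\<exists>C. \<forall>\<omega>\<in>space M. norm (\<Xi> i \<omega>) \<le> C)"
    proof (intro allI impI)
      fix i assume i: "i < N + N'"
      show "0 \<le> A i \<and> A i \<le> B i \<and> \<Xi> i \<in> borel_measurable (F (A i)) \<and> (\<exists>C. \<forall>\<omega>\<in>space M. norm (\<Xi> i \<omega>) \<le> C)"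
      proof (cases "i < N")
        case True then show ?thesis using 1[OF True] by (simp add: A_def B_def \<Xi>_def)
      next
        case False
        then have i': "i - N < N'" using i by simp
        show ?thesis using 2[OF i'] False by (simp add: A_def B_def \<Xi>_def)
      qed
    qed
    show "(\<lambda>t \<omega>. H t \<omega> - H' t \<omega>) = (\<lambda>t \<omega>. \<Sum>i<N + N'. indicator {A i<..B i} t *\<^sub>R \<Xi> i \<omega>)"
      unfolding split H H' by (simp add: A_def B_def \<Xi>_def sum_negf)
    show "(\<lambda>t \<omega>. J t \<omega> - J' t \<omega>) = (\<lambda>t \<omega>. \<Sum>i<N + N'. \<Xi> i \<omega> *v (W (min t (B i)) \<omega> - W (min t (A i)) \<omega>))"
      unfolding split J J' by (simp add: A_def B_def \<Xi>_def sum_negf neg)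
  qed
qed

lemma elementary_integral_measurable:
  assumes "elementary_integral M W H J"
  shows "(\<lambda>(t, \<omega>). H t \<omega>) \<in> borel_measurable (borel \<Otimes>\<^sub>M M)"
    and "0 \<le> t \<Longrightarrow> J t \<in> borel_measurable (F t)"
    and "AE \<omega> in M. continuous_on {0..} (\<lambda>t. J t \<omega>)"
proof -
  obtain N a b \<xi> where 1: "\<And>i. i < (N::nat) \<Longrightarrow> 0 \<le> a i \<and> a i \<le> b i \<and> \<xi> i \<in> borel_measurable (F (a i)) \<and>
        (\<exists>C. \<forall>\<omega>\<in>space M. norm (\<xi> i \<omega>) \<le> C)"
      and H: "H = (\<lambda>t \<omega>. \<Sum>i<N. indicator {a i<..b i} t *\<^sub>R \<xi> i \<omega>)"
      and J: "J = (\<lambda>t \<omega>. \<Sum>i<N. \<xi> i \<omega> *v (W (min t (b i)) \<omega> - W (min t (a i)) \<omega>))"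
    using assms(1) unfolding elementary_integral_def by blast
  show "(\<lambda>(t, \<omega>). H t \<omega>) \<in> borel_measurable (borel \<Otimes>\<^sub>M M)"
    unfolding H split_beta
  proof (intro borel_measurable_sum)
    fix i assume "i \<in> {..<N}"
    then have [measurable]: "\<xi> i \<in> borel_measurable M" using 1[of i] measurable_F_M by auto
    show "(\<lambda>x. indicator {a i<..b i} (fst x) *\<^sub>R \<xi> i (snd x)) \<in> borel_measurable (borel \<Otimes>\<^sub>M M)"
      by measurable
  qed
  show "J t \<in> borel_measurable (F t)" if t: "0 \<le> t"
    unfolding J
  proof (intro borel_measurable_sum)
    fix i assume "i \<in> {..<N}"
    then have i: "0 \<le> a i" "a i \<le> b i" "\<xi> i \<in> borel_measurable (F (a i))" using 1[of i] by auto
    show "(\<lambda>\<omega>. \<xi> i \<omega> *v (W (min t (b i)) \<omega> - W (min t (a i)) \<omega>)) \<in> borel_measurable (F t)"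
    proof (cases "a i \<le> t")
      case True
      have "\<xi> i \<in> borel_measurable (F t)" using measurable_F_mono[OF i(3) True] .
      moreover have "W (min t (b i)) \<in> borel_measurable (F t)" "W (min t (a i)) \<in> borel_measurable (F t)"
        using t i by (auto intro!: W_measurable_F)
      ultimately show ?thesis by measurable
    next
      case False
      \<comment> \<open>A coefficient that becomes known only after \<open>t\<close> meets an
        increment whose endpoints are both cut off at \<open>t\<close>, hence 0.\<close>
      then have "min t (b i) = t" "min t (a i) = t" using i by auto
      then show ?thesis by (simp add: matrix_vector_mult_def)
    qed
  qed
  have "AE \<omega> in M. continuous_on {0..} (\<lambda>t. W t \<omega>)" using brownian by (auto simp: brownian_motion_def)
  then show "AE \<omega> in M. continuous_on {0..} (\<lambda>t. J t \<omega>)"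
  proof eventually_elim
    case (elim \<omega>)
    have "continuous_on {0..} (\<lambda>t. W (min t c) \<omega>)" if "0 \<le> c" for c
      by (rule continuous_on_compose2[OF elim]) (use that in \<open>auto intro!: continuous_intros\<close>)
    then show ?case
      unfolding J matrix_vector_mult_def using 1
      by (intro continuous_intros) (auto intro: order_trans)
  qed
qed

text \<open>The bridge from overlapping intervals to a single grid, on which the discrete estimates
  apply. The times \<open>P\<close> are added to the endpoints so that \<open>J\<close> at such a
  time is a partial sum.\<close>

lemma elementary_integral_refine:
  assumes el: "elementary_integral M W H J" and P: "finite P" "P \<subseteq> {0..}"
  obtains p \<eta> n where "simple_integrand p \<eta>" "p 0 = 0" "\<And>t. t \<in> P \<Longrightarrow> \<exists>l\<le>n. t = p l"
    "\<And>l \<omega>. J (p l) \<omega> = simple_sum p \<eta> l \<omega>"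
    "\<And>k t \<omega>. t \<in> {p k<..p (Suc k)} \<Longrightarrow> H t \<omega> = \<eta> k \<omega>"
proof -
  obtain N a b \<xi> where 1: "\<And>i. i < (N::nat) \<Longrightarrow> 0 \<le> a i \<and> a i \<le> b i \<and> \<xi> i \<in> borel_measurable (F (a i)) \<and>
        (\<exists>C. \<forall>\<omega>\<in>space M. norm (\<xi> i \<omega>) \<le> C)"
      and H: "H = (\<lambda>t \<omega>. \<Sum>i<N. indicator {a i<..b i} t *\<^sub>R \<xi> i \<omega>)"
      and J: "J = (\<lambda>t \<omega>. \<Sum>i<N. \<xi> i \<omega> *v (W (min t (b i)) \<omega> - W (min t (a i)) \<omega>))"
    using el unfolding elementary_integral_def by blast
  define Q where "Q = insert 0 (P \<union> a ` {..<N} \<union> b ` {..<N})"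
  have "0 \<le> a i \<and> 0 \<le> b i" if "i < N" for i using 1[OF that] by auto
  then have Q: "finite Q" "Q \<subseteq> {0..}" "0 \<in> Q" using P by (auto simp: Q_def)
  define xs where "xs = sorted_list_of_set Q"
  have xs: "set xs = Q" "sorted xs" "xs \<noteq> []" using Q by (auto simp: xs_def)
  define n where "n = length xs - 1"
  \<comment> \<open>Past the last entry, with index \<open>n\<close>, the sequence stays
    constant.\<close>
  define p where "p k = xs ! (min k n)" for k
  have n: "k \<le> n \<Longrightarrow> k < length xs" for k using xs(3) by (cases xs) (auto simp: n_def)
  have p_mono: "p j \<le> p k" if "j \<le> k" for j k
    unfolding p_def using that n[of "min k n"] by (intro sorted_nth_mono xs(2)) auto
  have p_Q: "p k \<in> Q" for k unfolding p_def using n[of "min k n"] xs(1) by (metis min.cobounded2 nth_mem)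
  have p_ex: "\<exists>l\<le>n. t = p l" if "t \<in> Q" for t
  proof -
    have "t \<in> set xs" using that xs(1) by simp
    then obtain l where "l < length xs" "xs ! l = t" by (metis in_set_conv_nth)
    then show ?thesis by (intro exI[of _ l]) (auto simp: p_def n_def min_def)
  qed
  have p0: "p 0 = 0"
  proof -
    obtain l where "0 = p l" using p_ex[OF Q(3)] by blast
    then have "p 0 \<le> 0" using p_mono[of 0 l] by simp
    then show ?thesis using p_Q[of 0] Q(2) by auto
  qed
  have p_nonneg: "0 \<le> p k" for k using p_mono[of 0 k] p0 by simp
  \<comment> \<open>No endpoint lies strictly between consecutive grid points. Hence a cell is
    either contained in one of the given intervals or disjoint from it, up to endpoints.\<close>
  have next_le: "p (Suc l) \<le> c" if c: "p l < c" "c \<in> Q" for l c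
  proof -
    obtain j where "c = p j" using p_ex[OF c(2)] by blast
    then show ?thesis using c(1) p_mono[of j l] p_mono[of "Suc l" j] by (cases "j \<le> l") auto
  qed
  have aQ: "a i \<in> Q" "b i \<in> Q" "0 \<le> a i" "a i \<le> b i" if "i < N" for i using that 1 by (auto simp: Q_def)
  \<comment> \<open>Left-closed conditions on \<open>p k\<close> correspond to left-open ones on the
    times \<open>t\<close> in the cell \<open>{p k<..p (Suc k)}\<close>.\<close>
  define \<eta> where "\<eta> k \<omega> = (\<Sum>i<N. if a i \<le> p k \<and> p k < b i then \<xi> i \<omega> else 0)" for k \<omega>
  show ?thesis
  proof
    show "simple_integrand p \<eta>"
      unfolding simple_integrand_def
    proof (intro allI conjI)
      fix k
      show "0 \<le> p k" "p k \<le> p (Suc k)" using p_nonneg p_mono by auto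
      show "\<eta> k \<in> borel_measurable (F (p k))"
        unfolding \<eta>_def[abs_def]
      proof (intro borel_measurable_sum)
        fix i assume "i \<in> {..<N}"
        then have m: "\<xi> i \<in> borel_measurable (F (a i))" using 1[of i] by simp
        show "(\<lambda>\<omega>. if a i \<le> p k \<and> p k < b i then \<xi> i \<omega> else 0) \<in> borel_measurable (F (p k))"
        proof (cases "a i \<le> p k \<and> p k < b i")
          case True
          then show ?thesis using measurable_F_mono[OF m, of "p k"] by simp
        next
          case False
          show ?thesis by (simp only: False if_False borel_measurable_const)
        qed
      qed
      have "\<forall>i. \<exists>C. i < N \<longrightarrow> (\<forall>\<omega>\<in>space M. norm (\<xi> i \<omega>) \<le> C)" using 1 by blast
      then obtain C where C: "\<And>i \<omega>. i < N \<Longrightarrow> \<omega> \<in> space M \<Longrightarrow> norm (\<xi> i \<omega>) \<le> C i" by metis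
      have "norm (\<eta> k \<omega>) \<le> (\<Sum>i<N. \<bar>C i\<bar>)" if "\<omega> \<in> space M" for \<omega>
        unfolding \<eta>_def
      proof (rule sum_norm_le)
        fix i assume "i \<in> {..<N}"
        then have "norm (\<xi> i \<omega>) \<le> C i" using C that by auto
        then show "norm (if a i \<le> p k \<and> p k < b i then \<xi> i \<omega> else 0) \<le> \<bar>C i\<bar>"
          by (auto intro: order_trans[OF _ abs_ge_self])
      qed
      then show "\<exists>C. \<forall>\<omega>\<in>space M. norm (\<eta> k \<omega>) \<le> C" by blast
    qed
    show "p 0 = 0" by fact
    show "\<exists>l\<le>n. t = p l" if "t \<in> P" for t using p_ex that by (auto simp: Q_def)
    show "J (p l) \<omega> = simple_sum p \<eta> l \<omega>" for l \<omega>
    proof (induction l)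
      case 0
      have "min 0 (b i) = min 0 (a i)" if "i < N" for i using aQ[OF that] by auto
      then show ?case by (auto simp: J p0 simple_sum_def intro!: sum.neutral)
    next
      case (Suc l)
      have step: "W (min (p (Suc l)) (b i)) \<omega> - W (min (p (Suc l)) (a i)) \<omega> =
          (W (min (p l) (b i)) \<omega> - W (min (p l) (a i)) \<omega>) +
          (if a i \<le> p l \<and> p l < b i then W (p (Suc l)) \<omega> - W (p l) \<omega> else 0)" if "i < N" for i
      proof -
        note q = aQ[OF that] p_mono[of l "Suc l"]
        \<comment> \<open>The cell lies before, inside or after the interval; only inside does the
          clipped increment grow.\<close>
        consider "p l < a i" | "a i \<le> p l" "p l < b i" | "b i \<le> p l" by linarith
        then show ?thesis
        proof cases
          case 1
          then show ?thesis using next_le[OF 1] q by (simp add: min_def)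
        next
          case 2
          then have "min (p (Suc l)) (b i) = p (Suc l)" "min (p (Suc l)) (a i) = a i"
              "min (p l) (b i) = p l" "min (p l) (a i) = a i"
            using next_le[OF 2(2)] q by (auto simp: min_absorb1 min_absorb2)
          with 2 show ?thesis by simp
        next
          case 3
          then have "min (p (Suc l)) (b i) = b i" "min (p (Suc l)) (a i) = a i"
              "min (p l) (b i) = b i" "min (p l) (a i) = a i"
            using q by (auto simp: min_absorb1 min_absorb2)
          with 3 show ?thesis by simp
        qed
      qed
      have "J (p (Suc l)) \<omega> = J (p l) \<omega> + (\<Sum>i<N. \<xi> i \<omega> *v (if a i \<le> p l \<and> p l < b i then W (p (Suc l)) \<omega> - W (p l) \<omega> else 0))"
        unfolding J sum.distrib[symmetric] by (intro sum.cong) (simp_all add: step matrix_vector_right_distrib)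
      also have "(\<Sum>i<N. \<xi> i \<omega> *v (if a i \<le> p l \<and> p l < b i then W (p (Suc l)) \<omega> - W (p l) \<omega> else 0)) =
          (\<Sum>i<N. (if a i \<le> p l \<and> p l < b i then \<xi> i \<omega> else 0) *v (W (p (Suc l)) \<omega> - W (p l) \<omega>))"
        by (intro sum.cong) (auto simp: matrix_vector_mult_def zero_vec_def)
      also have "\<dots> = \<eta> l \<omega> *v (W (p (Suc l)) \<omega> - W (p l) \<omega>)"
        unfolding \<eta>_def by (induction N) (simp_all add: matrix_vector_mult_add_rdistrib)
      finally show ?case using Suc by (simp add: simple_sum_def)
    qed
    show "H t \<omega> = \<eta> k \<omega>" if t: "t \<in> {p k<..p (Suc k)}" for k t \<omega>
      unfolding H \<eta>_def
    proof (intro sum.cong refl)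
      fix i assume "i \<in> {..<N}"
      then have "a i \<in> Q" "b i \<in> Q" using aQ by auto
      then have "a i < t \<and> t \<le> b i \<longleftrightarrow> a i \<le> p k \<and> p k < b i"
        using t next_le[of k "a i"] next_le[of k "b i"] by force
      then show "indicator {a i<..b i} t *\<^sub>R \<xi> i \<omega> = (if a i \<le> p k \<and> p k < b i then \<xi> i \<omega> else 0)"
        by (auto simp: indicator_def)
    qed
  qed
qed

text \<open>The right-hand side is the variance produced by the discrete isometry; this rewrites it
  without reference to the grid.\<close>

lemma simple_integrand_energy:
  assumes p: "simple_integrand p \<eta>" "p 0 = 0"
    and H: "(\<lambda>(t, \<omega>). H t \<omega>) \<in> borel_measurable (borel \<Otimes>\<^sub>M M)"
      "\<And>k t \<omega>. t \<in> {p k<..p (Suc k)} \<Longrightarrow> H t \<omega> = \<eta> k \<omega>"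
  shows "(\<integral>\<^sup>+t\<in>{0..p n}. msq M (\<lambda>\<omega>. H t \<omega>) \<partial>lborel) =
    ennreal (\<Sum>k<n. (p (Suc k) - p k) * expectation (\<lambda>\<omega>. (norm (\<eta> k \<omega>))\<^sup>2))"
proof (induction n)
  case 0
  \<comment> \<open>Time 0 belongs to no half-open cell, so \<open>H\<close> is not described by
    \<open>\<eta>\<close> there; it is a null set.\<close>
  have "(\<integral>\<^sup>+t. msq M (\<lambda>\<omega>. H t \<omega>) * indicator {0..p 0} t \<partial>lborel) = (\<integral>\<^sup>+t. 0 \<partial>(lborel :: real measure))"
    using AE_lborel_singleton[of 0] p(2) by (intro nn_integral_cong_AE) auto
  then show ?case by simp
next
  case (Suc n)
  let ?h = "\<lambda>t. \<integral>\<^sup>+\<omega>. sqn (H t \<omega>) \<partial>M"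
  have [measurable]: "(\<lambda>x. H (fst x) (snd x)) \<in> borel_measurable (borel \<Otimes>\<^sub>M M)"
    using H(1) by (simp add: split_beta)
  have [measurable]: "?h \<in> borel_measurable borel"
    by (rule borel_measurable_nn_integral) (simp add: split_beta)
  note int = simple_integrand_integrable[OF p(1), of n]
  have pp: "p k \<le> p (Suc k)" for k using p(1) by (simp add: simple_integrand_def)
  have p0: "0 \<le> p n" "p n \<le> p (Suc n)" using p(1) by (auto simp: simple_integrand_def)
  have "{0..p (Suc n)} = {0..p n} \<union> {p n<..p (Suc n)}" using p0 by auto
  then have "(\<integral>\<^sup>+t\<in>{0..p (Suc n)}. ?h t \<partial>lborel) = (\<integral>\<^sup>+t\<in>{0..p n}. ?h t \<partial>lborel) + (\<integral>\<^sup>+t\<in>{p n<..p (Suc n)}. ?h t \<partial>lborel)"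
    by (simp only:) (rule nn_integral_disjoint_pair; auto)
  also have "(\<integral>\<^sup>+t\<in>{p n<..p (Suc n)}. ?h t \<partial>lborel) =
      (\<integral>\<^sup>+t\<in>{p n<..p (Suc n)}. ennreal (expectation (\<lambda>\<omega>. (norm (\<eta> n \<omega>))\<^sup>2)) \<partial>lborel)"
    using nn_integral_eq_integral[OF int]
    by (intro nn_integral_cong) (auto simp: indicator_def H(2))
  also have "\<dots> = ennreal ((p (Suc n) - p n) * expectation (\<lambda>\<omega>. (norm (\<eta> n \<omega>))\<^sup>2))"
    using p0 by (subst nn_integral_cmult_indicator) (auto simp: ennreal_mult[symmetric] mult.commute)
  also have "(\<integral>\<^sup>+t\<in>{0..p n}. ?h t \<partial>lborel) = ennreal (\<Sum>k<n. (p (Suc k) - p k) * expectation (\<lambda>\<omega>. (norm (\<eta> k \<omega>))\<^sup>2))"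
    by (rule Suc)
  finally show ?case
    using pp by (simp add: ennreal_plus[symmetric] sum_nonneg del: ennreal_plus)
qed

lemma elementary_isometry:
  assumes el: "elementary_integral M W H J" and t: "0 \<le> t"
  shows "msq M (\<lambda>\<omega>. J t \<omega>) =
    (\<integral>\<^sup>+s\<in>{0..t}. msq M (\<lambda>\<omega>. H s \<omega>) \<partial>lborel)"
proof -
  have fin: "finite {t}" "{t} \<subseteq> {0..}" using t by auto
  obtain p \<eta> n where p: "simple_integrand p \<eta>" "p 0 = 0" "\<And>t'. t' \<in> {t} \<Longrightarrow> \<exists>l\<le>n. t' = p l"
    "\<And>l \<omega>. J (p l) \<omega> = simple_sum p \<eta> l \<omega>"
    "\<And>k t \<omega>. t \<in> {p k<..p (Suc k)} \<Longrightarrow> H t \<omega> = \<eta> k \<omega>"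
    by (rule elementary_integral_refine[OF el fin], rule that, assumption+)
  obtain l where l: "t = p l" using p(3) by auto
  have "msq M (\<lambda>\<omega>. simple_sum p \<eta> l \<omega>) =
      ennreal (\<Sum>k<l. (p (Suc k) - p k) * expectation (\<lambda>\<omega>. (norm (\<eta> k \<omega>))\<^sup>2))"
    using simple_sum_isometry[OF p(1), of l] by (subst nn_integral_eq_integral) auto
  also have "\<dots> = (\<integral>\<^sup>+s\<in>{0..p l}. msq M (\<lambda>\<omega>. H s \<omega>) \<partial>lborel)"
    by (rule simple_integrand_energy[OF p(1,2) elementary_integral_measurable(1)[OF el] p(5), symmetric])
  finally show ?thesis by (simp only: l p(4))
qed

lemma elementary_maximal:
  assumes el: "elementary_integral M W H J" and P: "finite P" "P \<subseteq> {0..T}" and T: "0 \<le> T" and c: "0 < c"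
  shows "ennreal (c\<^sup>2) * emeasure M {\<omega>\<in>space M. \<exists>t\<in>P. c \<le> norm (J t \<omega>)} \<le>
    (\<integral>\<^sup>+s\<in>{0..T}. msq M (\<lambda>\<omega>. H s \<omega>) \<partial>lborel)"
proof -
  have fin: "finite (insert T P)" "insert T P \<subseteq> {0..}" using P T by auto
  obtain p \<eta> n where p: "simple_integrand p \<eta>" "p 0 = 0" "\<And>t'. t' \<in> insert T P \<Longrightarrow> \<exists>l\<le>n. t' = p l"
    "\<And>l \<omega>. J (p l) \<omega> = simple_sum p \<eta> l \<omega>"
    "\<And>k t \<omega>. t \<in> {p k<..p (Suc k)} \<Longrightarrow> H t \<omega> = \<eta> k \<omega>"
    by (rule elementary_integral_refine[OF el fin], rule that, assumption+)
  obtain l where l: "T = p l" using p(3) by auto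
  \<comment> \<open>A time of \<open>P\<close> may have been found at an index beyond
    \<open>l\<close>, because the grid may repeat a value. As it does not exceed
    \<open>T = p l\<close>, it then equals \<open>p l\<close>.\<close>
  have before: "\<exists>k\<le>l. t = p k" if t: "t \<in> P" for t
  proof -
    obtain k where k: "t = p k" using p(3) t by blast
    have "p k \<le> p l" using P(2) t k l by auto
    show ?thesis
    proof (cases "k \<le> l")
      case False
      then have "p k = p l" using simple_integrand_mono[OF p(1), of l k] \<open>p k \<le> p l\<close> by simp
      with k show ?thesis by auto
    qed (use k in auto)
  qed
  have [measurable]: "simple_sum p \<eta> k \<in> borel_measurable M" for k
    using simple_sum_measurable_F[OF p(1) order_refl] by (rule measurable_F_M)
  let ?A = "{\<omega>\<in>space M. \<exists>k\<le>l. c \<le> norm (simple_sum p \<eta> k \<omega>)}"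
  have "{\<omega>\<in>space M. \<exists>t\<in>P. c \<le> norm (J t \<omega>)} \<subseteq> ?A"
    using before p(4) by fastforce
  then have "emeasure M {\<omega>\<in>space M. \<exists>t\<in>P. c \<le> norm (J t \<omega>)} \<le> ennreal (prob ?A)"
    unfolding emeasure_eq_measure[symmetric] by (intro emeasure_mono) measurable
  then have "ennreal (c\<^sup>2) * emeasure M {\<omega>\<in>space M. \<exists>t\<in>P. c \<le> norm (J t \<omega>)} \<le> ennreal (c\<^sup>2) * ennreal (prob ?A)"
    by (intro mult_left_mono) auto
  also have "\<dots> = ennreal (c\<^sup>2 * prob ?A)" by (simp add: ennreal_mult)
  also have "\<dots> \<le> ennreal (\<Sum>k<l. (p (Suc k) - p k) * expectation (\<lambda>\<omega>. (norm (\<eta> k \<omega>))\<^sup>2))"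
    by (intro ennreal_leI simple_sum_maximal p(1) c)
  also have "\<dots> = (\<integral>\<^sup>+s\<in>{0..p l}. msq M (\<lambda>\<omega>. H s \<omega>) \<partial>lborel)"
    by (rule simple_integrand_energy[OF p(1,2) elementary_integral_measurable(1)[OF el] p(5), symmetric])
  finally show ?thesis by (simp only: l)
qed

end

section \<open>Translation continuity and density of elementary processes\<close>

text \<open>For arguments in which an approximation of quality \<open>k\<close> is fixed before
  \<open>n\<close> grows.\<close>

lemma tendsto_0_ennreal_approx:
  fixes a :: "nat \<Rightarrow> ennreal"
  assumes le: "\<And>k n. a n \<le> e k + d k n" and e: "e \<longlonglongrightarrow> 0" and d: "\<And>k::nat. d k \<longlonglongrightarrow> 0"
  shows "a \<longlonglongrightarrow> 0"
proof (rule order_tendstoI)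
  fix c :: ennreal assume c: "0 < c"
  have "\<forall>\<^sub>F k in sequentially. e k < c" using e c by (rule order_tendstoD)
  then obtain k where k: "e k < c" by (auto simp: eventually_sequentially)
  have "(\<lambda>n. e k + d k n) \<longlonglongrightarrow> e k + 0" by (intro tendsto_add tendsto_const d)
  then have "\<forall>\<^sub>F n in sequentially. e k + d k n < c" using k by (auto intro: order_tendstoD)
  then show "\<forall>\<^sub>F n in sequentially. a n < c"
    by eventually_elim (use le[of _ k] in \<open>auto intro: le_less_trans\<close>)
qed auto

text \<open>The source of the factors 3 below. Sums of two terms are treated as sums of three with
  one term 0.\<close>

lemma norm_add3_sq: "(norm (x + y + z :: 'v::real_normed_vector))\<^sup>2 \<le> 3 * ((norm x)\<^sup>2 + (norm y)\<^sup>2 + (norm z)\<^sup>2)"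
proof -
  have "(norm (x + y + z))\<^sup>2 \<le> (norm x + norm y + norm z)\<^sup>2"
    by (intro power_mono order_trans[OF norm_triangle_ineq] add_right_mono norm_triangle_ineq) auto
  also have "\<dots> \<le> 3 * ((norm x)\<^sup>2 + (norm y)\<^sup>2 + (norm z)\<^sup>2)"
    using sum_squares_bound[of "norm x" "norm y"] sum_squares_bound[of "norm x" "norm z"]
      sum_squares_bound[of "norm y" "norm z"]
    by (simp add: power2_eq_square algebra_simps)
  finally show ?thesis .
qed

lemma ennreal_norm_add3_sq:
  "sqn (x + y + z :: 'v::real_normed_vector) \<le>
    3 * (sqn x + sqn y + sqn z)"
proof -
  have "sqn (x + y + z) \<le> ennreal (3 * ((norm x)\<^sup>2 + (norm y)\<^sup>2 + (norm z)\<^sup>2))"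
    by (intro ennreal_leI norm_add3_sq)
  then show ?thesis by (simp add: ennreal_mult'')
qed

lemma nn_integral_translate:
  fixes f :: "real \<Rightarrow> ennreal"
  assumes "f \<in> borel_measurable borel"
  shows "(\<integral>\<^sup>+u. f (u + r) \<partial>lborel) = (\<integral>\<^sup>+u. f u \<partial>lborel)"
  using nn_integral_real_affine[of f 1 r] assms by (simp add: add.commute)

lemma bounded_nn_integral_tendsto_0:
  fixes u :: "nat \<Rightarrow> real \<Rightarrow> 'v::euclidean_space"
  assumes [measurable]: "\<And>n. u n \<in> borel_measurable borel"
    and bd: "\<And>n x. norm (u n x) \<le> C" and lim: "AE x in lborel. (\<lambda>n. u n x) \<longlonglongrightarrow> 0"
  shows "(\<lambda>n. \<integral>\<^sup>+x\<in>{a..b}. sqn (u n x) \<partial>lborel) \<longlonglongrightarrow> 0"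
proof -
  have "(\<lambda>n. \<integral>\<^sup>+x. sqn (u n x) * indicator {a..b} x \<partial>lborel) \<longlonglongrightarrow> (\<integral>\<^sup>+x. 0 \<partial>(lborel::real measure))"
  proof (rule nn_integral_dominated_convergence[where w="\<lambda>x. ennreal (C\<^sup>2) * indicator {a..b} x"])
    show "AE x in lborel. sqn (u n x) * indicator {a..b} x \<le> ennreal (C\<^sup>2) * indicator {a..b} x" for n
      using bd[of n] by (intro AE_I2 mult_right_mono ennreal_leI power_mono) auto
    show "(\<integral>\<^sup>+x. ennreal (C\<^sup>2) * indicator {a..b} x \<partial>lborel) < \<infinity>"
      by (subst nn_integral_cmult_indicator) (auto simp: ennreal_mult_less_top emeasure_lborel_Icc_eq)
    show "AE x in lborel. (\<lambda>n. sqn (u n x) * indicator {a..b} x) \<longlonglongrightarrow> 0"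
      using lim
    proof eventually_elim
      case (elim x)
      have "(\<lambda>n. (norm (u n x))\<^sup>2) \<longlonglongrightarrow> (norm (0::'v))\<^sup>2"
        by (intro tendsto_intros elim)
      then have "(\<lambda>n. sqn (u n x)) \<longlonglongrightarrow> 0"
        by (metis ennreal_0 norm_zero tendsto_ennrealI zero_power2)
      then show ?case
        by (cases "x \<in> {a..b}") auto
    qed
  qed auto
  then show ?thesis by simp
qed

text \<open>Approximation by continuous functions, for which the claim is dominated convergence. The
  difference is split into two approximation errors, one of them translated, and the translation
  error of the continuous function.\<close>

lemma translation_continuity:
  fixes \<phi> :: "real \<Rightarrow> 'v::euclidean_space"
  assumes [measurable]: "\<phi> \<in> borel_measurable borel" and bd: "\<And>u. norm (\<phi> u) \<le> B"
    and supp: "\<And>u. u \<notin> {0..T} \<Longrightarrow> \<phi> u = 0"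
    and r: "r \<longlonglongrightarrow> 0" "\<And>n. \<bar>r n\<bar> \<le> 1"
  shows "(\<lambda>n. \<integral>\<^sup>+u. sqn (\<phi> u - \<phi> (u + r n)) \<partial>lborel) \<longlonglongrightarrow> 0"
proof -
  have B: "0 \<le> B" using bd[of 0] norm_ge_zero order_trans by blast
  \<comment> \<open>This notion of measurability supplies continuous functions that converge to
    \<open>\<phi>\<close> off a negligible set.\<close>
  have "\<phi> measurable_on UNIV"
    by (intro lebesgue_measurable_imp_measurable_on measurable_completion) auto
  then obtain N g where N: "negligible N" and g: "\<And>k. continuous_on UNIV (g k)"
      and lim: "\<And>x. x \<notin> N \<Longrightarrow> (\<lambda>k. g k x) \<longlonglongrightarrow> \<phi> x"
    unfolding measurable_on_def by auto
  let ?P = "closest_point (cball (0::'v) B)"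
  have P: "continuous_on A ?P" for A
    using B by (intro continuous_on_closest_point) auto
  define G where "G k x = ?P (g k x)" for k x
  have G: "continuous_on UNIV (G k)" for k
    unfolding G_def by (rule continuous_on_compose2[OF P g]) auto
  then have [measurable]: "G k \<in> borel_measurable borel" for k
    by (intro borel_measurable_continuous_onI) simp
  have G_bd: "norm (G k x) \<le> B" for k x
    using closest_point_in_set[of "cball (0::'v) B" "g k x"] B unfolding G_def by auto
  have G_lim: "(\<lambda>k. G k x) \<longlonglongrightarrow> \<phi> x" if "x \<notin> N" for x
  proof -
    have "(\<lambda>k. ?P (g k x)) \<longlonglongrightarrow> ?P (\<phi> x)"
      using continuous_on_tendsto_compose[OF P[of UNIV] lim[OF that]] by auto
    also have "?P (\<phi> x) = \<phi> x" using bd by (intro closest_point_self) auto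
    finally show ?thesis by (simp add: G_def)
  qed
  have AE_N: "AE x in lborel. x \<notin> N"
    using AE_not_in[of N lebesgue] N by (simp add: negligible_iff_null_sets AE_completion_iff)
  \<comment> \<open>Shifts have length at most 1, so the integrand vanishes unless \<open>u\<close>
    is in \<open>{-1..T+1}\<close>, and then \<open>u + r n\<close> is in this window as well. A
    bounded window makes constants integrable.\<close>
  let ?K = "{-2..T+2}"
  define e where "e k = (\<integral>\<^sup>+u\<in>?K. sqn (\<phi> u - G k u) \<partial>lborel)" for k
  define d where "d k n = (\<integral>\<^sup>+u\<in>?K. sqn (G k u - G k (u + r n)) \<partial>lborel)" for k n
  have diff_bd: "norm (x - y) \<le> 2 * B" if "norm x \<le> B" "norm y \<le> B" for x y :: 'v
    using norm_triangle_ineq4[of x y] that by linarith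
  have e_lim: "e \<longlonglongrightarrow> 0"
    unfolding e_def
  proof (rule bounded_nn_integral_tendsto_0[where C="2*B"])
    show "norm (\<phi> x - G k x) \<le> 2 * B" for k x using diff_bd bd G_bd by blast
    show "AE x in lborel. (\<lambda>k. \<phi> x - G k x) \<longlonglongrightarrow> 0"
      using AE_N
    proof eventually_elim
      case (elim x)
      show ?case using tendsto_diff[OF tendsto_const G_lim[OF elim], of "\<phi> x"] by simp
    qed
  qed measurable
  have d_lim: "d k \<longlonglongrightarrow> 0" for k
    unfolding d_def
  proof (rule bounded_nn_integral_tendsto_0[where C="2*B"])
    show "norm (G k x - G k (x + r n)) \<le> 2 * B" for n x using diff_bd G_bd by blast
    show "AE x in lborel. (\<lambda>n. G k x - G k (x + r n)) \<longlonglongrightarrow> 0"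
    proof (rule AE_I2)
      fix x
      have "(\<lambda>n. x + r n) \<longlonglongrightarrow> x" using tendsto_add[OF tendsto_const r(1), of x] by simp
      then have "(\<lambda>n. G k (x + r n)) \<longlonglongrightarrow> G k x"
        using continuous_on_tendsto_compose[OF G] by auto
      then show "(\<lambda>n. G k x - G k (x + r n)) \<longlonglongrightarrow> 0"
        using tendsto_diff[OF tendsto_const, of _ _ _ "G k x"] by fastforce
    qed
  qed measurable
  show ?thesis
  proof (rule tendsto_0_ennreal_approx)
    \<comment> \<open>Twice the factor 3: by translation invariance the shifted approximation error
      has the same integral as the unshifted one.\<close>
    show "(\<lambda>k. 6 * e k) \<longlonglongrightarrow> 0"
      using ennreal_tendsto_cmult[OF _ e_lim, of 6] by simp
    show "(\<lambda>n. 3 * d k n) \<longlonglongrightarrow> 0" for k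
      using ennreal_tendsto_cmult[OF _ d_lim, of 3] by simp
    fix k n
    let ?e = "\<lambda>u. sqn (\<phi> u - G k u) * indicator ?K u"
    let ?d = "\<lambda>u. sqn (G k u - G k (u + r n)) * indicator ?K u"
    have "sqn (\<phi> u - \<phi> (u + r n)) \<le> 3 * (?e u + ?d u + ?e (u + r n))" for u
    proof (cases "u \<in> {-1..T+1}")
      case True
      then have "u \<in> ?K" "u + r n \<in> ?K" using r(2)[of n] by auto
      then show ?thesis
        using ennreal_norm_add3_sq[of "\<phi> u - G k u" "G k u - G k (u + r n)" "G k (u + r n) - \<phi> (u + r n)"]
        by (simp add: norm_minus_commute)
    next
      case False
      then have "\<phi> u = 0" "\<phi> (u + r n) = 0" using r(2)[of n] by (auto intro!: supp)
      then show ?thesis by simp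
    qed
    then have "(\<integral>\<^sup>+u. sqn (\<phi> u - \<phi> (u + r n)) \<partial>lborel) \<le>
        (\<integral>\<^sup>+u. 3 * (?e u + ?d u + ?e (u + r n)) \<partial>lborel)"
      by (intro nn_integral_mono) auto
    also have "\<dots> = 3 * ((\<integral>\<^sup>+u. ?e u \<partial>lborel) + (\<integral>\<^sup>+u. ?d u \<partial>lborel) + (\<integral>\<^sup>+u. ?e (u + r n) \<partial>lborel))"
      by (subst nn_integral_cmult, measurable, subst nn_integral_add, measurable, subst nn_integral_add, measurable)
    also have "(\<integral>\<^sup>+u. ?e (u + r n) \<partial>lborel) = (\<integral>\<^sup>+u. ?e u \<partial>lborel)"
      by (rule nn_integral_translate[of ?e]) measurable
    also have "3 * ((\<integral>\<^sup>+u. ?e u \<partial>lborel) + (\<integral>\<^sup>+u. ?d u \<partial>lborel) + (\<integral>\<^sup>+u. ?e u \<partial>lborel)) = 6 * e k + 3 * d k n"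
    proof -
      have "3 * (a + b + a) = 6 * a + 3 * b" for a b :: ennreal
        by (simp add: distrib_left mult_2_right add_ac) (metis (no_types) add.commute add.left_commute distrib_right numeral_Bit0 numeral_Bit1 numeral_plus_numeral semiring_norm(2) mult_numeral_1)
      then show ?thesis by (simp add: e_def d_def)
    qed
    finally show "(\<integral>\<^sup>+u. sqn (\<phi> u - \<phi> (u + r n)) \<partial>lborel) \<le> 6 * e k + 3 * d k n" .
  qed
qed

text \<open>Averaging the mean square error of all discretisations of mesh \<open>h\<close> over the offset \<open>s\<close> of the
  grid produces a full integral over time, which is then controlled by the continuity of translations.\<close>

lemma grid_offset_average:
  fixes D :: "real \<Rightarrow> real \<Rightarrow> ennreal"
  assumes D[measurable]: "(\<lambda>(u, r). D u r) \<in> borel_measurable (borel \<Otimes>\<^sub>M borel)" and h: "0 < h"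
  shows "(\<integral>\<^sup>+s\<in>{0..<h}. (\<Sum>k<K. \<integral>\<^sup>+r\<in>{0..h}. D (s + (real k - 1) * h) r \<partial>lborel) \<partial>lborel) \<le>
    (\<integral>\<^sup>+r\<in>{0..h}. (\<integral>\<^sup>+u. D u r \<partial>lborel) \<partial>lborel)"
proof -
  let ?c = "\<lambda>k. (real k - 1) * h"
  have [measurable]: "(\<lambda>x. D (f x) (g x)) \<in> borel_measurable N"
    if "f \<in> borel_measurable N" "g \<in> borel_measurable N" for f g and N :: "'z measure"
    using measurable_compose[OF measurable_Pair[OF that] D] by (simp add: split_beta)
  \<comment> \<open>Substituting \<open>u = s + (k - 1) h\<close> moves the offsets to consecutive
    cells. These tile an interval, so their indicators sum to at most 1 and the sum over
    \<open>k\<close> is bounded by one integral over the line.\<close>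
  have ind: "(\<Sum>k<K. indicator {?c k..<?c k + h} u :: ennreal) = indicator {- h..<(real K - 1) * h} u" for u
  proof (induction K)
    case (Suc K)
    define c where "c = real K * h"
    have c: "0 \<le> c" "(real (Suc K) - 1) * h = c" "(real K - 1) * h = c - h"
      using h by (auto simp: c_def algebra_simps)
    show ?case unfolding sum.lessThan_Suc Suc c(2,3)
      using h c(1) by (auto simp: indicator_def)
  qed simp
  have "(\<integral>\<^sup>+s\<in>{0..<h}. (\<Sum>k<K. \<integral>\<^sup>+r\<in>{0..h}. D (s + ?c k) r \<partial>lborel) \<partial>lborel) =
      (\<integral>\<^sup>+s. (\<integral>\<^sup>+r. (\<Sum>k<K. D (s + ?c k) r * indicator {0..h} r * indicator {0..<h} s) \<partial>lborel) \<partial>lborel)"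
  proof (rule nn_integral_cong)
    fix s :: real
    show "(\<Sum>k<K. \<integral>\<^sup>+r\<in>{0..h}. D (s + ?c k) r \<partial>lborel) * indicator {0..<h} s =
      (\<integral>\<^sup>+r. (\<Sum>k<K. D (s + ?c k) r * indicator {0..h} r * indicator {0..<h} s) \<partial>lborel)"
      by (subst nn_integral_sum, measurable) (simp add: nn_integral_multc sum_distrib_right)
  qed
  also have "\<dots> = (\<integral>\<^sup>+r. (\<integral>\<^sup>+s. (\<Sum>k<K. D (s + ?c k) r * indicator {0..h} r * indicator {0..<h} s) \<partial>lborel) \<partial>lborel)"
    by (rule lborel_pair.Fubini') measurable
  also have "\<dots> = (\<integral>\<^sup>+r. (\<Sum>k<K. \<integral>\<^sup>+u. D u r * indicator {0..h} r * indicator {?c k..<?c k + h} u \<partial>lborel) \<partial>lborel)"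
  proof (intro nn_integral_cong)
    fix r :: real
    have "(\<integral>\<^sup>+s. D (s + ?c k) r * indicator {0..h} r * indicator {0..<h} s \<partial>lborel) =
        (\<integral>\<^sup>+u. D u r * indicator {0..h} r * indicator {?c k..<?c k + h} u \<partial>lborel)" for k
    proof -
      have "(\<integral>\<^sup>+s. D (s + ?c k) r * indicator {0..h} r * indicator {?c k..<?c k + h} (s + ?c k) \<partial>lborel) =
        (\<integral>\<^sup>+u. D u r * indicator {0..h} r * indicator {?c k..<?c k + h} u \<partial>lborel)"
        by (rule nn_integral_translate[of "\<lambda>u. D u r * indicator {0..h} r * indicator {?c k..<?c k + h} u"]) measurable
      moreover have "indicator {?c k..<?c k + h} (s + ?c k) = (indicator {0..<h} s :: ennreal)" for s
        by (auto simp: indicator_def)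
      ultimately show ?thesis by simp
    qed
    then show "(\<integral>\<^sup>+s. (\<Sum>k<K. D (s + ?c k) r * indicator {0..h} r * indicator {0..<h} s) \<partial>lborel) =
        (\<Sum>k<K. \<integral>\<^sup>+u. D u r * indicator {0..h} r * indicator {?c k..<?c k + h} u \<partial>lborel)"
      by (subst nn_integral_sum) auto
  qed
  also have "\<dots> \<le> (\<integral>\<^sup>+r. (\<integral>\<^sup>+u. D u r \<partial>lborel) * indicator {0..h} r \<partial>lborel)"
  proof (intro nn_integral_mono)
    fix r :: real
    have "(\<Sum>k<K. \<integral>\<^sup>+u. D u r * indicator {0..h} r * indicator {?c k..<?c k + h} u \<partial>lborel) =
        (\<integral>\<^sup>+u. D u r * indicator {0..h} r * (\<Sum>k<K. indicator {?c k..<?c k + h} u) \<partial>lborel)"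
      by (subst nn_integral_sum[symmetric]) (auto simp: sum_distrib_left)
    also have "\<dots> \<le> (\<integral>\<^sup>+u. D u r * indicator {0..h} r \<partial>lborel)"
      unfolding ind by (intro nn_integral_mono) (auto simp: indicator_def)
    also have "\<dots> = (\<integral>\<^sup>+u. D u r \<partial>lborel) * indicator {0..h} r"
      by (rule nn_integral_multc) measurable
    finally show "(\<Sum>k<K. \<integral>\<^sup>+u. D u r * indicator {0..h} r * indicator {?c k..<?c k + h} u \<partial>lborel) \<le>
        (\<integral>\<^sup>+u. D u r \<partial>lborel) * indicator {0..h} r" .
  qed
  finally show ?thesis .
qed

text \<open>Moves the average over lags to the fixed interval \<open>{0..1}\<close>, where dominated
  convergence can be used as \<open>h\<close> tends to 0. The factor \<open>h\<close> released here
  cancels the length of the range of offsets.\<close>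

lemma nn_integral_scale_Icc:
  fixes E :: "real \<Rightarrow> ennreal"
  assumes [measurable]: "E \<in> borel_measurable borel" and h: "0 < h"
  shows "(\<integral>\<^sup>+r\<in>{0..h}. E r \<partial>lborel) = ennreal h * (\<integral>\<^sup>+\<rho>\<in>{0..1}. E (h * \<rho>) \<partial>lborel)"
proof -
  have "(\<integral>\<^sup>+r\<in>{0..h}. E r \<partial>lborel) = ennreal h * (\<integral>\<^sup>+\<rho>. E (h * \<rho>) * indicator {0..h} (h * \<rho>) \<partial>lborel)"
    using nn_integral_real_affine[of "\<lambda>r. E r * indicator {0..h} r" h 0] h by simp
  moreover have "indicator {0..h} (h * \<rho>) = (indicator {0..1} \<rho> :: ennreal)" for \<rho>
    using h by (auto simp: indicator_def zero_le_mult_iff)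
  ultimately show ?thesis by simp
qed

lemma below_average_exists:
  fixes C :: "real \<Rightarrow> ennreal"
  assumes le: "(\<integral>\<^sup>+s\<in>{0..<h}. C s \<partial>lborel) \<le> ennreal h * A" and h: "0 < h" and A: "A < \<epsilon>"
  shows "\<exists>s\<in>{0..<h}. C s < \<epsilon>"
proof (rule ccontr)
  assume "\<not> ?thesis"
  then have "\<And>s. s \<in> {0..<h} \<Longrightarrow> \<epsilon> \<le> C s" by (auto simp: not_less)
  then have "(\<integral>\<^sup>+s\<in>{0..<h}. \<epsilon> \<partial>lborel) \<le> (\<integral>\<^sup>+s\<in>{0..<h}. C s \<partial>lborel)"
    by (intro nn_integral_mono) (auto simp: indicator_def)
  also have "\<dots> \<le> ennreal h * A" by fact
  finally have "ennreal h * \<epsilon> \<le> ennreal h * A"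
    using h by (subst (asm) nn_integral_cmult_indicator) (auto simp: mult.commute)
  then have "\<epsilon> \<le> A"
    using h by (subst (asm) ennreal_mult_le_mult_iff) auto
  with A show False by simp
qed

section \<open>Translation continuity in mean square\<close>

context prob_space
begin

text \<open>Translation continuity holds path by path. Two applications of dominated convergence,
  first in \<open>\<omega>\<close> and then in \<open>\<rho>\<close>, carry it to the mean; Fubini's
  theorem restores the order of integration in the statement.\<close>

lemma translation_average:
  fixes H :: "real \<Rightarrow> 'a \<Rightarrow> 'v::euclidean_space"
  assumes H: "(\<lambda>(t, \<omega>). H t \<omega>) \<in> borel_measurable (borel \<Otimes>\<^sub>M M)"
    and bd: "\<And>t \<omega>. norm (H t \<omega>) \<le> B" and supp: "\<And>t \<omega>. t \<notin> {0..T} \<Longrightarrow> H t \<omega> = 0"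
  shows "(\<lambda>n. \<integral>\<^sup>+\<rho>\<in>{0..1}. (\<integral>\<^sup>+u. msq M (\<lambda>\<omega>. H u \<omega> - H (u + 1 / real (Suc n) * \<rho>) \<omega>) \<partial>lborel) \<partial>lborel) \<longlonglongrightarrow> 0"
proof -
  interpret pair_sigma_finite lborel M ..
  have [measurable]: "(\<lambda>x. H (f x) (g x)) \<in> borel_measurable N"
    if "f \<in> borel_measurable N" "g \<in> measurable N M" for f g and N :: "'z measure"
    using measurable_compose[OF measurable_Pair[OF that] H] by (simp add: split_beta)
  define q where "q r \<omega> = (\<integral>\<^sup>+u. sqn (H u \<omega> - H (u + r) \<omega>) \<partial>lborel)" for r \<omega>
  have [measurable]: "(\<lambda>x. q (fst x) (snd x)) \<in> borel_measurable (borel \<Otimes>\<^sub>M M)"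
    unfolding q_def by measurable
  have [measurable]: "q r \<in> borel_measurable M" for r
    unfolding q_def[abs_def] by measurable
  \<comment> \<open>For shifts of length at most 1 the difference is bounded by \<open>2 * B\<close>
    and vanishes off \<open>{-1..T+1}\<close>.\<close>
  define C where "C = ennreal ((2 * B)\<^sup>2) * emeasure lborel {-1..T+1}"
  have C_fin: "C < \<infinity>"
    unfolding C_def by (auto simp: ennreal_mult_less_top emeasure_lborel_Icc_eq)
  have q_bd: "q r \<omega> \<le> C" if "\<bar>r\<bar> \<le> 1" for r \<omega>
  proof -
    have "q r \<omega> \<le> (\<integral>\<^sup>+u. ennreal ((2 * B)\<^sup>2) * indicator {-1..T+1} u \<partial>lborel)"
      unfolding q_def
    proof (rule nn_integral_mono)
      fix u
      show "sqn (H u \<omega> - H (u + r) \<omega>) \<le> ennreal ((2 * B)\<^sup>2) * indicator {-1..T+1} u"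
      proof (cases "u \<in> {-1..T+1}")
        case True
        have "norm (H u \<omega> - H (u + r) \<omega>) \<le> 2 * B"
          using norm_triangle_ineq4[of "H u \<omega>" "H (u + r) \<omega>"] bd[of u \<omega>] bd[of "u + r" \<omega>] by linarith
        then have "sqn (H u \<omega> - H (u + r) \<omega>) \<le> ennreal ((2 * B)\<^sup>2)"
          by (intro ennreal_leI power_mono) auto
        with True show ?thesis by simp
      next
        case False
        then have "H u \<omega> = 0" "H (u + r) \<omega> = 0" using that by (auto intro!: supp)
        then show ?thesis by simp
      qed
    qed
    also have "\<dots> = C" unfolding C_def by (subst nn_integral_cmult_indicator) auto
    finally show ?thesis .
  qed
  have q_lim: "(\<lambda>n. q (1 / real (Suc n) * \<rho>) \<omega>) \<longlonglongrightarrow> 0" if "\<rho> \<in> {0..1}" "\<omega> \<in> space M" for \<rho> \<omega>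
    unfolding q_def
  proof (rule translation_continuity[where B=B and T=T])
    show "(\<lambda>u. H u \<omega>) \<in> borel_measurable borel" using that(2) by measurable
    show "(\<lambda>n. 1 / real (Suc n) * \<rho>) \<longlonglongrightarrow> 0"
      using tendsto_mult_right[OF LIMSEQ_inverse_real_of_nat, of \<rho>] by (simp add: divide_inverse mult.commute)
    show "\<bar>1 / real (Suc n) * \<rho>\<bar> \<le> 1" for n
      using that(1) by (auto simp: field_simps)
  qed (auto intro: bd supp)
  have small: "\<bar>1 / real (Suc n) * \<rho>\<bar> \<le> 1" if "\<rho> \<in> {0..1}" for n \<rho>
    using that by (auto simp: field_simps)
  have E_lim: "(\<lambda>n. \<integral>\<^sup>+\<omega>. q (1 / real (Suc n) * \<rho>) \<omega> \<partial>M) \<longlonglongrightarrow> 0" if \<rho>: "\<rho> \<in> {0..1}" for \<rho>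
  proof -
    have "(\<lambda>n. \<integral>\<^sup>+\<omega>. q (1 / real (Suc n) * \<rho>) \<omega> \<partial>M) \<longlonglongrightarrow> (\<integral>\<^sup>+\<omega>. 0 \<partial>M)"
      by (rule nn_integral_dominated_convergence[where w="\<lambda>_. C"])
         (use q_bd small[OF \<rho>] C_fin q_lim[OF \<rho>] in \<open>auto simp: emeasure_space_1\<close>)
    then show ?thesis by simp
  qed
  have "(\<lambda>n. \<integral>\<^sup>+\<rho>. (\<integral>\<^sup>+\<omega>. q (1 / real (Suc n) * \<rho>) \<omega> \<partial>M) * indicator {0..1} \<rho> \<partial>lborel) \<longlonglongrightarrow> (\<integral>\<^sup>+\<rho>. 0 \<partial>(lborel::real measure))"
  proof (rule nn_integral_dominated_convergence[where w="\<lambda>\<rho>. C * indicator {0..1} \<rho>"])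
    show "(\<lambda>\<rho>. (\<integral>\<^sup>+\<omega>. q (1 / real (Suc n) * \<rho>) \<omega> \<partial>M) * indicator {0..1} \<rho>) \<in> borel_measurable lborel" for n
    proof -
      have [measurable]: "(\<lambda>x. q (1 / real (Suc n) * fst x) (snd x)) \<in> borel_measurable (borel \<Otimes>\<^sub>M M)"
        unfolding q_def by measurable
      show ?thesis by measurable
    qed
    have "(\<integral>\<^sup>+\<omega>. q (1 / real (Suc n) * \<rho>) \<omega> \<partial>M) \<le> (\<integral>\<^sup>+\<omega>. C \<partial>M)" if "\<rho> \<in> {0..1}" for n \<rho>
      using q_bd small[OF that] by (intro nn_integral_mono) auto
    then show "AE \<rho> in lborel. (\<integral>\<^sup>+\<omega>. q (1 / real (Suc n) * \<rho>) \<omega> \<partial>M) * indicator {0..1} \<rho> \<le> C * indicator {0..1} \<rho>" for n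
      by (intro AE_I2) (auto simp: indicator_def emeasure_space_1)
    show "(\<integral>\<^sup>+\<rho>. C * indicator {0..1} \<rho> \<partial>(lborel::real measure)) < \<infinity>"
      using C_fin by (subst nn_integral_cmult_indicator) (auto simp: emeasure_lborel_Icc_eq)
    show "AE \<rho> in lborel. (\<lambda>n. (\<integral>\<^sup>+\<omega>. q (1 / real (Suc n) * \<rho>) \<omega> \<partial>M) * indicator {0..1} \<rho>) \<longlonglongrightarrow> 0"
      using E_lim by (intro AE_I2) (auto simp: indicator_def)
  qed auto
  moreover have "(\<integral>\<^sup>+u. msq M (\<lambda>\<omega>. H u \<omega> - H (u + r) \<omega>) \<partial>lborel) = (\<integral>\<^sup>+\<omega>. q r \<omega> \<partial>M)" for r
    unfolding q_def by (rule Fubini'[symmetric]) measurable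
  ultimately show ?thesis by simp
qed

end

text \<open>Joint measurability is given only over \<open>{0..T}\<close>. Forcing the time into that
  interval gives a process on the whole line, as required for integration against
  \<open>lborel\<close>.\<close>

lemma clamp_process_measurable:
  fixes T :: real
  assumes T: "0 \<le> T" and X: "jointly_measurable M T X"
  shows "(\<lambda>(t, \<omega>). X (max 0 (min T t)) \<omega>) \<in> borel_measurable (borel \<Otimes>\<^sub>M M)"
proof -
  have c: "(\<lambda>t::real. max 0 (min T t)) \<in> measurable borel (restrict_space borel {0..T})"
    using T by (intro measurable_restrict_space2) auto
  have "(\<lambda>x. (max 0 (min T (fst x)), snd x)) \<in> measurable (borel \<Otimes>\<^sub>M M) (restrict_space borel {0..T} \<Otimes>\<^sub>M M)"
    by (intro measurable_Pair measurable_compose[OF measurable_fst c] measurable_snd)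
  from measurable_compose[OF this X] show ?thesis by (simp add: split_beta)
qed

lemma extend_process_measurable:
  fixes X :: "real \<Rightarrow> 'a \<Rightarrow> 'v::{real_normed_vector, second_countable_topology}"
  assumes T: "0 \<le> T" and X: "jointly_measurable M T X"
  shows "(\<lambda>(t, \<omega>). if t \<in> {0..T} then X t \<omega> else 0) \<in> borel_measurable (borel \<Otimes>\<^sub>M M)"
proof -
  note [measurable] = clamp_process_measurable[OF T X, unfolded split_beta]
  have "(\<lambda>x. indicator {0..T} (fst x) *\<^sub>R X (max 0 (min T (fst x))) (snd x)) \<in> borel_measurable (borel \<Otimes>\<^sub>M M)"
    by measurable
  also have "(\<lambda>x. indicator {0..T} (fst x) *\<^sub>R X (max 0 (min T (fst x))) (snd x)) =
      (\<lambda>(t, \<omega>). if t \<in> {0..T} then X t \<omega> else 0)"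
    by (auto simp: fun_eq_iff indicator_def)
  finally show ?thesis .
qed

lemma ennreal_norm_diff_sq_triangle:
  fixes x y z :: "'v::real_normed_vector"
  shows "sqn (x - z) \<le> 3 * (sqn (x - y) + sqn (y - z))"
  using ennreal_norm_add3_sq[of "x - y" "y - z" 0] by simp

section \<open>Density of elementary processes\<close>

context brownian_space
begin

text \<open>Within the cell after \<open>p k\<close> the mean square error of sampling at time
  \<open>t\<close> is \<open>D (p k) (t - p k)\<close>, with a lag in \<open>{0..h}\<close>. Summed
  over the cells this gives at most \<open>C s\<close>; its average over offsets is small, so some
  offset is good.\<close>

lemma elementary_dense_bounded:
  fixes H :: "real \<Rightarrow> 'a \<Rightarrow> real ^ 'd ^ 'k"
  assumes H: "(\<lambda>(t, \<omega>). H t \<omega>) \<in> borel_measurable (borel \<Otimes>\<^sub>M M)"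
    and bd: "\<And>t \<omega>. norm (H t \<omega>) \<le> B" and supp: "\<And>t \<omega>. t \<notin> {0..T} \<Longrightarrow> H t \<omega> = 0"
    and ad: "\<And>t. t \<in> {0..T} \<Longrightarrow> H t \<in> borel_measurable (F t)"
    and \<epsilon>: "0 < \<epsilon>"
  shows "\<exists>G J. elementary_integral M W G J \<and>
    (\<integral>\<^sup>+t\<in>{0..T}. msq M (\<lambda>\<omega>. G t \<omega> - H t \<omega>) \<partial>lborel) < \<epsilon>"
proof -
  interpret pair_sigma_finite lborel M ..
  have [measurable]: "(\<lambda>x. H (f x) (g x)) \<in> borel_measurable N"
    if "f \<in> borel_measurable N" "g \<in> measurable N M" for f g and N :: "'z measure"
    using measurable_compose[OF measurable_Pair[OF that] H] by (simp add: split_beta)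
  define D where "D u r = msq M (\<lambda>\<omega>. H u \<omega> - H (u + r) \<omega>)" for u r
  have D: "(\<lambda>(u, r). D u r) \<in> borel_measurable (borel \<Otimes>\<^sub>M borel)"
    unfolding D_def by measurable
  have [measurable]: "(\<lambda>x. D (f x) (g x)) \<in> borel_measurable N"
    if "f \<in> borel_measurable N" "g \<in> borel_measurable N" for f g and N :: "'z measure"
    using measurable_compose[OF measurable_Pair[OF that] D] by (simp add: split_beta)
  define A where "A n = (\<integral>\<^sup>+\<rho>\<in>{0..1}. (\<integral>\<^sup>+u. D u (1 / real (Suc n) * \<rho>) \<partial>lborel) \<partial>lborel)" for n
  have "A \<longlonglongrightarrow> 0"
    unfolding A_def D_def by (rule translation_average[OF H bd supp])
  then have "\<forall>\<^sub>F n in sequentially. A n < \<epsilon>" using \<epsilon> by (rule order_tendstoD)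
  then obtain n where n: "A n < \<epsilon>" by (auto simp: eventually_sequentially)
  define h where "h = 1 / real (Suc n)"
  have h: "0 < h" by (simp add: h_def)
  \<comment> \<open>One more than \<open>T / h\<close>, because the grid starts one step before the
    offset and must still reach \<open>T\<close>.\<close>
  obtain K :: nat where K: "T / h + 1 \<le> real K" using real_arch_simple by blast
  define C where "C s = (\<Sum>k<K. \<integral>\<^sup>+r\<in>{0..h}. D (s + (real k - 1) * h) r \<partial>lborel)" for s
  have "(\<integral>\<^sup>+s\<in>{0..<h}. C s \<partial>lborel) \<le> (\<integral>\<^sup>+r\<in>{0..h}. (\<integral>\<^sup>+u. D u r \<partial>lborel) \<partial>lborel)"
    unfolding C_def by (rule grid_offset_average[OF D h])
  also have "\<dots> = ennreal h * A n"
    unfolding A_def h_def[symmetric] by (rule nn_integral_scale_Icc[OF _ h]) measurable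
  finally have "(\<integral>\<^sup>+s\<in>{0..<h}. C s \<partial>lborel) \<le> ennreal h * A n" .
  from below_average_exists[OF this h n] obtain s where s: "0 \<le> s" "s < h" "C s < \<epsilon>"
    by auto
  \<comment> \<open>The first point \<open>s - h\<close> is negative, so every time in
    \<open>{0<..T}\<close> comes after some grid point.\<close>
  define p where "p k = s + (real k - 1) * h" for k
  have p_Suc: "p (Suc k) = p k + h" for k by (simp add: p_def algebra_simps)
  have p_mono: "p j \<le> p k" if "j \<le> k" for j k using that h by (simp add: p_def mult_right_mono)
  have p_0: "p 0 < 0" using s by (simp add: p_def)
  have p_K: "T \<le> p K"
  proof -
    have "T / h * h \<le> (real K - 1) * h" using K h by (intro mult_right_mono) auto
    then show ?thesis using s h by (simp add: p_def)
  qed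
  \<comment> \<open>Elementary intervals must start at nonnegative times, but the sample is still
    taken at \<open>p k\<close>. If \<open>p k\<close> is outside \<open>{0..T}\<close> the sample
    is 0 and thus known at any time.\<close>
  define a where "a k = max 0 (p k)" for k
  define G where "G t \<omega> = (\<Sum>k<K. indicator {a k<..a (Suc k)} t *\<^sub>R H (p k) \<omega>)" for t \<omega>
  define J where "J t \<omega> = (\<Sum>k<K. H (p k) \<omega> *v (W (min t (a (Suc k))) \<omega> - W (min t (a k)) \<omega>))" for t \<omega>
  have "elementary_integral M W G J"
    unfolding elementary_integral_def
  proof (intro exI conjI)
    show "\<forall>k<K. 0 \<le> a k \<and> a k \<le> a (Suc k) \<and> H (p k) \<in> borel_measurable (F (a k)) \<and>
        (\<exists>C. \<forall>\<omega>\<in>space M. norm (H (p k) \<omega>) \<le> C)"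
    proof (intro allI impI conjI)
      fix k
      show "0 \<le> a k" "a k \<le> a (Suc k)" using p_mono[of k "Suc k"] by (auto simp: a_def)
      show "H (p k) \<in> borel_measurable (F (a k))"
      proof (cases "p k \<in> {0..T}")
        case True
        then show ?thesis using ad[OF True] by (simp add: a_def max_def)
      next
        case False
        then have "H (p k) = (\<lambda>\<omega>. 0)" using supp by auto
        then show ?thesis by simp
      qed
      show "\<exists>C. \<forall>\<omega>\<in>space M. norm (H (p k) \<omega>) \<le> C" using bd by blast
    qed
    show "G = (\<lambda>t \<omega>. \<Sum>k<K. indicator {a k<..a (Suc k)} t *\<^sub>R H (p k) \<omega>)" by (simp add: G_def fun_eq_iff)
    show "J = (\<lambda>t \<omega>. \<Sum>k<K. H (p k) \<omega> *v (W (min t (a (Suc k))) \<omega> - W (min t (a k)) \<omega>))"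
      by (simp add: J_def fun_eq_iff)
  qed
  moreover have "(\<integral>\<^sup>+t\<in>{0..T}. msq M (\<lambda>\<omega>. G t \<omega> - H t \<omega>) \<partial>lborel) \<le> C s"
  proof -
    have pt: "msq M (\<lambda>\<omega>. G t \<omega> - H t \<omega>) \<le>
        (\<Sum>k<K. D (p k) (t - p k) * indicator {0..h} (t - p k))" if t: "0 < t" "t \<le> T" for t
    proof -
      \<comment> \<open>The unique cell containing \<open>t\<close>; the sum defining
        \<open>G\<close> reduces to the sample at its left end.\<close>
      define j where "j = (LEAST k. t \<le> p (Suc k))"
      have "K \<noteq> 0" using p_K p_0 t by (cases "K = 0") auto
      then obtain K' where K': "K = Suc K'" by (cases K) auto
      have K't: "t \<le> p (Suc K')" using p_K t K' by simp
      have j: "t \<le> p (Suc j)" unfolding j_def using K't by (rule LeastI)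
      have "j \<le> K'" unfolding j_def using K't by (rule Least_le)
      then have jK: "j < K" using K' by simp
      have jl: "p j < t"
      proof (cases j)
        case 0 then show ?thesis using p_0 t by simp
      next
        case (Suc i)
        then have "\<not> t \<le> p (Suc i)" using not_less_Least[of i "\<lambda>k. t \<le> p (Suc k)"] by (simp add: j_def)
        then show ?thesis using Suc by simp
      qed
      have ind: "indicator {a k<..a (Suc k)} t = (if k = j then 1 else 0 :: real)" for k
      proof -
        have "t \<in> {a k<..a (Suc k)} \<longleftrightarrow> p k < t \<and> t \<le> p (Suc k)" using t by (auto simp: a_def)
        also have "\<dots> \<longleftrightarrow> k = j"
          using j jl p_mono[of "Suc k" j] p_mono[of "Suc j" k] by (cases k j rule: linorder_cases) auto
        finally show ?thesis by (simp add: indicator_def)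
      qed
      have "G t \<omega> = (\<Sum>k<K. if k = j then H (p k) \<omega> else 0)" for \<omega>
        unfolding G_def ind by (intro sum.cong) auto
      then have "G t \<omega> = H (p j) \<omega>" for \<omega> using jK by simp
      then have "msq M (\<lambda>\<omega>. G t \<omega> - H t \<omega>) = D (p j) (t - p j) * indicator {0..h} (t - p j)"
        using jl j p_Suc[of j] by (simp add: D_def indicator_def)
      also have "\<dots> \<le> (\<Sum>k<K. D (p k) (t - p k) * indicator {0..h} (t - p k))"
        using jK by (intro member_le_sum) auto
      finally show ?thesis .
    qed
    \<comment> \<open>The pointwise bound holds for positive times; time 0 is a null set.\<close>
    have "(\<integral>\<^sup>+t\<in>{0..T}. msq M (\<lambda>\<omega>. G t \<omega> - H t \<omega>) \<partial>lborel) \<le>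
        (\<integral>\<^sup>+t. (\<Sum>k<K. D (p k) (t - p k) * indicator {0..h} (t - p k)) \<partial>lborel)"
      using AE_lborel_singleton[of 0] pt
      by (intro nn_integral_mono_AE) (auto simp: indicator_def elim!: eventually_mono)
    also have "\<dots> = (\<Sum>k<K. \<integral>\<^sup>+t. D (p k) (t - p k) * indicator {0..h} (t - p k) \<partial>lborel)"
      by (rule nn_integral_sum) measurable
    also have "\<dots> = C s"
      unfolding C_def p_def[symmetric]
    proof (intro sum.cong refl)
      fix k
      show "(\<integral>\<^sup>+t. D (p k) (t - p k) * indicator {0..h} (t - p k) \<partial>lborel) = (\<integral>\<^sup>+r\<in>{0..h}. D (p k) r \<partial>lborel)"
        using nn_integral_translate[of "\<lambda>r. D (p k) r * indicator {0..h} r" "- p k"] by simp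
    qed
    finally show ?thesis .
  qed
  ultimately show ?thesis using s(3) by (blast intro: le_less_trans)
qed

text \<open>Reduction to the bounded case by cutting \<open>H\<close> off where its norm exceeds
  \<open>m\<close>. The cut-off error is dominated by the square of \<open>H\<close>, which is
  integrable.\<close>

lemma elementary_dense:
  fixes H :: "real \<Rightarrow> 'a \<Rightarrow> real ^ 'd ^ 'k"
  assumes T: "0 \<le> T" and H: "H \<in> L2F M W T" and \<epsilon>: "0 < \<epsilon>"
  shows "\<exists>G J. elementary_integral M W G J \<and>
    (\<integral>\<^sup>+t\<in>{0..T}. msq M (\<lambda>\<omega>. G t \<omega> - H t \<omega>) \<partial>lborel) < \<epsilon>"
proof -
  have ad: "adapted_process M W T H"
    and fin: "(\<integral>\<^sup>+t\<in>{0..T}. msq M (\<lambda>\<omega>. H t \<omega>) \<partial>lborel) < \<infinity>"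
    using H by (auto simp: L2F_def)
  define E where "E t \<omega> = (if t \<in> {0..T} then H t \<omega> else 0)" for t \<omega>
  have E: "(\<lambda>(t, \<omega>). E t \<omega>) \<in> borel_measurable (borel \<Otimes>\<^sub>M M)"
    unfolding E_def using ad by (intro extend_process_measurable[OF T]) (auto simp: adapted_process_def)
  have [measurable]: "(\<lambda>x. E (f x) (g x)) \<in> borel_measurable N"
    if "f \<in> borel_measurable N" "g \<in> measurable N M" for f g and N :: "'z measure"
    using measurable_compose[OF measurable_Pair[OF that] E] by (simp add: split_beta)
  define Hb where "Hb m t \<omega> = (if norm (E t \<omega>) \<le> real m then E t \<omega> else 0)" for m :: nat and t \<omega>
  have Hb_m: "(\<lambda>(t, \<omega>). Hb m t \<omega>) \<in> borel_measurable (borel \<Otimes>\<^sub>M M)" for m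
    unfolding Hb_def split_beta by measurable
  have [measurable]: "(\<lambda>x. Hb m (f x) (g x)) \<in> borel_measurable N"
    if "f \<in> borel_measurable N" "g \<in> measurable N M" for f g m and N :: "'z measure"
    using measurable_compose[OF measurable_Pair[OF that] Hb_m] by (simp add: split_beta)
  have Hb_ad: "Hb m t \<in> borel_measurable (F t)" if "t \<in> {0..T}" for m t
  proof -
    have [measurable]: "E t \<in> borel_measurable (F t)"
      using ad that by (auto simp: adapted_process_def E_def[abs_def])
    show ?thesis unfolding Hb_def[abs_def] by measurable
  qed
  have fin': "(\<integral>\<^sup>+x. sqn (E (fst x) (snd x)) \<partial>(lborel \<Otimes>\<^sub>M M)) < \<infinity>"
  proof -
    have "(\<integral>\<^sup>+x. sqn (E (fst x) (snd x)) \<partial>(lborel \<Otimes>\<^sub>M M)) =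
        (\<integral>\<^sup>+t. msq M (\<lambda>\<omega>. E t \<omega>) \<partial>lborel)"
      by (subst nn_integral_fst[symmetric]) auto
    also have "\<dots> = (\<integral>\<^sup>+t\<in>{0..T}. msq M (\<lambda>\<omega>. H t \<omega>) \<partial>lborel)"
      by (intro nn_integral_cong) (auto simp: E_def indicator_def)
    finally show ?thesis using fin by simp
  qed
  have "(\<lambda>m. \<integral>\<^sup>+x. sqn (Hb m (fst x) (snd x) - E (fst x) (snd x)) \<partial>(lborel \<Otimes>\<^sub>M M)) \<longlonglongrightarrow>
      (\<integral>\<^sup>+x. 0 \<partial>((lborel :: real measure) \<Otimes>\<^sub>M M))"
  proof (rule nn_integral_dominated_convergence[where w="\<lambda>x. sqn (E (fst x) (snd x))"])
    show "AE x in lborel \<Otimes>\<^sub>M M. sqn (Hb m (fst x) (snd x) - E (fst x) (snd x)) \<le>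
        sqn (E (fst x) (snd x))" for m
      by (intro AE_I2) (auto simp: Hb_def)
    show "AE x in lborel \<Otimes>\<^sub>M M. (\<lambda>m. sqn (Hb m (fst x) (snd x) - E (fst x) (snd x))) \<longlonglongrightarrow> 0"
    proof (rule AE_I2)
      fix x
      obtain m0 :: nat where "norm (E (fst x) (snd x)) \<le> real m0" using real_arch_simple by blast
      then have "\<forall>\<^sub>F m in sequentially. sqn (Hb m (fst x) (snd x) - E (fst x) (snd x)) = 0"
        unfolding eventually_sequentially by (intro exI[of _ m0]) (auto simp: Hb_def)
      then show "(\<lambda>m. sqn (Hb m (fst x) (snd x) - E (fst x) (snd x))) \<longlonglongrightarrow> 0"
        by (rule tendsto_eventually)
    qed
  qed (use fin' in auto)
  \<comment> \<open>The triangle inequality costs a factor 3, and each of the two errors may use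
    half of \<open>\<epsilon>\<close>.\<close>
  then have "(\<lambda>m. 6 * (\<integral>\<^sup>+x. sqn (Hb m (fst x) (snd x) - E (fst x) (snd x)) \<partial>(lborel \<Otimes>\<^sub>M M))) \<longlonglongrightarrow> 6 * 0"
    by (intro ennreal_tendsto_cmult) simp_all
  then have "\<forall>\<^sub>F m in sequentially. 6 * (\<integral>\<^sup>+x. sqn (Hb m (fst x) (snd x) - E (fst x) (snd x)) \<partial>(lborel \<Otimes>\<^sub>M M)) < \<epsilon>"
    using \<epsilon> by (intro order_tendstoD(2)[where y="6 * 0"]) simp_all
  then obtain m where m: "6 * (\<integral>\<^sup>+x. sqn (Hb m (fst x) (snd x) - E (fst x) (snd x)) \<partial>(lborel \<Otimes>\<^sub>M M)) < \<epsilon>"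
    by (auto simp: eventually_sequentially)
  have "0 < \<epsilon> / 6" using \<epsilon> by (simp add: ennreal_zero_less_divide)
  have "\<exists>G J. elementary_integral M W G J \<and>
      (\<integral>\<^sup>+t\<in>{0..T}. msq M (\<lambda>\<omega>. G t \<omega> - Hb m t \<omega>) \<partial>lborel) < \<epsilon> / 6"
  proof (rule elementary_dense_bounded[where B="real m"])
    show "norm (Hb m t \<omega>) \<le> real m" for t \<omega> by (simp add: Hb_def)
    show "Hb m t \<omega> = 0" if "t \<notin> {0..T}" for t \<omega> unfolding Hb_def E_def using that by auto
  qed (fact Hb_m Hb_ad \<open>0 < \<epsilon> / 6\<close>)+
  then obtain G J where el: "elementary_integral M W G J"
    and G: "(\<integral>\<^sup>+t\<in>{0..T}. msq M (\<lambda>\<omega>. G t \<omega> - Hb m t \<omega>) \<partial>lborel) < \<epsilon> / 6"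
    by blast
  have [measurable]: "(\<lambda>x. G (f x) (g x)) \<in> borel_measurable N"
    if "f \<in> borel_measurable N" "g \<in> measurable N M" for f g and N :: "'z measure"
    using measurable_compose[OF measurable_Pair[OF that] elementary_integral_measurable(1)[OF el]] by (simp add: split_beta)
  have "(\<integral>\<^sup>+t\<in>{0..T}. msq M (\<lambda>\<omega>. G t \<omega> - H t \<omega>) \<partial>lborel) \<le>
      (\<integral>\<^sup>+t. 3 * (msq M (\<lambda>\<omega>. G t \<omega> - Hb m t \<omega>) * indicator {0..T} t +
        msq M (\<lambda>\<omega>. Hb m t \<omega> - E t \<omega>)) \<partial>lborel)"
  proof (rule nn_integral_mono)
    fix t :: real
    show "msq M (\<lambda>\<omega>. G t \<omega> - H t \<omega>) * indicator {0..T} t \<le>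
        3 * (msq M (\<lambda>\<omega>. G t \<omega> - Hb m t \<omega>) * indicator {0..T} t +
        msq M (\<lambda>\<omega>. Hb m t \<omega> - E t \<omega>))"
    proof (cases "t \<in> {0..T}")
      case True
      then have HE: "H t \<omega> = E t \<omega>" for \<omega> by (simp add: E_def)
      have "msq M (\<lambda>\<omega>. G t \<omega> - H t \<omega>) \<le>
          (\<integral>\<^sup>+\<omega>. 3 * (sqn (G t \<omega> - Hb m t \<omega>) + sqn (Hb m t \<omega> - E t \<omega>)) \<partial>M)"
        unfolding HE by (intro nn_integral_mono ennreal_norm_diff_sq_triangle)
      also have "\<dots> = 3 * (msq M (\<lambda>\<omega>. G t \<omega> - Hb m t \<omega>) +
        msq M (\<lambda>\<omega>. Hb m t \<omega> - E t \<omega>))"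
        by (subst nn_integral_cmult, measurable, subst nn_integral_add, measurable)
      finally show ?thesis using True by simp
    qed simp
  qed
  also have "\<dots> = 3 * ((\<integral>\<^sup>+t\<in>{0..T}. msq M (\<lambda>\<omega>. G t \<omega> - Hb m t \<omega>) \<partial>lborel) +
      (\<integral>\<^sup>+t. msq M (\<lambda>\<omega>. Hb m t \<omega> - E t \<omega>) \<partial>lborel))"
    by (subst nn_integral_cmult, measurable, subst nn_integral_add, measurable)
  also have "(\<integral>\<^sup>+t. msq M (\<lambda>\<omega>. Hb m t \<omega> - E t \<omega>) \<partial>lborel) =
      (\<integral>\<^sup>+x. sqn (Hb m (fst x) (snd x) - E (fst x) (snd x)) \<partial>(lborel \<Otimes>\<^sub>M M))"
    by (subst nn_integral_fst[symmetric]) auto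
  also have "3 * ((\<integral>\<^sup>+t\<in>{0..T}. msq M (\<lambda>\<omega>. G t \<omega> - Hb m t \<omega>) \<partial>lborel) + \<dots>) < \<epsilon>"
  proof -
    have "3 * (a + b) < \<epsilon>" if ab: "a < \<epsilon> / 6" "6 * b < \<epsilon>" for a b :: ennreal
    proof -
      have "a < \<top>" using ab(1) by (rule less_le_trans) simp
      then obtain a' where a': "a = ennreal a'" "0 \<le> a'" by (cases a) auto
      have "6 * b < \<top>" using ab(2) by (rule less_le_trans) simp
      then have "b < \<top>" by (auto simp: ennreal_mult_less_top)
      then obtain b' where b': "b = ennreal b'" "0 \<le> b'" by (cases b) auto
      have n6: "6 * ennreal b' = ennreal (6 * b')" using b' by (simp add: ennreal_mult)
      have n3: "3 * (a + b) = ennreal (3 * (a' + b'))"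
        using a' b' by (simp add: ennreal_mult)
      show ?thesis
      proof (cases \<epsilon>)
        case (real e)
        have "\<epsilon> / 6 = ennreal (e / 6)" using real by (simp add: divide_ennreal[symmetric])
        then have "a' < e / 6" "6 * b' < e"
          using ab a' b' real unfolding n6 by (simp_all add: n6 ennreal_less_iff)
        then have "3 * (a' + b') < e" by simp
        then show ?thesis unfolding n3 real using a' b' by (intro ennreal_lessI) auto
      next
        case top
        show ?thesis unfolding n3 top by (rule ennreal_less_top)
      qed
    qed
    then show ?thesis using G m by blast
  qed
  finally show ?thesis using el by blast
qed

end

section \<open>Existence and stability of the Ito integral\<close>

lemma borel_measurable_caratheodory:
  fixes g :: "'a \<Rightarrow> 'p::{metric_space, second_countable_topology} \<Rightarrow> 'q::metric_space"
  assumes g: "\<And>\<theta>. (\<lambda>x. g x \<theta>) \<in> borel_measurable N" and U: "U \<in> borel_measurable N"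
    and cont: "\<And>x. x \<in> space N \<Longrightarrow> continuous_on UNIV (g x)"
  shows "(\<lambda>x. g x (U x)) \<in> borel_measurable N"
proof -
  \<comment> \<open>Inserting a simple function means switching between finitely many measurable
    functions; continuity in the second argument passes to the limit.\<close>
  obtain S where S: "\<And>i. simple_function N (S i)" "\<And>x. x \<in> space N \<Longrightarrow> (\<lambda>i. S i x) \<longlonglongrightarrow> U x"
    using borel_measurable_implies_sequence_metric[OF U] by metis
  show ?thesis
  proof (rule borel_measurable_LIMSEQ_metric)
    fix i
    have fin: "finite (S i ` space N)" using S(1) by (rule simple_functionD)
    have "S i \<in> measurable N (count_space (S i ` space N))"
      using simple_functionD(2)[OF S(1)[of i]] fin by (subst measurable_count_space_eq2) auto
    then show "(\<lambda>x. g x (S i x)) \<in> borel_measurable N"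
      by (rule measurable_compose_countable'[where f="\<lambda>\<theta> x. g x \<theta>", OF g _ countable_finite[OF fin]])
  next
    fix x assume x: "x \<in> space N"
    show "(\<lambda>i. g x (S i x)) \<longlonglongrightarrow> g x (U x)"
      using continuous_on_tendsto_compose[OF cont[OF x] S(2)[OF x]] by simp
  qed
qed

text \<open>An instance of the preceding argument in which the inserted variable is time itself.
  Clamping makes the paths continuous on the whole line.\<close>

lemma continuous_process_measurable:
  fixes X :: "real \<Rightarrow> 'a \<Rightarrow> 'v::metric_space"
  assumes T: "0 \<le> T" and X: "\<And>t. t \<in> {0..T} \<Longrightarrow> X t \<in> borel_measurable M"
    and cont: "\<And>\<omega>. \<omega> \<in> space M \<Longrightarrow> continuous_on {0..T} (\<lambda>t. X t \<omega>)"
  shows "jointly_measurable M T X"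
proof -
  let ?N = "restrict_space borel {0..T} \<Otimes>\<^sub>M M"
  have "(\<lambda>x. X (max 0 (min T (fst x))) (snd x)) \<in> borel_measurable ?N"
  proof (rule borel_measurable_caratheodory[where g="\<lambda>x t. X (max 0 (min T t)) (snd x)"])
    show "(\<lambda>x. X (max 0 (min T \<theta>)) (snd x)) \<in> borel_measurable ?N" for \<theta>
      by (rule measurable_compose[OF measurable_snd X]) (use T in auto)
    have "(\<lambda>t. t) \<in> borel_measurable (restrict_space borel {0..T})" by (rule measurable_restrict_space1) simp
    then show "fst \<in> borel_measurable ?N" by (rule measurable_compose[OF measurable_fst])
    show "continuous_on UNIV (\<lambda>t. X (max 0 (min T t)) (snd x))" if "x \<in> space ?N" for x
      by (rule continuous_on_compose2[OF cont]) (use that T in \<open>auto simp: space_pair_measure intro!: continuous_intros\<close>)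
  qed
  also have "?this \<longleftrightarrow> ?thesis"
    by (intro measurable_cong) (auto simp: space_pair_measure space_restrict_space)
  finally show ?thesis .
qed

lemma measurable_restrict_time:
  assumes X: "(\<lambda>(t, \<omega>). X t \<omega>) \<in> borel_measurable (borel \<Otimes>\<^sub>M M)"
  shows "(\<lambda>(t, \<omega>). X t \<omega>) \<in> borel_measurable (restrict_space borel {0..T::real} \<Otimes>\<^sub>M M)"
proof -
  have "(\<lambda>t. t) \<in> borel_measurable (restrict_space borel {0..T})" by (rule measurable_restrict_space1) simp
  then have "(\<lambda>x. (fst x, snd x)) \<in> measurable (restrict_space borel {0..T} \<Otimes>\<^sub>M M) (borel \<Otimes>\<^sub>M M)"
    by (intro measurable_Pair measurable_snd measurable_compose[OF measurable_fst])
  from measurable_compose[OF this X] show ?thesis by simp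
qed

lemma process_measurable_mono:
  assumes "t \<le> (T::real)" and X: "jointly_measurable M T X"
  shows "jointly_measurable M t X"
proof -
  have "(\<lambda>s. s) \<in> measurable (restrict_space borel {0..t}) (restrict_space borel {0..T})"
    using assms(1) by (intro measurable_restrict_space3) auto
  then have "(\<lambda>x. (fst x, snd x)) \<in> measurable (restrict_space borel {0..t} \<Otimes>\<^sub>M M) (restrict_space borel {0..T} \<Otimes>\<^sub>M M)"
    by (intro measurable_Pair measurable_snd measurable_compose[OF measurable_fst])
  from measurable_compose[OF this X] show ?thesis by simp
qed

text \<open>The squared norm for the product of Lebesgue measure on \<open>{0..T}\<close> and
  \<open>M\<close>, allowed to be infinite.\<close>

definition energy :: "'a measure \<Rightarrow> real \<Rightarrow> (real \<Rightarrow> 'a \<Rightarrow> 'v::real_normed_vector) \<Rightarrow> ennreal" where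
  "energy M T X = (\<integral>\<^sup>+t\<in>{0..T}. msq M (\<lambda>\<omega>. X t \<omega>) \<partial>lborel)"

lemma energy_mono: "t \<le> T \<Longrightarrow> energy M t X \<le> energy M T X"
  unfolding energy_def by (intro nn_integral_mono) (auto simp: indicator_def)

context prob_space
begin

lemma energy_triangle:
  fixes X Y Z :: "real \<Rightarrow> 'a \<Rightarrow> 'v::euclidean_space"
  assumes X: "jointly_measurable M T X"
    and Y: "jointly_measurable M T Y"
    and Z: "jointly_measurable M T Z"
  shows "energy M T (\<lambda>t \<omega>. X t \<omega> - Z t \<omega>) \<le>
    3 * (energy M T (\<lambda>t \<omega>. X t \<omega> - Y t \<omega>) + energy M T (\<lambda>t \<omega>. Y t \<omega> - Z t \<omega>))"
proof -
  let ?R = "restrict_space borel {0..T}"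
  have gen: "(\<lambda>t. msq M (\<lambda>\<omega>. A t \<omega> - B t \<omega>) * indicator {0..T} t) \<in> borel_measurable borel"
       "t \<in> {0..T} \<Longrightarrow> (\<lambda>\<omega>. A t \<omega> - B t \<omega>) \<in> borel_measurable M"
    if A: "(\<lambda>(t, \<omega>). A t \<omega>) \<in> borel_measurable (?R \<Otimes>\<^sub>M M)" and B: "(\<lambda>(t, \<omega>). B t \<omega>) \<in> borel_measurable (?R \<Otimes>\<^sub>M M)"
    for A B :: "real \<Rightarrow> 'a \<Rightarrow> 'v" and t
  proof -
    have AB: "(\<lambda>(t, \<omega>). A t \<omega> - B t \<omega>) \<in> borel_measurable (?R \<Otimes>\<^sub>M M)"
      using borel_measurable_diff[OF A B] by (simp add: split_beta)
    then have "(\<lambda>(t, \<omega>). sqn (A t \<omega> - B t \<omega>)) \<in> borel_measurable (?R \<Otimes>\<^sub>M M)"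
      by (simp add: split_beta)
    then have "(\<lambda>t. \<integral>\<^sup>+\<omega>. sqn (A t \<omega> - B t \<omega>) \<partial>M) \<in> borel_measurable ?R"
      by (rule borel_measurable_nn_integral)
    then show "(\<lambda>t. msq M (\<lambda>\<omega>. A t \<omega> - B t \<omega>) * indicator {0..T} t) \<in> borel_measurable borel"
      by (subst (asm) borel_measurable_restrict_space_iff_ennreal) auto
    show "(\<lambda>\<omega>. A t \<omega> - B t \<omega>) \<in> borel_measurable M" if "t \<in> {0..T}"
      using measurable_Pair2[OF AB, of t] that by (simp add: space_restrict_space)
  qed
  have "energy M T (\<lambda>t \<omega>. X t \<omega> - Z t \<omega>) \<le>
      (\<integral>\<^sup>+t. 3 * (msq M (\<lambda>\<omega>. X t \<omega> - Y t \<omega>) * indicator {0..T} t +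
        msq M (\<lambda>\<omega>. Y t \<omega> - Z t \<omega>) * indicator {0..T} t) \<partial>lborel)"
    unfolding energy_def
  proof (rule nn_integral_mono)
    fix t :: real
    show "msq M (\<lambda>\<omega>. X t \<omega> - Z t \<omega>) * indicator {0..T} t \<le>
        3 * (msq M (\<lambda>\<omega>. X t \<omega> - Y t \<omega>) * indicator {0..T} t +
        msq M (\<lambda>\<omega>. Y t \<omega> - Z t \<omega>) * indicator {0..T} t)"
    proof (cases "t \<in> {0..T}")
      case True
      note [measurable] = gen(2)[OF X Y True] gen(2)[OF Y Z True]
      have "msq M (\<lambda>\<omega>. X t \<omega> - Z t \<omega>) \<le>
          (\<integral>\<^sup>+\<omega>. 3 * (sqn (X t \<omega> - Y t \<omega>) + sqn (Y t \<omega> - Z t \<omega>)) \<partial>M)"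
        by (intro nn_integral_mono ennreal_norm_diff_sq_triangle)
      also have "\<dots> = 3 * (msq M (\<lambda>\<omega>. X t \<omega> - Y t \<omega>) +
        msq M (\<lambda>\<omega>. Y t \<omega> - Z t \<omega>))"
        by (subst nn_integral_cmult, measurable, subst nn_integral_add, measurable)
      finally show ?thesis using True by simp
    qed simp
  qed
  also have "\<dots> = 3 * (energy M T (\<lambda>t \<omega>. X t \<omega> - Y t \<omega>) + energy M T (\<lambda>t \<omega>. Y t \<omega> - Z t \<omega>))"
    unfolding energy_def using gen(1)[OF X Y] gen(1)[OF Y Z]
    by (subst nn_integral_cmult, simp, subst nn_integral_add, simp_all)
  finally show ?thesis .
qed

end

lemma energy_minus_commute: "energy M T (\<lambda>t \<omega>. X t \<omega> - Y t \<omega>) = energy M T (\<lambda>t \<omega>. Y t \<omega> - X t \<omega>)"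
  by (simp add: energy_def norm_minus_commute)

lemma uniformly_Cauchy_geometric:
  fixes f :: "nat \<Rightarrow> 'b \<Rightarrow> 'v::real_normed_vector"
  assumes f: "\<And>n x. N \<le> n \<Longrightarrow> x \<in> S \<Longrightarrow> norm (f (Suc n) x - f n x) \<le> (1/2)^n"
  shows "uniformly_Cauchy_on S f"
proof -
  \<comment> \<open>The bound is the exact geometric sum, not just \<open>2 * (1/2)^n\<close>, so
    that the induction closes.\<close>
  have step: "norm (f (n + j) x - f n x) \<le> 2 * (1/2)^n - 2 * (1/2)^(n + j)" if "N \<le> n" "x \<in> S" for n j x
  proof (induction j)
    case (Suc j)
    have "norm (f (n + Suc j) x - f n x) \<le> norm (f (Suc (n + j)) x - f (n + j) x) + norm (f (n + j) x - f n x)"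
      using norm_triangle_ineq[of "f (Suc (n + j)) x - f (n + j) x" "f (n + j) x - f n x"] by simp
    also have "\<dots> \<le> (1/2)^(n + j) + (2 * (1/2)^n - 2 * (1/2)^(n + j))"
      using Suc f[of "n + j" x] that by (intro add_mono) auto
    finally show ?case by simp
  qed simp
  show ?thesis
    unfolding uniformly_Cauchy_on_def
  proof (intro allI impI)
    fix e :: real assume e: "0 < e"
    then obtain n0 where n0: "(1/2)^n0 < e / 4" using real_arch_pow_inv[of "e/4" "1/2"] by auto
    define n where "n = max N n0"
    have "(1/2::real)^n \<le> (1/2)^n0" by (intro power_decreasing) (auto simp: n_def)
    then have n: "(1/2::real)^n < e / 4" using n0 by (rule le_less_trans)
    have near: "norm (f m x - f n x) < e / 2" if "n \<le> m" "x \<in> S" for m x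
    proof -
      obtain j where j: "m = n + j" using le_Suc_ex[OF \<open>n \<le> m\<close>] by blast
      have "norm (f m x - f n x) \<le> 2 * (1/2)^n - 2 * (1/2)^(n + j)"
        unfolding j using step[of n x j] that by (simp add: n_def)
      also have "\<dots> \<le> 2 * (1/2)^n" by simp
      finally show ?thesis using n by simp
    qed
    show "\<exists>M. \<forall>x\<in>S. \<forall>m\<ge>M. \<forall>k\<ge>M. dist (f m x) (f k x) < e"
    proof (intro exI ballI allI impI)
      fix x m k assume "x \<in> S" "n \<le> m" "n \<le> k"
      have "dist (f m x) (f k x) \<le> norm (f m x - f n x) + norm (f k x - f n x)"
        using dist_triangle2[of "f m x" "f k x" "f n x"] by (simp add: dist_norm)
      also have "\<dots> < e" using near[of m x] near[of k x] \<open>x \<in> S\<close> \<open>n \<le> m\<close> \<open>n \<le> k\<close> by simp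
      finally show "dist (f m x) (f k x) < e" .
    qed
  qed
qed

section \<open>Construction and stability of the stochastic integral\<close>

context brownian_space
begin

text \<open>The bound over finite sets of times does not depend on the set, so it passes to an
  increasing union. A dense countable \<open>Q\<close> will then control continuous paths on the
  whole interval.\<close>

lemma elementary_maximal_countable:
  fixes J :: "real \<Rightarrow> 'a \<Rightarrow> real ^ 'k"
  assumes el: "elementary_integral M W H J" and T: "0 \<le> T" and c: "0 < c"
    and Q: "countable Q" "Q \<subseteq> {0..T}" and e: "energy M T H \<le> ennreal e" "0 \<le> e"
  shows "{\<omega>\<in>space M. \<exists>t\<in>Q. c \<le> norm (J t \<omega>)} \<in> events"
    and "c\<^sup>2 * prob {\<omega>\<in>space M. \<exists>t\<in>Q. c \<le> norm (J t \<omega>)} \<le> e"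
proof -
  have m: "{\<omega>\<in>space M. c \<le> norm (J t \<omega>)} \<in> events" if "t \<in> Q" for t
  proof -
    have [measurable]: "J t \<in> borel_measurable M"
      using that Q(2) by (intro measurable_F_M[OF elementary_integral_measurable(2)[OF el]]) auto
    show ?thesis by measurable
  qed
  let ?A = "\<lambda>P. {\<omega>\<in>space M. \<exists>t\<in>P. c \<le> norm (J t \<omega>)}"
  have A_eq: "?A P = (\<Union>t\<in>P. {\<omega>\<in>space M. c \<le> norm (J t \<omega>)})" for P by auto
  have mP: "?A P \<in> events" if "P \<subseteq> Q" for P
    unfolding A_eq using m that countable_subset[OF that Q(1)] by (intro sets.countable_UN'') auto
  show "?A Q \<in> events" by (rule mP) simp
  show "c\<^sup>2 * prob (?A Q) \<le> e"
  proof (cases "Q = {}")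
    case False
    define q where "q = from_nat_into Q"
    have q: "range q = Q" unfolding q_def using False Q(1) by (rule range_from_nat_into)
    define P where "P m = q ` {..m::nat}" for m
    have PQ: "P m \<subseteq> Q" "finite (P m)" for m using q by (auto simp: P_def)
    have fin: "c\<^sup>2 * prob (?A (P m)) \<le> e" for m
    proof -
      have "ennreal (c\<^sup>2) * emeasure M (?A (P m)) \<le> energy M T H"
        unfolding energy_def using PQ[of m] Q(2) by (intro elementary_maximal[OF el _ _ T c]) auto
      also have "\<dots> \<le> ennreal e" by (rule e)
      finally have "ennreal (c\<^sup>2 * prob (?A (P m))) \<le> ennreal e"
        by (simp add: emeasure_eq_measure ennreal_mult)
      then show ?thesis using e(2) by (subst (asm) ennreal_le_iff) auto
    qed
    have "(\<lambda>m. prob (?A (P m))) \<longlonglongrightarrow> prob (\<Union>m. ?A (P m))"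
      using mP[OF PQ(1)] by (intro finite_Lim_measure_incseq) (auto simp: incseq_def P_def)
    moreover have "(\<Union>m. ?A (P m)) = ?A Q"
      unfolding q[symmetric] P_def by auto
    ultimately have "(\<lambda>m. c\<^sup>2 * prob (?A (P m))) \<longlonglongrightarrow> c\<^sup>2 * prob (?A Q)"
      by (intro tendsto_mult_left) simp
    then show ?thesis using fin by (intro LIMSEQ_le_const2) auto
  qed (simp add: e(2))
qed

lemma ito_integral_exists:
  fixes H :: "real \<Rightarrow> 'a \<Rightarrow> real ^ 'd ^ 'k"
  assumes T: "0 \<le> T" and H: "H \<in> L2F M W T"
  shows "\<exists>I. is_ito_integral M W T H I"
proof -
  \<comment> \<open>The rate must beat the squared threshold: deviations above
    \<open>(1/2)^n\<close> have probability at most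
    \<open>6 * (1/8)^n / (1/4)^n = 6 * (1/2)^n\<close>, which is summable.\<close>
  define \<delta> :: "nat \<Rightarrow> real" where "\<delta> n = (1/8)^n" for n
  have "\<forall>n. \<exists>G J. elementary_integral M W G J \<and> energy M T (\<lambda>t \<omega>. G t \<omega> - H t \<omega>) < ennreal (\<delta> n)"
    unfolding energy_def by (intro allI elementary_dense[OF T H]) (simp add: \<delta>_def)
  then obtain G J where el: "\<And>n. elementary_integral M W (G n) (J n)"
    and G: "\<And>n. energy M T (\<lambda>t \<omega>. G n t \<omega> - H t \<omega>) < ennreal (\<delta> n)"
    unfolding choice_iff by blast
  have Hm: "jointly_measurable M T H"
    using H by (simp add: L2F_def adapted_process_def)
  have Gm: "jointly_measurable M T (G n)" for n
    by (rule measurable_restrict_time[OF elementary_integral_measurable(1)[OF el]])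
  have GG: "energy M T (\<lambda>t \<omega>. G m t \<omega> - G n t \<omega>) \<le> ennreal (6 * \<delta> n)" if "n \<le> m" for m n
  proof -
    have "energy M T (\<lambda>t \<omega>. G m t \<omega> - G n t \<omega>) \<le>
        3 * (energy M T (\<lambda>t \<omega>. G m t \<omega> - H t \<omega>) + energy M T (\<lambda>t \<omega>. H t \<omega> - G n t \<omega>))"
      by (rule energy_triangle[OF Gm Hm Gm])
    also have "\<dots> \<le> 3 * (ennreal (\<delta> m) + ennreal (\<delta> n))"
      using G[of m] G[of n] by (intro mult_left_mono add_mono) (auto simp: energy_minus_commute[of M T H])
    also have "\<dots> \<le> 3 * (ennreal (\<delta> n) + ennreal (\<delta> n))"
      using that by (intro mult_left_mono add_mono ennreal_leI) (auto simp: \<delta>_def intro: power_decreasing)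
    also have "\<dots> = ennreal (6 * \<delta> n)"
      by (simp add: ennreal_mult[symmetric] ennreal_plus[symmetric] \<delta>_def del: ennreal_plus flip: ennreal_numeral)
    finally show ?thesis .
  qed
  have JJ: "msq M (\<lambda>\<omega>. J n t \<omega> - J m t \<omega>) \<le> ennreal (6 * \<delta> n)"
    if "n \<le> m" "t \<in> {0..T}" for m n t
  proof -
    have "msq M (\<lambda>\<omega>. J n t \<omega> - J m t \<omega>) = energy M t (\<lambda>t \<omega>. G n t \<omega> - G m t \<omega>)"
      unfolding energy_def using that by (intro elementary_isometry[OF elementary_integral_diff[OF el el]]) auto
    also have "\<dots> \<le> energy M T (\<lambda>t \<omega>. G n t \<omega> - G m t \<omega>)"
      using that by (intro energy_mono) auto
    also have "\<dots> \<le> ennreal (6 * \<delta> n)"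
      using GG[OF that(1)] by (simp add: energy_minus_commute[of M T "G n"])
    finally show ?thesis .
  qed
  obtain Q where Q: "countable Q" "Q \<subseteq> {0..T}" "{0..T} \<subseteq> closure Q"
    using separable[of "{0..T}"] by blast
  have closure_Q: "closure Q = {0..T}"
    using Q(2,3) closure_minimal[OF Q(2)] by auto
  define A where "A n = {\<omega>\<in>space M. \<exists>t\<in>Q. (1/2)^n \<le> norm (J (Suc n) t \<omega> - J n t \<omega>)}" for n
  have A: "A n \<in> events" "prob (A n) \<le> 6 * (1/2)^n" for n
  proof -
    note mx = elementary_maximal_countable[OF elementary_integral_diff[OF el el] T _ Q(1,2) GG[of n "Suc n"], of "(1/2)^n"]
    show "A n \<in> events" unfolding A_def by (rule mx(1)) (auto simp: \<delta>_def)
    have "((1/2)^n)\<^sup>2 * prob (A n) \<le> 6 * \<delta> n" unfolding A_def by (rule mx(2)) (auto simp: \<delta>_def)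
    also have "6 * \<delta> n = ((1/2)^n)\<^sup>2 * (6 * (1/2)^n)"
      by (simp add: \<delta>_def power2_eq_square power_mult_distrib[symmetric])
    finally show "prob (A n) \<le> 6 * (1/2)^n"
      by (subst (asm) mult_le_cancel_left_pos) auto
  qed
  have "AE \<omega> in M. \<forall>\<^sub>F n in sequentially. \<omega> \<in> space M - A n"
  proof (rule borel_cantelli_AE1)
    have "summable (\<lambda>n. 6 * (1/2::real)^n)" by (intro summable_mult summable_geometric) simp
    then show "summable (\<lambda>n. prob (A n))"
      by (rule summable_comparison_test'[where N=0]) (use A(2) in simp)
  qed (use A(1) in \<open>auto simp: emeasure_eq_measure\<close>)
  moreover have "AE \<omega> in M. \<forall>n. continuous_on {0..} (\<lambda>t. J n t \<omega>)"
    using elementary_integral_measurable(3)[OF el] by (simp add: AE_all_countable)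
  ultimately have "AE \<omega> in M. (\<forall>\<^sub>F n in sequentially. \<omega> \<in> space M - A n) \<and> (\<forall>n. continuous_on {0..} (\<lambda>t. J n t \<omega>))"
    by eventually_elim auto
  then obtain N where N: "N \<in> null_sets M"
    "\<And>\<omega>. \<omega> \<in> space M - N \<Longrightarrow> (\<forall>\<^sub>F n in sequentially. \<omega> \<in> space M - A n) \<and> (\<forall>n. continuous_on {0..} (\<lambda>t. J n t \<omega>))"
    by (auto elim!: AE_E3)
  \<comment> \<open>On the exceptional set the value is 0. That set belongs to every
    \<open>F t\<close>, so the limit stays adapted while every path becomes continuous.\<close>
  define I where "I t \<omega> = (if \<omega> \<in> N then 0 else lim (\<lambda>n. J n t \<omega>))" for t \<omega>
  have J_cont: "continuous_on {0..T} (\<lambda>t. J n t \<omega>)" if "\<omega> \<in> space M - N" for n \<omega>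
    using N(2)[OF that] by (auto intro: continuous_on_subset)
  \<comment> \<open>The events \<open>A n\<close> control successive differences only on
    \<open>Q\<close>; continuity extends the bound to \<open>{0..T}\<close>, and geometric decay
    gives uniform convergence.\<close>
  have unif: "uniform_limit {0..T} (\<lambda>n t. J n t \<omega>) (\<lambda>t. I t \<omega>) sequentially" if \<omega>: "\<omega> \<in> space M - N" for \<omega>
  proof -
    obtain n0 where n0: "\<And>n. n0 \<le> n \<Longrightarrow> \<omega> \<notin> A n"
      using N(2)[OF \<omega>] by (auto simp: eventually_sequentially)
    have "norm (J (Suc n) t \<omega> - J n t \<omega>) \<le> (1/2)^n" if "n0 \<le> n" "t \<in> {0..T}" for n t
    proof (rule continuous_on_closure_norm_le[where s=Q])
      show "continuous_on (closure Q) (\<lambda>t. J (Suc n) t \<omega> - J n t \<omega>)"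
        unfolding closure_Q by (intro continuous_intros J_cont \<omega>)
      show "\<forall>t\<in>Q. norm (J (Suc n) t \<omega> - J n t \<omega>) \<le> (1/2)^n"
        using n0[OF that(1)] \<omega> by (auto simp: A_def not_le intro: less_imp_le)
      show "t \<in> closure Q" using that(2) closure_Q by simp
    qed
    then have "uniformly_Cauchy_on {0..T} (\<lambda>n t. J n t \<omega>)"
      by (rule uniformly_Cauchy_geometric)
    then have "uniform_limit {0..T} (\<lambda>n t. J n t \<omega>) (\<lambda>t. lim (\<lambda>n. J n t \<omega>)) sequentially"
      by (simp add: uniformly_convergent_eq_Cauchy[symmetric] uniformly_convergent_uniform_limit_iff)
    then show ?thesis using \<omega> by (simp add: I_def)
  qed
  have J_lim: "(\<lambda>n. J n t \<omega>) \<longlonglongrightarrow> I t \<omega>" if "\<omega> \<in> space M - N" "t \<in> {0..T}" for \<omega> t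
    using tendsto_uniform_limitI[OF unif[OF that(1)] that(2)] .
  have I_cont: "continuous_on {0..T} (\<lambda>t. I t \<omega>)" if "\<omega> \<in> space M" for \<omega>
  proof (cases "\<omega> \<in> N")
    case False
    then have \<omega>: "\<omega> \<in> space M - N" using that by simp
    show ?thesis
      by (rule uniform_limit_theorem[OF _ unif[OF \<omega>]]) (auto intro: always_eventually J_cont[OF \<omega>])
  qed (simp add: I_def)
  have J_ad: "J n t \<in> borel_measurable (F t)" if "t \<in> {0..T}" for n t
    using elementary_integral_measurable(2)[OF el] that by auto
  have I_ad: "I t \<in> borel_measurable (F t)" if t: "t \<in> {0..T}" for t
  proof (rule borel_measurable_LIMSEQ_metric)
    fix n
    have "N \<inter> space (F t) \<in> sets (F t)" using null_sets_F[OF N(1), of t] sets.top[of "F t"] by (rule sets.Int)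
    then show "(\<lambda>\<omega>. if \<omega> \<in> N then 0 else J n t \<omega>) \<in> borel_measurable (F t)"
      using J_ad[OF t, of n] by (intro measurable_If_set) auto
  next
    fix \<omega> assume "\<omega> \<in> space (F t)"
    then show "(\<lambda>n. if \<omega> \<in> N then 0 else J n t \<omega>) \<longlonglongrightarrow> I t \<omega>"
      using J_lim[of \<omega> t] t by (cases "\<omega> \<in> N") (auto simp: I_def)
  qed
  \<comment> \<open>Fatou's lemma, letting \<open>m\<close> tend to infinity in the Cauchy estimate
    \<open>JJ\<close>.\<close>
  have I_L2: "msq M (\<lambda>\<omega>. J n t \<omega> - I t \<omega>) \<le> ennreal (6 * \<delta> n)" if t: "t \<in> {0..T}" for n t
  proof -
    note [measurable] = measurable_F_M[OF J_ad[OF t]]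
    have "AE \<omega> in M. \<omega> \<notin> N" using N(1) by (rule AE_not_in)
    then have "AE \<omega> in M. sqn (J n t \<omega> - I t \<omega>) = liminf (\<lambda>m. sqn (J n t \<omega> - J m t \<omega>))"
    proof (rule AE_mp[OF _ AE_I2], intro impI)
      fix \<omega> assume "\<omega> \<in> space M" "\<omega> \<notin> N"
      then have "(\<lambda>m. J m t \<omega>) \<longlonglongrightarrow> I t \<omega>" using J_lim t by auto
      then have "(\<lambda>m. sqn (J n t \<omega> - J m t \<omega>)) \<longlonglongrightarrow> sqn (J n t \<omega> - I t \<omega>)"
        by (intro tendsto_intros tendsto_ennrealI)
      from lim_imp_Liminf[OF _ this]
      show "sqn (J n t \<omega> - I t \<omega>) = liminf (\<lambda>m. sqn (J n t \<omega> - J m t \<omega>))" by simp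
    qed
    then have "msq M (\<lambda>\<omega>. J n t \<omega> - I t \<omega>) =
        (\<integral>\<^sup>+\<omega>. liminf (\<lambda>m. sqn (J n t \<omega> - J m t \<omega>)) \<partial>M)"
      by (rule nn_integral_cong_AE)
    also have "\<dots> \<le> liminf (\<lambda>m. \<integral>\<^sup>+\<omega>. sqn (J n t \<omega> - J m t \<omega>) \<partial>M)"
      by (rule nn_integral_liminf) measurable
    also have "\<dots> \<le> limsup (\<lambda>m. \<integral>\<^sup>+\<omega>. sqn (J n t \<omega> - J m t \<omega>) \<partial>M)"
      by (rule Liminf_le_Limsup) simp
    also have "\<dots> \<le> ennreal (6 * \<delta> n)"
      using JJ[OF _ t, of n] by (intro Limsup_bounded) (auto simp: eventually_sequentially)
    finally show ?thesis .
  qed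
  have \<delta>_lim: "(\<lambda>n. ennreal (c * \<delta> n)) \<longlonglongrightarrow> 0" for c
  proof -
    have "(\<lambda>n. c * \<delta> n) \<longlonglongrightarrow> c * 0"
      unfolding \<delta>_def by (intro tendsto_mult_left LIMSEQ_realpow_zero) auto
    from tendsto_ennrealI[OF this] show ?thesis by simp
  qed
  have "is_ito_integral M W T H I"
    unfolding is_ito_integral_def adapted_process_def
  proof (intro conjI ballI exI allI)
    show "jointly_measurable M T I"
      using measurable_F_M[OF I_ad] I_cont by (intro continuous_process_measurable T) auto
    show "I t \<in> borel_measurable (F t)" if "t \<in> {0..T}" for t using I_ad that .
    show "continuous_on {0..T} (\<lambda>t. I t \<omega>)" if "\<omega> \<in> space M" for \<omega> using I_cont that .
    show "elementary_integral M W (G n) (J n)" for n by (rule el)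
    show "(\<lambda>n. \<integral>\<^sup>+t\<in>{0..T}. msq M (\<lambda>\<omega>. G n t \<omega> - H t \<omega>) \<partial>lborel) \<longlonglongrightarrow> 0"
      unfolding energy_def[symmetric]
      by (rule tendsto_sandwich[OF _ _ tendsto_const \<delta>_lim[of 1]]) (use less_imp_le[OF G] in \<open>auto intro: always_eventually\<close>)
    show "(\<lambda>n. \<integral>\<^sup>+\<omega>. sqn (J n t \<omega> - I t \<omega>) \<partial>M) \<longlonglongrightarrow> 0" if "t \<in> {0..T}" for t
      by (rule tendsto_sandwich[OF _ _ tendsto_const \<delta>_lim[of 6]]) (use I_L2[OF that] in \<open>auto intro: always_eventually\<close>)
  qed
  then show ?thesis by (rule exI[of "is_ito_integral M W T H" I])
qed

lemma is_ito_integral_ito_integral: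
  "0 \<le> T \<Longrightarrow> H \<in> L2F M W T \<Longrightarrow> is_ito_integral M W T H (ito_integral M W T H)"
  unfolding ito_integral_def by (rule someI_ex[OF ito_integral_exists])

text \<open>The isometry for the approximating elementary processes, carried to the limit. Three
  nested splittings with factor 3 produce 27. Applied to equal integrands it also says that two
  versions agree almost surely at each time.\<close>

lemma is_ito_integral_energy:
  fixes H H' :: "real \<Rightarrow> 'a \<Rightarrow> real ^ 'd ^ 'k"
  assumes I: "is_ito_integral M W T H I" and I': "is_ito_integral M W T H' I'" and t: "t \<in> {0..T}"
    and H: "jointly_measurable M T H"
    and H': "jointly_measurable M T H'"
  shows "msq M (\<lambda>\<omega>. I t \<omega> - I' t \<omega>) \<le> 27 * energy M t (\<lambda>t \<omega>. H t \<omega> - H' t \<omega>)"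
proof -
  obtain G J where el: "\<And>n. elementary_integral M W (G n) (J n)"
    and G: "(\<lambda>n. energy M T (\<lambda>t \<omega>. G n t \<omega> - H t \<omega>)) \<longlonglongrightarrow> 0"
    and J: "(\<lambda>n. \<integral>\<^sup>+\<omega>. sqn (J n t \<omega> - I t \<omega>) \<partial>M) \<longlonglongrightarrow> 0"
    using I t unfolding is_ito_integral_def energy_def by blast
  obtain G' J' where el': "\<And>n. elementary_integral M W (G' n) (J' n)"
    and G': "(\<lambda>n. energy M T (\<lambda>t \<omega>. G' n t \<omega> - H' t \<omega>)) \<longlonglongrightarrow> 0"
    and J': "(\<lambda>n. \<integral>\<^sup>+\<omega>. sqn (J' n t \<omega> - I' t \<omega>) \<partial>M) \<longlonglongrightarrow> 0"
    using I' t unfolding is_ito_integral_def energy_def by blast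
  have t': "0 \<le> t" "t \<le> T" using t by auto
  have Gm: "jointly_measurable M t (G n)" for n
    by (rule measurable_restrict_time[OF elementary_integral_measurable(1)[OF el]])
  have Gm': "jointly_measurable M t (G' n)" for n
    by (rule measurable_restrict_time[OF elementary_integral_measurable(1)[OF el']])
  note [measurable] = measurable_F_M[OF elementary_integral_measurable(2)[OF el t'(1)]]
    measurable_F_M[OF elementary_integral_measurable(2)[OF el' t'(1)]]
  have [measurable]: "I t \<in> borel_measurable M" "I' t \<in> borel_measurable M"
    using I I' t measurable_F_M by (auto simp: is_ito_integral_def adapted_process_def)
  let ?e = "energy M t (\<lambda>t \<omega>. H t \<omega> - H' t \<omega>)"
  let ?j = "\<lambda>n. \<integral>\<^sup>+\<omega>. sqn (J n t \<omega> - I t \<omega>) \<partial>M"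
  let ?j' = "\<lambda>n. \<integral>\<^sup>+\<omega>. sqn (J' n t \<omega> - I' t \<omega>) \<partial>M"
  let ?g = "\<lambda>n. energy M T (\<lambda>t \<omega>. G n t \<omega> - H t \<omega>)"
  let ?g' = "\<lambda>n. energy M T (\<lambda>t \<omega>. G' n t \<omega> - H' t \<omega>)"
  have le: "msq M (\<lambda>\<omega>. I t \<omega> - I' t \<omega>) \<le>
      3 * (?j n + 3 * (?g n + 3 * (?e + ?g' n)) + ?j' n)" for n
  proof -
    have "msq M (\<lambda>\<omega>. I t \<omega> - I' t \<omega>) \<le>
        (\<integral>\<^sup>+\<omega>. 3 * (sqn (J n t \<omega> - I t \<omega>) + sqn (J n t \<omega> - J' n t \<omega>) +
          sqn (J' n t \<omega> - I' t \<omega>)) \<partial>M)"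
    proof (rule nn_integral_mono)
      fix \<omega>
      show "sqn (I t \<omega> - I' t \<omega>) \<le> 3 * (sqn (J n t \<omega> - I t \<omega>) +
          sqn (J n t \<omega> - J' n t \<omega>) + sqn (J' n t \<omega> - I' t \<omega>))"
        using ennreal_norm_add3_sq[of "I t \<omega> - J n t \<omega>" "J n t \<omega> - J' n t \<omega>" "J' n t \<omega> - I' t \<omega>"]
        by (simp add: norm_minus_commute[of "I t \<omega>"])
    qed
    also have "\<dots> = 3 * (?j n + msq M (\<lambda>\<omega>. J n t \<omega> - J' n t \<omega>) + ?j' n)"
      by (subst nn_integral_cmult, measurable, subst nn_integral_add, measurable, subst nn_integral_add, measurable)
    also have "msq M (\<lambda>\<omega>. J n t \<omega> - J' n t \<omega>) = energy M t (\<lambda>t \<omega>. G n t \<omega> - G' n t \<omega>)"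
      unfolding energy_def by (rule elementary_isometry[OF elementary_integral_diff[OF el el'] t'(1)])
    also have "\<dots> \<le> 3 * (energy M t (\<lambda>t \<omega>. G n t \<omega> - H t \<omega>) + energy M t (\<lambda>t \<omega>. H t \<omega> - G' n t \<omega>))"
      by (rule energy_triangle[OF Gm process_measurable_mono[OF t'(2) H] Gm'])
    also have "\<dots> \<le> 3 * (?g n + 3 * (?e + ?g' n))"
    proof (intro mult_left_mono add_mono energy_mono t')
      have "energy M t (\<lambda>t \<omega>. H t \<omega> - G' n t \<omega>) \<le> 3 * (?e + energy M t (\<lambda>t \<omega>. H' t \<omega> - G' n t \<omega>))"
        by (rule energy_triangle[OF process_measurable_mono[OF t'(2) H] process_measurable_mono[OF t'(2) H'] Gm'])
      also have "\<dots> \<le> 3 * (?e + ?g' n)"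
        unfolding energy_minus_commute[of M t H'] by (intro mult_left_mono add_mono energy_mono t') auto
      finally show "energy M t (\<lambda>t \<omega>. H t \<omega> - G' n t \<omega>) \<le> 3 * (?e + ?g' n)" .
    qed auto
    finally show ?thesis by (simp add: mult_left_mono add_mono)
  qed
  have "(\<lambda>n. 3 * (?j n + 3 * (?g n + 3 * (?e + ?g' n)) + ?j' n)) \<longlonglongrightarrow> 3 * (0 + 3 * (0 + 3 * (?e + 0)) + 0)"
    by (intro ennreal_tendsto_cmult tendsto_add J J' G G' tendsto_const) auto
  moreover have "3 * (0 + 3 * (0 + 3 * (?e + 0)) + 0) = 27 * ?e"
    by (simp add: mult.assoc[symmetric])
  ultimately show ?thesis using le by (intro LIMSEQ_le_const) auto
qed

end

section \<open>Integral inequalities and sections of processes\<close>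

text \<open>The weight \<open>exp (- 2 K t)\<close> turns the integral inequality into a contraction.\<close>

lemma gronwall_ennreal:
  fixes u :: "real \<Rightarrow> ennreal"
  assumes K: "0 < K" and B: "B < \<infinity>" "\<And>t. t \<in> {0..T} \<Longrightarrow> u t \<le> B"
    and le: "\<And>t. t \<in> {0..T} \<Longrightarrow> u t \<le> ennreal K * (\<integral>\<^sup>+s\<in>{0..t}. u s \<partial>lborel)"
    and t: "t \<in> {0..T}"
  shows "u t = 0"
proof -
  define m where "m = (SUP t\<in>{0..T}. ennreal (exp (- 2 * K * t)) * u t)"
  have "m \<le> B"
    unfolding m_def
  proof (rule SUP_least)
    fix t assume t: "t \<in> {0..T}"
    have "ennreal (exp (- 2 * K * t)) * u t \<le> 1 * B"
      using t K B(2) by (intro mult_mono) (auto simp: ennreal_le_1)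
    then show "ennreal (exp (- 2 * K * t)) * u t \<le> B" by simp
  qed
  \<comment> \<open>Finiteness is what allows \<open>m = 0\<close> to be concluded from
    \<open>m \<le> m / 2\<close>.\<close>
  then have m_fin: "m < \<infinity>" using B(1) by (rule le_less_trans)
  have u_le: "u s \<le> ennreal (exp (2 * K * s)) * m" if s: "s \<in> {0..T}" for s
  proof -
    have "u s = ennreal (exp (2 * K * s)) * (ennreal (exp (- 2 * K * s)) * u s)"
      by (simp add: mult.assoc[symmetric] ennreal_mult[symmetric] exp_add[symmetric])
    also have "\<dots> \<le> ennreal (exp (2 * K * s)) * m"
      unfolding m_def using s by (intro mult_left_mono SUP_upper) auto
    finally show ?thesis .
  qed
  \<comment> \<open>Integrating \<open>exp (2 * K * s)\<close> yields the divisor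
    \<open>2 * K\<close>, which the factor \<open>K\<close> of the hypothesis reduces to 2.\<close>
  have half: "ennreal (exp (- 2 * K * t)) * u t \<le> m * ennreal (1/2)" if t: "t \<in> {0..T}" for t
  proof -
    have "(\<integral>\<^sup>+s\<in>{0..t}. u s \<partial>lborel) \<le> (\<integral>\<^sup>+s. m * (ennreal (exp (2 * K * s)) * indicator {0..t} s) \<partial>lborel)"
      using u_le t by (intro nn_integral_mono) (auto simp: indicator_def mult.commute)
    also have "\<dots> = m * (\<integral>\<^sup>+s. ennreal (exp (2 * K * s)) * indicator {0..t} s \<partial>lborel)"
      by (rule nn_integral_cmult) auto
    also have "(\<integral>\<^sup>+s. ennreal (exp (2 * K * s)) * indicator {0..t} s \<partial>lborel) =
        ennreal (exp (2 * K * t) / (2 * K) - exp (2 * K * 0) / (2 * K))"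
      using K t by (intro nn_integral_FTC_Icc) (auto intro!: derivative_eq_intros)
    also have "\<dots> \<le> ennreal (exp (2 * K * t) / (2 * K))"
      using K by (intro ennreal_leI) auto
    finally have "(\<integral>\<^sup>+s\<in>{0..t}. u s \<partial>lborel) \<le> m * ennreal (exp (2 * K * t) / (2 * K))"
      by (simp add: mult_left_mono)
    then have "u t \<le> ennreal K * (m * ennreal (exp (2 * K * t) / (2 * K)))"
      using le[OF t] by (meson mult_left_mono order_trans zero_le)
    then have "ennreal (exp (- 2 * K * t)) * u t \<le>
        ennreal (exp (- 2 * K * t)) * (ennreal K * (m * ennreal (exp (2 * K * t) / (2 * K))))"
      by (rule mult_left_mono) simp
    also have "\<dots> = m * (ennreal (exp (- 2 * K * t)) * ennreal K * ennreal (exp (2 * K * t) / (2 * K)))"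
      by (simp only: mult_ac)
    also have "ennreal (exp (- 2 * K * t)) * ennreal K * ennreal (exp (2 * K * t) / (2 * K)) = ennreal (1/2)"
      using K by (simp add: ennreal_mult[symmetric] exp_minus)
    finally show ?thesis .
  qed
  have "m \<le> m * ennreal (1/2)"
    by (subst (1) m_def, rule SUP_least) (rule half)
  then have "m = 0"
  proof (cases m)
    case (real r)
    then have "r \<le> r * (1/2)"
      using \<open>m \<le> m * ennreal (1/2)\<close> by (simp add: ennreal_mult[symmetric] del: ennreal_half)
    then show ?thesis using real by simp
  qed (use m_fin in simp)
  then show ?thesis using u_le[OF t] by simp
qed

text \<open>On an interval of finite length the bound \<open>x \<le> 1 + x\<^sup>2\<close>
  suffices.\<close>

lemma square_set_integrable:
  fixes f :: "real \<Rightarrow> 'v::euclidean_space"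
  assumes m: "(\<lambda>s. indicator {0..T} s *\<^sub>R f s) \<in> borel_measurable borel"
    and fin: "(\<integral>\<^sup>+s\<in>{0..T}. sqn (f s) \<partial>lborel) < \<infinity>"
  shows "set_integrable lborel {0..T} f"
  unfolding set_integrable_def integrable_iff_bounded
proof
  show "(\<lambda>s. indicator {0..T} s *\<^sub>R f s) \<in> borel_measurable lborel" using m by simp
  have "(\<integral>\<^sup>+s. ennreal (norm (indicator {0..T} s *\<^sub>R f s)) \<partial>lborel) \<le>
      (\<integral>\<^sup>+s. indicator {0..T} s + sqn (indicator {0..T} s *\<^sub>R f s) \<partial>lborel)"
  proof (intro nn_integral_mono)
    fix s
    have "x \<le> 1 + x\<^sup>2" if "0 \<le> x" for x :: real
      using sum_squares_bound[of 1 x] that unfolding one_power2 by linarith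
    from this[of "norm (f s)"] have "ennreal (norm (f s)) \<le> 1 + sqn (f s)"
      by (metis ennreal_1 ennreal_leI ennreal_plus norm_ge_zero zero_le_one zero_le_power2)
    then show "ennreal (norm (indicator {0..T} s *\<^sub>R f s)) \<le>
        indicator {0..T} s + sqn (indicator {0..T} s *\<^sub>R f s)"
      by (auto simp: indicator_def)
  qed
  also have "\<dots> = emeasure lborel {0..T} + (\<integral>\<^sup>+s. sqn (indicator {0..T} s *\<^sub>R f s) \<partial>lborel)"
    using m by (subst nn_integral_add) (auto simp del: norm_scaleR)
  also have "(\<integral>\<^sup>+s. sqn (indicator {0..T} s *\<^sub>R f s) \<partial>lborel) =
      (\<integral>\<^sup>+s\<in>{0..T}. sqn (f s) \<partial>lborel)"
    by (intro nn_integral_cong) (auto simp: indicator_def)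
  also have "emeasure lborel {0..T} + \<dots> < \<infinity>"
    using fin by (auto simp: emeasure_lborel_Icc_eq)
  finally show "(\<integral>\<^sup>+s. ennreal (norm (indicator {0..T} s *\<^sub>R f s)) \<partial>lborel) < \<infinity>" .
qed

text \<open>Cauchy-Schwarz against the indicator of the interval, whose length is the factor
  \<open>t\<close>.\<close>

lemma set_integral_sq_bound:
  fixes f :: "real \<Rightarrow> 'v::euclidean_space"
  assumes f: "set_integrable lborel {0..t} f" and t: "0 \<le> t"
  shows "sqn (LINT s:{0..t}|lborel. f s) \<le>
    ennreal t * (\<integral>\<^sup>+s\<in>{0..t}. sqn (f s) \<partial>lborel)"
proof -
  have i: "integrable lborel (\<lambda>s. indicator {0..t} s *\<^sub>R f s)" using f by (simp add: set_integrable_def)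
  then have [measurable]: "(\<lambda>s. indicator {0..t} s *\<^sub>R f s) \<in> borel_measurable borel" by auto
  let ?n = "\<lambda>s. ennreal (norm (indicator {0..t} s *\<^sub>R f s))"
  have "ennreal (norm (LINT s:{0..t}|lborel. f s)) \<le> (\<integral>\<^sup>+s. ?n s \<partial>lborel)"
    unfolding set_lebesgue_integral_def by (rule integral_norm_bound_ennreal[OF i])
  also have "\<dots> = (\<integral>\<^sup>+s. indicator {0..t} s * ?n s \<partial>lborel)"
    by (intro nn_integral_cong) (auto simp: indicator_def)
  finally have "(ennreal (norm (LINT s:{0..t}|lborel. f s)))\<^sup>2 \<le> (\<integral>\<^sup>+s. indicator {0..t} s * ?n s \<partial>lborel)\<^sup>2"
    by (rule power_mono) simp
  also have "\<dots> \<le> (\<integral>\<^sup>+s. (indicator {0..t} s)\<^sup>2 \<partial>lborel) * (\<integral>\<^sup>+s. (?n s)\<^sup>2 \<partial>lborel)"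
    by (rule Cauchy_Schwarz_nn_integral) measurable
  also have "(\<integral>\<^sup>+s. (indicator {0..t} s)\<^sup>2 \<partial>lborel) = (\<integral>\<^sup>+s. indicator {0..t} s \<partial>lborel)"
    by (intro nn_integral_cong) (auto simp: indicator_def)
  also have "\<dots> = ennreal t" using t by simp
  also have "(\<integral>\<^sup>+s. (?n s)\<^sup>2 \<partial>lborel) = (\<integral>\<^sup>+s\<in>{0..t}. sqn (f s) \<partial>lborel)"
    by (intro nn_integral_cong) (auto simp: indicator_def ennreal_power)
  finally show ?thesis by (simp add: ennreal_power)
qed

lemma continuous_on_set_integral:
  fixes f :: "real \<Rightarrow> 'v::euclidean_space"
  assumes f: "set_integrable lborel {0..T} f"
  shows "continuous_on {0..T} (\<lambda>t. LINT s:{0..t}|lborel. f s)"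
    and "continuous_on {0..T} (\<lambda>t. LINT s:{t..T}|lborel. f s)"
proof -
  have i: "f integrable_on {0..T}" by (rule set_borel_integral_eq_integral(1)[OF f])
  have eq1: "(LINT s:{0..t}|lborel. f s) = integral {0..t} f" if "t \<in> {0..T}" for t
    by (rule set_borel_integral_eq_integral(2)[OF set_integrable_subset[OF f]]) (use that in auto)
  show "continuous_on {0..T} (\<lambda>t. LINT s:{0..t}|lborel. f s)"
    by (rule continuous_on_eq[OF indefinite_integral_continuous_1[OF i] eq1[symmetric]])
  have eq2: "(LINT s:{t..T}|lborel. f s) = integral {t..T} f" if "t \<in> {0..T}" for t
    by (rule set_borel_integral_eq_integral(2)[OF set_integrable_subset[OF f]]) (use that in auto)
  show "continuous_on {0..T} (\<lambda>t. LINT s:{t..T}|lborel. f s)"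
    by (rule continuous_on_eq[OF indefinite_integral_continuous_1'[OF i] eq2[symmetric]])
qed

section \<open>From almost every time to every time\<close>

lemma closure_cofull_Icc:
  fixes S :: "real set"
  assumes T: "0 < T" and S: "{0..T} - S \<in> null_sets lborel"
  shows "{0..T} \<subseteq> closure S"
proof -
  \<comment> \<open>A nonempty open set is not negligible, so the part of the open interval missed
    by the closure is empty.\<close>
  have "open ({0<..<T} - closure S)" by (intro open_Diff) auto
  moreover have "negligible ({0<..<T} - closure S)"
  proof (rule negligible_subset)
    show "negligible ({0..T} - S)"
      using S by (auto simp: negligible_iff_null_sets null_sets_completionI)
    show "{0<..<T} - closure S \<subseteq> {0..T} - S" using closure_subset[of S] by auto
  qed
  ultimately have "{0<..<T} - closure S = {}" using open_not_negligible by blast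
  then have "closure {0<..<T} \<subseteq> closure S" by (intro closure_minimal) auto
  then show ?thesis using T by simp
qed

text \<open>The exceptional set in the hypothesis may depend on \<open>t\<close>. A countable dense
  subset of \<open>S\<close> has a common one, and continuity does the rest. With
  \<open>S = {0..T}\<close> this exchanges "for all times" and "almost surely".\<close>

lemma AE_continuous_eq_0:
  fixes D :: "real \<Rightarrow> 'a \<Rightarrow> 'v::real_normed_vector"
  assumes cont: "AE \<omega> in M. continuous_on {0..T} (\<lambda>t. D t \<omega>)"
    and S: "S \<subseteq> {0..T}" "{0..T} \<subseteq> closure S"
    and D: "\<And>t. t \<in> S \<Longrightarrow> AE \<omega> in M. D t \<omega> = 0"
  shows "AE \<omega> in M. \<forall>t\<in>{0..T}. D t \<omega> = 0"
proof -
  obtain Q where Q: "countable Q" "Q \<subseteq> S" "S \<subseteq> closure Q"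
    using separable[of S] by blast
  have "closure S \<subseteq> closure Q" using Q(3) by (intro closure_minimal) auto
  then have cl: "closure Q = {0..T}"
    using S Q(2) closure_minimal[of Q "{0..T}"] by auto
  have "AE \<omega> in M. \<forall>t\<in>Q. D t \<omega> = 0"
    using Q D by (subst AE_ball_countable) auto
  with cont show ?thesis
  proof eventually_elim
    case (elim \<omega>)
    show ?case
    proof
      fix t assume "t \<in> {0..T}"
      then have "norm (D t \<omega>) \<le> 0"
        using elim by (intro continuous_on_closure_norm_le[where s=Q and f="\<lambda>t. D t \<omega>"]) (auto simp: cl)
      then show "D t \<omega> = 0" by simp
    qed
  qed
qed

lemma (in prob_space) energy_le:
  fixes X Y :: "real \<Rightarrow> 'a \<Rightarrow> 'v::euclidean_space"
    and X' :: "real \<Rightarrow> 'a \<Rightarrow> 'w::euclidean_space"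
  assumes le: "\<And>t. t \<in> {0..T} \<Longrightarrow> AE \<omega> in M. norm (X' t \<omega>) \<le> L * norm (X t \<omega>)"
    and L: "0 \<le> L"
    and X: "jointly_measurable M T X"
  shows "energy M T X' \<le> ennreal (L\<^sup>2) * energy M T X"
proof -
  have "(\<lambda>(t, \<omega>). sqn (X t \<omega>)) \<in> borel_measurable (restrict_space borel {0..T} \<Otimes>\<^sub>M M)"
    using X by (simp add: split_beta)
  then have "(\<lambda>t. \<integral>\<^sup>+\<omega>. sqn (X t \<omega>) \<partial>M) \<in> borel_measurable (restrict_space borel {0..T})"
    by (rule borel_measurable_nn_integral)
  then have m: "(\<lambda>t. msq M (\<lambda>\<omega>. X t \<omega>) * indicator {0..T} t) \<in> borel_measurable borel"
    by (subst (asm) borel_measurable_restrict_space_iff_ennreal) auto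
  have "energy M T X' \<le> (\<integral>\<^sup>+t. ennreal (L\<^sup>2) * (msq M (\<lambda>\<omega>. X t \<omega>) * indicator {0..T} t) \<partial>lborel)"
    unfolding energy_def
  proof (rule nn_integral_mono)
    fix t
    show "msq M (\<lambda>\<omega>. X' t \<omega>) * indicator {0..T} t \<le>
        ennreal (L\<^sup>2) * (msq M (\<lambda>\<omega>. X t \<omega>) * indicator {0..T} t)"
    proof (cases "t \<in> {0..T}")
      case True
      have [measurable]: "X t \<in> borel_measurable M"
        using measurable_Pair2[OF X, of t] True by (simp add: space_restrict_space)
      have "msq M (\<lambda>\<omega>. X' t \<omega>) \<le> (\<integral>\<^sup>+\<omega>. ennreal (L\<^sup>2) * sqn (X t \<omega>) \<partial>M)"
      proof (rule nn_integral_mono_AE)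
        show "AE \<omega> in M. sqn (X' t \<omega>) \<le> ennreal (L\<^sup>2) * sqn (X t \<omega>)"
          using le[OF True]
        proof eventually_elim
          case (elim \<omega>)
          then have "(norm (X' t \<omega>))\<^sup>2 \<le> (L * norm (X t \<omega>))\<^sup>2" by (rule power_mono) simp
          then show ?case by (simp add: ennreal_mult[symmetric] power_mult_distrib ennreal_leI)
        qed
      qed
      also have "\<dots> = ennreal (L\<^sup>2) * msq M (\<lambda>\<omega>. X t \<omega>)"
        by (rule nn_integral_cmult) measurable
      finally show ?thesis using True by simp
    qed simp
  qed
  also have "\<dots> = ennreal (L\<^sup>2) * energy M T X"
    unfolding energy_def by (rule nn_integral_cmult) (use m in simp)
  finally show ?thesis .
qed

lemma process_section_measurable:
  fixes X :: "real \<Rightarrow> 'a \<Rightarrow> 'v::euclidean_space"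
  assumes T: "0 \<le> T" and X: "jointly_measurable M T X"
    and \<omega>: "\<omega> \<in> space M"
  shows "(\<lambda>s. indicator {0..T} s *\<^sub>R X s \<omega>) \<in> borel_measurable borel"
proof -
  have "(\<lambda>t. if t \<in> {0..T} then X t \<omega> else 0) \<in> borel_measurable borel"
    using measurable_Pair1[OF extend_process_measurable[OF T X] \<omega>] by simp
  also have "(\<lambda>t. if t \<in> {0..T} then X t \<omega> else 0) = (\<lambda>s. indicator {0..T} s *\<^sub>R X s \<omega>)"
    by (auto simp: fun_eq_iff)
  finally show ?thesis .
qed

lemma (in prob_space)
  fixes X :: "real \<Rightarrow> 'a \<Rightarrow> 'v::euclidean_space"
  assumes T: "0 \<le> T" and X: "jointly_measurable M T X"
  shows energy_swap: "energy M T X = (\<integral>\<^sup>+\<omega>. (\<integral>\<^sup>+t\<in>{0..T}. sqn (X t \<omega>) \<partial>lborel) \<partial>M)"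
    and energy_section_measurable:
      "(\<lambda>\<omega>. \<integral>\<^sup>+t\<in>{0..T}. sqn (X t \<omega>) \<partial>lborel) \<in> borel_measurable M"
proof -
  interpret pair_sigma_finite lborel M ..
  let ?E = "\<lambda>x. if fst x \<in> {0..T} then X (fst x) (snd x) else 0"
  have E[measurable]: "?E \<in> borel_measurable (borel \<Otimes>\<^sub>M M)"
    using extend_process_measurable[OF T X] by (simp add: split_beta)
  have sec: "(\<integral>\<^sup>+t\<in>{0..T}. sqn (X t \<omega>) \<partial>lborel) = (\<integral>\<^sup>+t. sqn (?E (t, \<omega>)) \<partial>lborel)" for \<omega>
    by (intro nn_integral_cong) (auto simp: indicator_def)
  have "energy M T X = (\<integral>\<^sup>+t. msq M (\<lambda>\<omega>. ?E (t, \<omega>)) \<partial>lborel)"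
    unfolding energy_def by (intro nn_integral_cong) (auto simp: indicator_def)
  also have "\<dots> = (\<integral>\<^sup>+\<omega>. (\<integral>\<^sup>+t. sqn (?E (t, \<omega>)) \<partial>lborel) \<partial>M)"
    by (rule Fubini'[symmetric]) measurable
  finally show "energy M T X = (\<integral>\<^sup>+\<omega>. (\<integral>\<^sup>+t\<in>{0..T}. sqn (X t \<omega>) \<partial>lborel) \<partial>M)"
    unfolding sec .
  have "(\<lambda>x. ?E (snd x, fst x)) \<in> borel_measurable (M \<Otimes>\<^sub>M lborel)"
    by (rule measurable_compose[OF _ E]) measurable
  then have "(\<lambda>(\<omega>, t). sqn (?E (t, \<omega>))) \<in> borel_measurable (M \<Otimes>\<^sub>M lborel)"
    by (simp add: split_beta)
  then have "(\<lambda>\<omega>. \<integral>\<^sup>+t. sqn (?E (t, \<omega>)) \<partial>lborel) \<in> borel_measurable M"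
    by (rule lborel.borel_measurable_nn_integral)
  then show "(\<lambda>\<omega>. \<integral>\<^sup>+t\<in>{0..T}. sqn (X t \<omega>) \<partial>lborel) \<in> borel_measurable M"
    unfolding sec .
qed

lemma (in prob_space) AE_set_integrable:
  fixes X :: "real \<Rightarrow> 'a \<Rightarrow> 'v::euclidean_space"
  assumes T: "0 \<le> T" and X: "jointly_measurable M T X"
    and fin: "energy M T X < \<infinity>"
  shows "AE \<omega> in M. set_integrable lborel {0..T} (\<lambda>s. X s \<omega>)"
proof -
  have "AE \<omega> in M. (\<integral>\<^sup>+t\<in>{0..T}. sqn (X t \<omega>) \<partial>lborel) \<noteq> \<infinity>"
    using fin unfolding energy_swap[OF T X]
    by (intro nn_integral_PInf_AE energy_section_measurable[OF T X]) auto
  then show ?thesis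
  proof (rule AE_mp[OF _ AE_I2], intro impI)
    fix \<omega> assume "\<omega> \<in> space M" "(\<integral>\<^sup>+t\<in>{0..T}. sqn (X t \<omega>) \<partial>lborel) \<noteq> \<infinity>"
    then show "set_integrable lborel {0..T} (\<lambda>s. X s \<omega>)"
      by (intro square_set_integrable process_section_measurable[OF T X]) (auto simp: top.not_eq_extremum)
  qed
qed

section \<open>Forward equation\<close>

lemma L2F_iff: "X \<in> L2F M W T \<longleftrightarrow> adapted_process M W T X \<and> energy M T X < \<infinity>"
  by (simp add: L2F_def energy_def)

lemma adapted_process_joint:
  "adapted_process M W T X \<Longrightarrow> jointly_measurable M T X"
  by (simp add: adapted_process_def)

lemma adapted_process_diff:
  fixes X :: "real \<Rightarrow> 'a \<Rightarrow> 'v::euclidean_space" and Y :: "real \<Rightarrow> 'a \<Rightarrow> 'v"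
  assumes "adapted_process M W T X" "adapted_process M W T Y"
  shows "adapted_process M W T (\<lambda>t \<omega>. X t \<omega> - Y t \<omega>)"
  unfolding adapted_process_def
proof (intro conjI ballI)
  show "(\<lambda>(t, \<omega>). X t \<omega> - Y t \<omega>) \<in> borel_measurable (restrict_space borel {0..T} \<Otimes>\<^sub>M M)"
    using borel_measurable_diff[OF assms[THEN adapted_process_joint]] by (simp add: split_beta)
  fix t assume "t \<in> {0..T}"
  then have "X t \<in> borel_measurable (brownian_filtration M W t)" "Y t \<in> borel_measurable (brownian_filtration M W t)"
    using assms by (simp_all add: adapted_process_def)
  then show "(\<lambda>\<omega>. X t \<omega> - Y t \<omega>) \<in> borel_measurable (brownian_filtration M W t)"
    by (rule borel_measurable_diff)
qed

lemma adapted_process_Pair: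
  fixes X :: "real \<Rightarrow> 'a \<Rightarrow> 'v::euclidean_space" and Y :: "real \<Rightarrow> 'a \<Rightarrow> 'w::euclidean_space"
  assumes "adapted_process M W T X" "adapted_process M W T Y"
  shows "adapted_process M W T (\<lambda>t \<omega>. (X t \<omega>, Y t \<omega>))"
  unfolding adapted_process_def
proof (intro conjI ballI)
  show "(\<lambda>(t, \<omega>). (X t \<omega>, Y t \<omega>)) \<in> borel_measurable (restrict_space borel {0..T} \<Otimes>\<^sub>M M)"
    using borel_measurable_Pair[OF assms[THEN adapted_process_joint]] by (simp add: split_beta)
  fix t assume "t \<in> {0..T}"
  then have "X t \<in> borel_measurable (brownian_filtration M W t)" "Y t \<in> borel_measurable (brownian_filtration M W t)"
    using assms by (simp_all add: adapted_process_def)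
  then show "(\<lambda>\<omega>. (X t \<omega>, Y t \<omega>)) \<in> borel_measurable (brownian_filtration M W t)"
    by (rule borel_measurable_Pair)
qed

text \<open>A coefficient is Lipschitz only off a null set \<open>N\<close>; on \<open>N\<close> its composition with a process need
  not be measurable.\<close>

definition compose_off :: "'a set \<Rightarrow> (real \<Rightarrow> 'a \<Rightarrow> 'p \<Rightarrow> 'v::zero) \<Rightarrow> (real \<Rightarrow> 'a \<Rightarrow> 'p) \<Rightarrow> real \<Rightarrow> 'a \<Rightarrow> 'v" where
  "compose_off N \<phi> U t \<omega> = (if \<omega> \<in> N then 0 else \<phi> t \<omega> (U t \<omega>))"

text \<open>The integrand enters the predicate only through mean square distances, which ignore null
  sets.\<close>

lemma is_ito_integral_cong:
  assumes "\<And>t. t \<in> {0..T} \<Longrightarrow> AE \<omega> in M. H t \<omega> = H' t \<omega>"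
  shows "is_ito_integral M W T H = is_ito_integral M W T H'"
proof -
  have "(\<integral>\<^sup>+t\<in>{0..T}. msq M (\<lambda>\<omega>. G t \<omega> - H t \<omega>) \<partial>lborel) =
      (\<integral>\<^sup>+t\<in>{0..T}. msq M (\<lambda>\<omega>. G t \<omega> - H' t \<omega>) \<partial>lborel)" for G
  proof (rule nn_integral_cong)
    fix t
    show "msq M (\<lambda>\<omega>. G t \<omega> - H t \<omega>) * indicator {0..T} t =
        msq M (\<lambda>\<omega>. G t \<omega> - H' t \<omega>) * indicator {0..T} t"
    proof (cases "t \<in> {0..T}")
      case True
      have "msq M (\<lambda>\<omega>. G t \<omega> - H t \<omega>) = msq M (\<lambda>\<omega>. G t \<omega> - H' t \<omega>)"
        using assms[OF True] by (intro nn_integral_cong_AE) (auto elim: eventually_mono)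
      then show ?thesis by simp
    qed simp
  qed
  then show ?thesis by (simp add: is_ito_integral_def fun_eq_iff)
qed

section \<open>Coefficients along processes, and uniqueness for the forward equation\<close>

context brownian_space
begin

lemma L2F_cont_subset_L2F:
  assumes T: "0 \<le> T" and X: "X \<in> L2F_cont M W T"
  shows "X \<in> L2F M W T" and "t \<in> {0..T} \<Longrightarrow> msq M (\<lambda>\<omega>. X t \<omega>) \<le>
    (\<integral>\<^sup>+\<omega>. (SUP t\<in>{0..T}. sqn (X t \<omega>)) \<partial>M)"
proof -
  let ?S = "\<integral>\<^sup>+\<omega>. (SUP t\<in>{0..T}. sqn (X t \<omega>)) \<partial>M"
  have le: "msq M (\<lambda>\<omega>. X t \<omega>) \<le> ?S" if "t \<in> {0..T}" for t
    using that by (intro nn_integral_mono SUP_upper)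
  then show "t \<in> {0..T} \<Longrightarrow> msq M (\<lambda>\<omega>. X t \<omega>) \<le> ?S" .
  have "energy M T X \<le> (\<integral>\<^sup>+t. ?S * indicator {0..T} t \<partial>lborel)"
    unfolding energy_def using le by (intro nn_integral_mono) (auto simp: indicator_def)
  also have "\<dots> = ?S * ennreal T" using T by (subst nn_integral_cmult_indicator) auto
  also have "\<dots> < \<infinity>" using X by (auto simp: L2F_cont_def ennreal_mult_less_top)
  finally show "X \<in> L2F M W T" using X by (simp add: L2F_iff L2F_cont_def)
qed

lemma L2F_Pair:
  fixes X :: "real \<Rightarrow> 'a \<Rightarrow> 'v::euclidean_space" and Y :: "real \<Rightarrow> 'a \<Rightarrow> 'w::euclidean_space"
  assumes X: "X \<in> L2F M W T" and Y: "Y \<in> L2F M W T"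
  shows "(\<lambda>t \<omega>. (X t \<omega>, Y t \<omega>)) \<in> L2F M W T"
proof -
  have ad: "adapted_process M W T X" "adapted_process M W T Y" using X Y by (auto simp: L2F_iff)
  have z: "adapted_process M W T (\<lambda>t \<omega>. 0 :: 'u::euclidean_space)"
    by (simp add: adapted_process_def)
  note j = adapted_process_joint[OF adapted_process_Pair[OF ad(1) ad(2)]]
    adapted_process_joint[OF adapted_process_Pair[OF ad(1) z]] adapted_process_joint[OF adapted_process_Pair[OF z z]]
  have "energy M T (\<lambda>t \<omega>. (X t \<omega>, Y t \<omega>) - (0, 0)) \<le>
      3 * (energy M T (\<lambda>t \<omega>. (X t \<omega>, Y t \<omega>) - (X t \<omega>, 0)) + energy M T (\<lambda>t \<omega>. (X t \<omega>, 0 :: 'w) - (0, 0)))"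
    by (rule energy_triangle[OF j])
  also have "\<dots> = 3 * (energy M T Y + energy M T X)"
    by (simp add: energy_def norm_Pair)
  also have "\<dots> < \<infinity>" using X Y by (auto simp: L2F_iff ennreal_mult_less_top)
  finally show ?thesis using adapted_process_Pair[OF ad] by (simp add: L2F_iff)
qed

lemma L2F_Lip_lipschitz:
  assumes "\<phi> \<in> L2F_Lip M W T"
  obtains N L where "N \<in> null_sets M" "0 \<le> L"
    "\<And>\<omega> t. \<omega> \<in> space M - N \<Longrightarrow> t \<in> {0..T} \<Longrightarrow> lipschitz_on L UNIV (\<phi> t \<omega>)"
proof -
  obtain L where L: "AE \<omega> in M. \<forall>t\<in>{0..T}. lipschitz_on L UNIV (\<phi> t \<omega>)"
    using assms by (auto simp: L2F_Lip_def)
  obtain N where N: "N \<in> null_sets M" "\<And>\<omega>. \<omega> \<in> space M - N \<Longrightarrow> \<forall>t\<in>{0..T}. lipschitz_on L UNIV (\<phi> t \<omega>)"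
    by (rule AE_E3[OF L]) blast
  show ?thesis
  \<comment> \<open>Taking \<open>max 0 L\<close> yields a nonnegative constant without exhibiting a
    point off the null set.\<close>
  proof (rule that[of N "max 0 L"])
    show "lipschitz_on (max 0 L) UNIV (\<phi> t \<omega>)" if "\<omega> \<in> space M - N" "t \<in> {0..T}" for \<omega> t
      by (rule lipschitz_on_le[OF bspec[OF N(2)[OF that(1)] that(2)]]) simp
  qed (use N(1) in auto)
qed

text \<open>Off \<open>N\<close> the coefficient is continuous in its last argument, so
  measurability follows from that of its sections, once jointly and once for \<open>F t\<close>.
  Finite energy follows by comparison with the coefficient at 0.\<close>

lemma compose_off_L2F:
  fixes \<phi> :: "real \<Rightarrow> 'a \<Rightarrow> 'p::euclidean_space \<Rightarrow> 'v::euclidean_space"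
  assumes \<phi>: "\<phi> \<in> L2F_Lip M W T" and U: "U \<in> L2F M W T" and N: "N \<in> null_sets M" and L: "0 \<le> L"
    and lip: "\<And>\<omega> t. \<omega> \<in> space M - N \<Longrightarrow> t \<in> {0..T} \<Longrightarrow> lipschitz_on L UNIV (\<phi> t \<omega>)"
  shows "compose_off N \<phi> U \<in> L2F M W T"
proof -
  have \<phi>_ad: "adapted_process M W T (\<lambda>t \<omega>. \<phi> t \<omega> \<theta>)" for \<theta>
    using \<phi> by (simp add: L2F_Lip_def)
  have \<phi>0: "(\<lambda>t \<omega>. \<phi> t \<omega> 0) \<in> L2F M W T"
    using \<phi> by (simp add: L2F_Lip_def)
  have U_ad: "adapted_process M W T U" using U by (simp add: L2F_iff)
  have cont: "continuous_on UNIV (\<lambda>\<theta>. if \<omega> \<in> N then 0 else \<phi> t \<omega> \<theta>)" if "\<omega> \<in> space M" "t \<in> {0..T}" for \<omega> t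
    using lip[of \<omega> t] that by (cases "\<omega> \<in> N") (auto intro: lipschitz_on_continuous_on)
  have ad: "adapted_process M W T (compose_off N \<phi> U)"
    unfolding adapted_process_def
  proof (intro conjI ballI)
    let ?R = "restrict_space borel {0..T} \<Otimes>\<^sub>M M"
    have "(\<lambda>x. if snd x \<in> N then 0 else \<phi> (fst x) (snd x) (U (fst x) (snd x))) \<in> borel_measurable ?R"
    proof (rule borel_measurable_caratheodory[where g="\<lambda>x \<theta>. if snd x \<in> N then 0 else \<phi> (fst x) (snd x) \<theta>"])
      show "(\<lambda>x. if snd x \<in> N then 0 else \<phi> (fst x) (snd x) \<theta>) \<in> borel_measurable ?R" for \<theta>
      proof (rule measurable_If)
        show "(\<lambda>x. \<phi> (fst x) (snd x) \<theta>) \<in> borel_measurable ?R"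
          using adapted_process_joint[OF \<phi>_ad[of \<theta>]] by (simp add: split_beta)
        have [measurable]: "N \<in> sets M" using N by auto
        show "{x \<in> space ?R. snd x \<in> N} \<in> sets ?R" by measurable
      qed simp
      show "(\<lambda>x. U (fst x) (snd x)) \<in> borel_measurable ?R"
        using adapted_process_joint[OF U_ad] by (simp add: split_beta)
      show "continuous_on UNIV (\<lambda>\<theta>. if snd x \<in> N then 0 else \<phi> (fst x) (snd x) \<theta>)" if "x \<in> space ?R" for x
        using that by (intro cont) (auto simp: space_pair_measure space_restrict_space)
    qed
    then show "(\<lambda>(t, \<omega>). compose_off N \<phi> U t \<omega>) \<in> borel_measurable ?R"
      by (simp add: compose_off_def split_beta)
  next
    fix t assume t: "t \<in> {0..T}"
    have "(\<lambda>\<omega>. if \<omega> \<in> N then 0 else \<phi> t \<omega> (U t \<omega>)) \<in> borel_measurable (F t)"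
    proof (rule borel_measurable_caratheodory[where g="\<lambda>\<omega> \<theta>. if \<omega> \<in> N then 0 else \<phi> t \<omega> \<theta>"])
      show "(\<lambda>\<omega>. if \<omega> \<in> N then 0 else \<phi> t \<omega> \<theta>) \<in> borel_measurable (F t)" for \<theta>
      proof (rule measurable_If_set)
        show "(\<lambda>\<omega>. \<phi> t \<omega> \<theta>) \<in> borel_measurable (F t)" using \<phi>_ad[of \<theta>] t by (simp add: adapted_process_def)
        show "N \<inter> space (F t) \<in> sets (F t)" using null_sets_F[OF N, of t] sets.top[of "F t"] by (rule sets.Int)
      qed simp
      show "U t \<in> borel_measurable (F t)" using U_ad t by (simp add: adapted_process_def)
    qed (use cont t in simp)
    then show "compose_off N \<phi> U t \<in> borel_measurable (F t)"
      by (simp add: compose_off_def[abs_def])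
  qed
  have z: "adapted_process M W T (\<lambda>t \<omega>. 0 :: 'v)" by (simp add: adapted_process_def)
  have "energy M T (\<lambda>t \<omega>. compose_off N \<phi> U t \<omega> - 0) \<le>
      3 * (energy M T (\<lambda>t \<omega>. compose_off N \<phi> U t \<omega> - \<phi> t \<omega> 0) + energy M T (\<lambda>t \<omega>. \<phi> t \<omega> 0 - 0))"
    by (intro energy_triangle adapted_process_joint[where W=W] ad \<phi>_ad z)
  also have "energy M T (\<lambda>t \<omega>. compose_off N \<phi> U t \<omega> - \<phi> t \<omega> 0) \<le> ennreal (L\<^sup>2) * energy M T U"
  proof (rule energy_le[OF _ L adapted_process_joint[OF U_ad]])
    fix t assume t: "t \<in> {0..T}"
    show "AE \<omega> in M. norm (compose_off N \<phi> U t \<omega> - \<phi> t \<omega> 0) \<le> L * norm (U t \<omega>)"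
      using AE_not_in[OF N] AE_space
    proof eventually_elim
      case (elim \<omega>)
      then show ?case
        using lipschitz_onD[OF lip[of \<omega> t], of "U t \<omega>" 0] t by (simp add: compose_off_def dist_norm)
    qed
  qed
  finally have "energy M T (compose_off N \<phi> U) \<le> 3 * (ennreal (L\<^sup>2) * energy M T U + energy M T (\<lambda>t \<omega>. \<phi> t \<omega> 0))"
    by (simp add: mult_left_mono add_mono)
  also have "\<dots> < \<infinity>" using U \<phi>0 by (auto simp: L2F_iff ennreal_mult_less_top)
  finally show ?thesis using ad by (simp add: L2F_iff)
qed

text \<open>The predicates for the two integrands coincide, so the choice returns the very same
  function. The equality thus holds without an exceptional set.\<close>

lemma ito_integral_compose_off:
  assumes N: "N \<in> null_sets M"
  shows "ito_integral M W T (\<lambda>s \<omega>. \<phi> s \<omega> (U s \<omega>)) = ito_integral M W T (compose_off N \<phi> U)"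
proof -
  have "is_ito_integral M W T (\<lambda>s \<omega>. \<phi> s \<omega> (U s \<omega>)) = is_ito_integral M W T (compose_off N \<phi> U)"
    using AE_not_in[OF N] by (intro is_ito_integral_cong) (auto simp: compose_off_def elim: eventually_mono)
  then show ?thesis by (simp add: ito_integral_def)
qed

lemma set_integral_compose_off:
  "\<omega> \<notin> N \<Longrightarrow> (LINT s:A|lborel. compose_off N \<phi> U s \<omega>) = (LINT s:A|lborel. \<phi> s \<omega> (U s \<omega>))"
  by (simp add: compose_off_def)

lemma compose_off_energy_diff:
  fixes \<phi> :: "real \<Rightarrow> 'a \<Rightarrow> 'n::euclidean_space \<times> 'q::euclidean_space \<Rightarrow> 'v::euclidean_space"
  assumes L: "0 \<le> L" and t: "t \<le> T"
    and lip: "\<And>\<omega> t. \<omega> \<in> space M - N \<Longrightarrow> t \<in> {0..T} \<Longrightarrow> lipschitz_on L UNIV (\<phi> t \<omega>)"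
    and X: "adapted_process M W T X" "adapted_process M W T X'"
  shows "energy M t (\<lambda>s \<omega>. compose_off N \<phi> (\<lambda>s \<omega>. (X s \<omega>, V s \<omega>)) s \<omega> - compose_off N \<phi> (\<lambda>s \<omega>. (X' s \<omega>, V s \<omega>)) s \<omega>) \<le>
    ennreal (L\<^sup>2) * energy M t (\<lambda>s \<omega>. X s \<omega> - X' s \<omega>)"
proof (rule energy_le[OF AE_I2 L])
  fix s \<omega> assume s: "s \<in> {0..t}" and \<omega>: "\<omega> \<in> space M"
  show "norm (compose_off N \<phi> (\<lambda>s \<omega>. (X s \<omega>, V s \<omega>)) s \<omega> - compose_off N \<phi> (\<lambda>s \<omega>. (X' s \<omega>, V s \<omega>)) s \<omega>) \<le>
      L * norm (X s \<omega> - X' s \<omega>)"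
    using lipschitz_onD[OF lip[of \<omega> s], of "(X s \<omega>, V s \<omega>)" "(X' s \<omega>, V s \<omega>)"] s \<omega> t L
    by (cases "\<omega> \<in> N") (auto simp: compose_off_def dist_norm norm_Pair)
next
  show "(\<lambda>(s, \<omega>). X s \<omega> - X' s \<omega>) \<in> borel_measurable (restrict_space borel {0..t} \<Otimes>\<^sub>M M)"
    by (intro process_measurable_mono[OF t] adapted_process_joint[where W=W] adapted_process_diff X)
qed

text \<open>Both solutions are driven by the same \<open>y\<close> and \<open>z\<close>, so the
  Lipschitz bounds leave only the difference of the states. Cauchy-Schwarz bounds the drift and the
  stability estimate bounds the stochastic part.\<close>

lemma forward_solution_unique:
  fixes y :: "real \<Rightarrow> 'a \<Rightarrow> real ^ 'm" and X X' :: "real \<Rightarrow> 'a \<Rightarrow> real ^ 'n"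
  assumes T: "0 \<le> T" and b: "b \<in> L2F_Lip M W T" and \<sigma>: "\<sigma> \<in> L2F_Lip M W T"
    and yz: "(y, z) \<in> M_space M W T"
    and sol: "forward_solution M W T x0 b \<sigma> y z X" "forward_solution M W T x0 b \<sigma> y z X'"
  shows "AE \<omega> in M. \<forall>t\<in>{0..T}. X t \<omega> = X' t \<omega>"
proof -
  obtain N L where N: "N \<in> null_sets M" and L: "0 \<le> L"
    and lip: "\<And>\<omega> t. \<omega> \<in> space M - N \<Longrightarrow> t \<in> {0..T} \<Longrightarrow> lipschitz_on L UNIV (b t \<omega>)"
    by (rule L2F_Lip_lipschitz[OF b]) blast
  obtain N' L' where N': "N' \<in> null_sets M" and L': "0 \<le> L'"
    and lip': "\<And>\<omega> t. \<omega> \<in> space M - N' \<Longrightarrow> t \<in> {0..T} \<Longrightarrow> lipschitz_on L' UNIV (\<sigma> t \<omega>)"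
    by (rule L2F_Lip_lipschitz[OF \<sigma>]) blast
  define V where "V = (\<lambda>s \<omega>. (y s \<omega>, z s \<omega>))"
  have XC: "X \<in> L2F_cont M W T" "X' \<in> L2F_cont M W T" using sol by (auto simp: forward_solution_def)
  then have X_ad: "adapted_process M W T X" "adapted_process M W T X'" by (auto simp: L2F_cont_def)
  have "y \<in> L2F M W T" "z \<in> L2F M W T"
    using yz L2F_cont_subset_L2F(1)[OF T] by (auto simp: M_space_def)
  then have VL: "V \<in> L2F M W T" unfolding V_def by (rule L2F_Pair)
  define U where "U = (\<lambda>X s \<omega>. (X s \<omega> :: real ^ 'n, V s \<omega>))"
  have UL: "U X \<in> L2F M W T" "U X' \<in> L2F M W T"
    unfolding U_def by (intro L2F_Pair VL L2F_cont_subset_L2F[OF T] XC)+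
  define B where "B = (\<lambda>X. compose_off N b (U X))"
  define S where "S = (\<lambda>X. compose_off N' \<sigma> (U X))"
  have BL: "B X \<in> L2F M W T" "B X' \<in> L2F M W T"
    unfolding B_def by (intro compose_off_L2F[OF b _ N L lip] UL; assumption)+
  have SL: "S X \<in> L2F M W T" "S X' \<in> L2F M W T"
    unfolding S_def by (intro compose_off_L2F[OF \<sigma> _ N' L' lip'] UL; assumption)+
  note Bj = adapted_process_joint[OF conjunct1[OF BL(1)[unfolded L2F_iff]]]
    adapted_process_joint[OF conjunct1[OF BL(2)[unfolded L2F_iff]]]
  note Sj = adapted_process_joint[OF conjunct1[OF SL(1)[unfolded L2F_iff]]]
    adapted_process_joint[OF conjunct1[OF SL(2)[unfolded L2F_iff]]]
  define I where "I = (\<lambda>X. ito_integral M W T (S X))"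
  have ito: "is_ito_integral M W T (S X) (I X)" "is_ito_integral M W T (S X') (I X')"
    unfolding I_def using SL by (auto intro: is_ito_integral_ito_integral T)
  have I_eq: "ito_integral M W T (\<lambda>s \<omega>. \<sigma> s \<omega> (Z s \<omega>, y s \<omega>, z s \<omega>)) = I Z" for Z
    unfolding I_def S_def ito_integral_compose_off[OF N', symmetric] by (simp add: U_def V_def)
  have eq: "AE \<omega> in M. Z t \<omega> = x0 + (LINT s:{0..t}|lborel. B Z s \<omega>) + I Z t \<omega>"
    if "forward_solution M W T x0 b \<sigma> y z Z" "t \<in> {0..T}" for Z t
  proof -
    have "AE \<omega> in M. Z t \<omega> = forward_rhs M W T x0 b \<sigma> Z y z t \<omega>"
      using that by (auto simp: forward_solution_def)
    then show ?thesis
      using AE_not_in[OF N]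
      by eventually_elim (simp add: forward_rhs_def I_eq B_def U_def V_def set_integral_compose_off)
  qed
  have int: "AE \<omega> in M. set_integrable lborel {0..T} (\<lambda>s. B X s \<omega>)"
      "AE \<omega> in M. set_integrable lborel {0..T} (\<lambda>s. B X' s \<omega>)"
    using BL by (auto intro!: AE_set_integrable[OF T] Bj simp: L2F_iff)
  define u where "u t = msq M (\<lambda>\<omega>. X t \<omega> - X' t \<omega>)" for t
  \<comment> \<open>The 3 comes from splitting drift and stochastic part, \<open>T\<close> from
    Cauchy-Schwarz on \<open>{0..t}\<close>, 27 from the stability of the integral; adding 1 makes
    \<open>K\<close> positive even if both Lipschitz constants are 0.\<close>
  define K where "K = 3 * (T * L\<^sup>2 + 27 * L'\<^sup>2) + 1"
  have K: "0 < K" unfolding K_def using T by (intro add_nonneg_pos mult_nonneg_nonneg add_nonneg_nonneg) auto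
  have X_m: "X t \<in> borel_measurable M" "X' t \<in> borel_measurable M" if "t \<in> {0..T}" for t
    using X_ad that measurable_F_M by (auto simp: adapted_process_def)
  have u_le: "u t \<le> ennreal K * (\<integral>\<^sup>+s\<in>{0..t}. u s \<partial>lborel)" if t: "t \<in> {0..T}" for t
  proof -
    have t': "0 \<le> t" "t \<le> T" using t by auto
    let ?e = "energy M t (\<lambda>s \<omega>. X s \<omega> - X' s \<omega>)"
    have Bd: "(\<lambda>(s, \<omega>). B X s \<omega> - B X' s \<omega>) \<in> borel_measurable (restrict_space borel {0..t} \<Otimes>\<^sub>M M)"
      using borel_measurable_diff[OF Bj] by (intro process_measurable_mono[OF t'(2)]) (simp add: split_beta)
    let ?A = "\<lambda>\<omega>. \<integral>\<^sup>+s\<in>{0..t}. sqn (B X s \<omega> - B X' s \<omega>) \<partial>lborel"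
    have [measurable]: "?A \<in> borel_measurable M"
      by (rule energy_section_measurable[OF t'(1) Bd])
    have [measurable]: "I X t \<in> borel_measurable M" "I X' t \<in> borel_measurable M"
      using ito t measurable_F_M by (auto simp: is_ito_integral_def adapted_process_def)
    have "u t \<le> (\<integral>\<^sup>+\<omega>. 3 * (ennreal t * ?A \<omega> + sqn (I X t \<omega> - I X' t \<omega>)) \<partial>M)"
      unfolding u_def
    proof (rule nn_integral_mono_AE)
      show "AE \<omega> in M. sqn (X t \<omega> - X' t \<omega>) \<le>
          3 * (ennreal t * ?A \<omega> + sqn (I X t \<omega> - I X' t \<omega>))"
        using eq[OF sol(1) t] eq[OF sol(2) t] int
      proof eventually_elim
        case (elim \<omega>)
        have i: "set_integrable lborel {0..t} (\<lambda>s. B X s \<omega>)" "set_integrable lborel {0..t} (\<lambda>s. B X' s \<omega>)"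
          using elim t' by (auto intro: set_integrable_subset)
        let ?D = "LINT s:{0..t}|lborel. B X s \<omega> - B X' s \<omega>"
        have "X t \<omega> - X' t \<omega> = ?D + (I X t \<omega> - I X' t \<omega>) + 0"
          unfolding elim(1,2) set_integral_diff(2)[OF i] by simp
        then have "sqn (X t \<omega> - X' t \<omega>) \<le>
            3 * (sqn ?D + sqn (I X t \<omega> - I X' t \<omega>) + sqn (0 :: real ^ 'n))"
          by (simp only: ennreal_norm_add3_sq)
        also have "\<dots> \<le> 3 * (ennreal t * ?A \<omega> + sqn (I X t \<omega> - I X' t \<omega>) + 0)"
          using set_integral_sq_bound[OF set_integral_diff(1)[OF i] t'(1)]
          by (intro mult_left_mono add_mono) auto
        finally show ?case by simp
      qed
    qed
    also have "\<dots> = 3 * (ennreal t * (\<integral>\<^sup>+\<omega>. ?A \<omega> \<partial>M) + msq M (\<lambda>\<omega>. I X t \<omega> - I X' t \<omega>))"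
      by (simp add: nn_integral_cmult nn_integral_add)
    also have "\<dots> \<le> 3 * (ennreal t * (ennreal (L\<^sup>2) * ?e) + 27 * (ennreal (L'\<^sup>2) * ?e))"
    proof (intro mult_left_mono add_mono)
      have "energy M t (\<lambda>s \<omega>. B X s \<omega> - B X' s \<omega>) \<le> ennreal (L\<^sup>2) * ?e"
        unfolding B_def U_def by (rule compose_off_energy_diff[OF L t'(2) lip X_ad])
      then show "(\<integral>\<^sup>+\<omega>. ?A \<omega> \<partial>M) \<le> ennreal (L\<^sup>2) * ?e"
        unfolding energy_swap[OF t'(1) Bd] .
      have "msq M (\<lambda>\<omega>. I X t \<omega> - I X' t \<omega>) \<le> 27 * energy M t (\<lambda>s \<omega>. S X s \<omega> - S X' s \<omega>)"
        by (rule is_ito_integral_energy[OF ito t Sj])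
      also have "\<dots> \<le> 27 * (ennreal (L'\<^sup>2) * ?e)"
        unfolding S_def U_def
        by (intro mult_left_mono compose_off_energy_diff[OF L' t'(2) lip' X_ad]) auto
      finally show "msq M (\<lambda>\<omega>. I X t \<omega> - I X' t \<omega>) \<le> 27 * (ennreal (L'\<^sup>2) * ?e)" .
    qed auto
    also have "\<dots> = ennreal (3 * (t * L\<^sup>2 + 27 * L'\<^sup>2)) * ?e"
    proof -
      have "ennreal (3 * (t * L\<^sup>2 + 27 * L'\<^sup>2)) = 3 * (ennreal t * ennreal (L\<^sup>2) + 27 * ennreal (L'\<^sup>2))"
        using t' by (subst ennreal_mult, simp, simp, subst ennreal_plus) (simp_all add: ennreal_mult)
      then show ?thesis by (simp only: distrib_right mult.assoc)
    qed
    also have "\<dots> \<le> ennreal K * ?e"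
    proof (intro mult_right_mono ennreal_leI)
      have "t * L\<^sup>2 \<le> T * L\<^sup>2" using t' by (intro mult_right_mono) auto
      then show "3 * (t * L\<^sup>2 + 27 * L'\<^sup>2) \<le> K" by (simp add: K_def)
    qed simp
    also have "?e = (\<integral>\<^sup>+s\<in>{0..t}. u s \<partial>lborel)" by (simp add: energy_def u_def)
    finally show ?thesis .
  qed
  let ?S = "\<lambda>X. \<integral>\<^sup>+\<omega>. (SUP t\<in>{0..T}. sqn (X t \<omega> :: real ^ 'n)) \<partial>M"
  \<comment> \<open>The finite a priori bound required by Gronwall's lemma, from the square
    integrable suprema of the two solutions.\<close>
  have u_bd: "u t \<le> 3 * (?S X + ?S X')" if t: "t \<in> {0..T}" for t
  proof -
    note [measurable] = X_m[OF t]
    have "u t \<le> (\<integral>\<^sup>+\<omega>. 3 * (sqn (X t \<omega>) + sqn (X' t \<omega>)) \<partial>M)"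
      unfolding u_def
    proof (rule nn_integral_mono)
      fix \<omega>
      show "sqn (X t \<omega> - X' t \<omega>) \<le> 3 * (sqn (X t \<omega>) + sqn (X' t \<omega>))"
        using ennreal_norm_diff_sq_triangle[of "X t \<omega>" "X' t \<omega>" 0] by simp
    qed
    also have "\<dots> = 3 * (msq M (\<lambda>\<omega>. X t \<omega>) + msq M (\<lambda>\<omega>. X' t \<omega>))"
      by (subst nn_integral_cmult, measurable, subst nn_integral_add, measurable)
    also have "\<dots> \<le> 3 * (?S X + ?S X')"
      by (intro mult_left_mono add_mono L2F_cont_subset_L2F(2)[OF T] XC t) auto
    finally show ?thesis .
  qed
  have S_fin: "3 * (?S X + ?S X') < \<infinity>"
    using XC by (auto simp: L2F_cont_def ennreal_mult_less_top)
  show ?thesis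
  proof -
    have "AE \<omega> in M. \<forall>t\<in>{0..T}. X t \<omega> - X' t \<omega> = 0"
    proof (rule AE_continuous_eq_0[where S="{0..T}"])
      show "AE \<omega> in M. continuous_on {0..T} (\<lambda>t. X t \<omega> - X' t \<omega>)"
        using XC by (intro AE_I2) (auto simp: L2F_cont_def intro: continuous_on_diff)
      show "AE \<omega> in M. X t \<omega> - X' t \<omega> = 0" if t: "t \<in> {0..T}" for t
      proof -
        have "u t = 0" by (rule gronwall_ennreal[OF K S_fin u_bd u_le t])
        then show ?thesis
          unfolding u_def using X_m[OF t] by (subst (asm) nn_integral_0_iff_AE) (auto elim: eventually_mono)
      qed
    qed auto
    then show ?thesis by simp
  qed
qed

end

section \<open>Backward residual and the loss\<close>

lemma backward_rhs_cong:
  assumes "\<And>s. s \<in> {0..T} \<Longrightarrow> X s \<omega> = X' s \<omega>" and t: "t \<in> {0..T}"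
  shows "backward_rhs M W T f g X y z t \<omega> = backward_rhs M W T f g X' y z t \<omega>"
proof -
  have "(LINT s:{t..T}|lborel. f s \<omega> (X s \<omega>, y s \<omega>, z s \<omega>)) = (LINT s:{t..T}|lborel. f s \<omega> (X' s \<omega>, y s \<omega>, z s \<omega>))"
    using assms by (intro set_lebesgue_integral_cong) auto
  then show ?thesis using assms(1)[of T] t by (simp add: backward_rhs_def)
qed

section \<open>The equations at all times, and the value of the loss\<close>

context brownian_space
begin

text \<open>A solution satisfies its equation at each time almost surely. A statement almost
  everywhere for the product measure needs one null set for all times, which continuity of both
  sides supplies.\<close>

lemma forward_solution_AE_all:
  fixes y :: "real \<Rightarrow> 'a \<Rightarrow> real ^ 'm" and X :: "real \<Rightarrow> 'a \<Rightarrow> real ^ 'n"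
  assumes T: "0 \<le> T" and b: "b \<in> L2F_Lip M W T" and \<sigma>: "\<sigma> \<in> L2F_Lip M W T"
    and yz: "(y, z) \<in> M_space M W T" and sol: "forward_solution M W T x0 b \<sigma> y z X"
  shows "AE \<omega> in M. \<forall>t\<in>{0..T}. X t \<omega> = forward_rhs M W T x0 b \<sigma> X y z t \<omega>"
proof -
  obtain N L where N: "N \<in> null_sets M" and L: "0 \<le> L"
    and lip: "\<And>\<omega> t. \<omega> \<in> space M - N \<Longrightarrow> t \<in> {0..T} \<Longrightarrow> lipschitz_on L UNIV (b t \<omega>)"
    by (rule L2F_Lip_lipschitz[OF b]) blast
  obtain N' L' where N': "N' \<in> null_sets M" and L': "0 \<le> L'"
    and lip': "\<And>\<omega> t. \<omega> \<in> space M - N' \<Longrightarrow> t \<in> {0..T} \<Longrightarrow> lipschitz_on L' UNIV (\<sigma> t \<omega>)"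
    by (rule L2F_Lip_lipschitz[OF \<sigma>]) blast
  define U where "U = (\<lambda>s \<omega>. (X s \<omega>, y s \<omega>, z s \<omega>))"
  have XC: "X \<in> L2F_cont M W T" using sol by (simp add: forward_solution_def)
  have yzL: "y \<in> L2F M W T" "z \<in> L2F M W T"
    using yz L2F_cont_subset_L2F(1)[OF T] by (auto simp: M_space_def)
  have UL: "U \<in> L2F M W T"
    unfolding U_def by (intro L2F_Pair L2F_cont_subset_L2F(1)[OF T XC] yzL)
  define B where "B = compose_off N b U"
  define S where "S = compose_off N' \<sigma> U"
  have BL: "B \<in> L2F M W T" unfolding B_def by (rule compose_off_L2F[OF b UL N L lip])
  have SL: "S \<in> L2F M W T" unfolding S_def by (rule compose_off_L2F[OF \<sigma> UL N' L' lip'])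
  define I where "I = ito_integral M W T S"
  have I_eq: "ito_integral M W T (\<lambda>s \<omega>. \<sigma> s \<omega> (X s \<omega>, y s \<omega>, z s \<omega>)) = I"
    unfolding I_def S_def ito_integral_compose_off[OF N', symmetric] by (simp add: U_def)
  have I_cont: "continuous_on {0..T} (\<lambda>t. I t \<omega>)" if "\<omega> \<in> space M" for \<omega>
    using is_ito_integral_ito_integral[OF T SL] that by (simp add: I_def is_ito_integral_def)
  have int: "AE \<omega> in M. set_integrable lborel {0..T} (\<lambda>s. B s \<omega>)"
    using BL by (auto intro!: AE_set_integrable[OF T] adapted_process_joint[where W=W] simp: L2F_iff)
  have rhs: "forward_rhs M W T x0 b \<sigma> X y z t \<omega> = x0 + (LINT s:{0..t}|lborel. B s \<omega>) + I t \<omega>"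
    if "\<omega> \<notin> N" for t \<omega>
    using that by (simp add: forward_rhs_def I_eq B_def U_def set_integral_compose_off)
  have "AE \<omega> in M. \<forall>t\<in>{0..T}. X t \<omega> - forward_rhs M W T x0 b \<sigma> X y z t \<omega> = 0"
  proof (rule AE_continuous_eq_0[where S="{0..T}"])
    show "AE \<omega> in M. continuous_on {0..T} (\<lambda>t. X t \<omega> - forward_rhs M W T x0 b \<sigma> X y z t \<omega>)"
      using int AE_not_in[OF N] AE_space
    proof eventually_elim
      case (elim \<omega>)
      have "continuous_on {0..T} (\<lambda>t. X t \<omega>)" using XC elim by (simp add: L2F_cont_def)
      then show ?case
        unfolding rhs[OF elim(2)]
        by (intro continuous_intros continuous_on_set_integral elim I_cont)
    qed
    show "AE \<omega> in M. X t \<omega> - forward_rhs M W T x0 b \<sigma> X y z t \<omega> = 0" if "t \<in> {0..T}" for t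
      using sol that by (simp add: forward_solution_def)
  qed auto
  then show ?thesis by simp
qed

text \<open>Replaces the residual by a modification that is measurable at each time and continuous
  on every path. Only then can it be integrated jointly and its zeros be extended by
  continuity.\<close>

lemma backward_residual:
  fixes y :: "real \<Rightarrow> 'a \<Rightarrow> real ^ 'm" and X :: "real \<Rightarrow> 'a \<Rightarrow> real ^ 'n"
  assumes T: "0 \<le> T" and f: "f \<in> L2F_Lip M W T" and g: "g \<in> L2FT_Lip M W T"
    and yz: "(y, z) \<in> M_space M W T" and X: "X \<in> L2F_cont M W T"
  obtains N R where "N \<in> null_sets M"
    "\<And>t \<omega>. \<omega> \<in> space M - N \<Longrightarrow> R t \<omega> = y t \<omega> - backward_rhs M W T f g X y z t \<omega>"
    "\<And>\<omega>. \<omega> \<in> space M \<Longrightarrow> continuous_on {0..T} (\<lambda>t. R t \<omega>)"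
    "\<And>t. t \<in> {0..T} \<Longrightarrow> R t \<in> borel_measurable M"
proof -
  obtain N L where N: "N \<in> null_sets M" and L: "0 \<le> L"
    and lip: "\<And>\<omega> t. \<omega> \<in> space M - N \<Longrightarrow> t \<in> {0..T} \<Longrightarrow> lipschitz_on L UNIV (f t \<omega>)"
    by (rule L2F_Lip_lipschitz[OF f]) blast
  obtain Lg where "AE \<omega> in M. lipschitz_on Lg UNIV (g \<omega>)"
    using g by (auto simp: L2FT_Lip_def)
  then obtain Ng where Ng: "Ng \<in> null_sets M" and lip_g: "\<And>\<omega>. \<omega> \<in> space M - Ng \<Longrightarrow> lipschitz_on Lg UNIV (g \<omega>)"
    by (rule AE_E3) blast
  define U where "U = (\<lambda>s \<omega>. (X s \<omega>, y s \<omega>, z s \<omega>))"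
  have y: "y \<in> L2F_cont M W T" and z: "z \<in> L2F M W T" using yz by (auto simp: M_space_def)
  have UL: "U \<in> L2F M W T"
    unfolding U_def by (intro L2F_Pair L2F_cont_subset_L2F(1)[OF T X] L2F_cont_subset_L2F(1)[OF T y] z)
  define C where "C = compose_off N f U"
  have CL: "C \<in> L2F M W T" unfolding C_def by (rule compose_off_L2F[OF f UL N L lip])
  have Cj: "jointly_measurable M T C"
    using CL by (auto intro: adapted_process_joint simp: L2F_iff)
  have "AE \<omega> in M. set_integrable lborel {0..T} (\<lambda>s. C s \<omega>)"
    using CL by (intro AE_set_integrable[OF T Cj]) (simp add: L2F_iff)
  then obtain Ni where Ni: "Ni \<in> null_sets M"
    and int: "\<And>\<omega>. \<omega> \<in> space M - Ni \<Longrightarrow> set_integrable lborel {0..T} (\<lambda>s. C s \<omega>)"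
    by (rule AE_E3) blast
  define I where "I = ito_integral M W T z"
  have I: "is_ito_integral M W T z I" unfolding I_def by (rule is_ito_integral_ito_integral[OF T z])
  \<comment> \<open>The three exceptional sets: \<open>f\<close> not Lipschitz, \<open>g\<close> not
    Lipschitz, and the path of the driver not integrable.\<close>
  define N0 where "N0 = N \<union> Ng \<union> Ni"
  have N0: "N0 \<in> null_sets M" unfolding N0_def using N Ng Ni by auto
  define G where "G \<omega> = (if \<omega> \<in> Ng then 0 else g \<omega> (X T \<omega>))" for \<omega>
  define R where "R t \<omega> = (if \<omega> \<in> N0 then 0 else
      y t \<omega> - (G \<omega> + (LINT s:{t..T}|lborel. C s \<omega>) - (I T \<omega> - I t \<omega>)))" for t \<omega>
  have meas: "P t \<in> borel_measurable M" if "adapted_process M W T P" "t \<in> {0..T}" for P :: "real \<Rightarrow> 'a \<Rightarrow> real ^ 'q" and t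
    using that measurable_F_M by (auto simp: adapted_process_def)
  have TT: "T \<in> {0..T}" using T by simp
  have G_m: "G \<in> borel_measurable M"
    unfolding G_def[abs_def]
  proof (rule borel_measurable_caratheodory[where g="\<lambda>\<omega> \<theta>. if \<omega> \<in> Ng then 0 else g \<omega> \<theta>"])
    show "(\<lambda>\<omega>. if \<omega> \<in> Ng then 0 else g \<omega> \<theta>) \<in> borel_measurable M" for \<theta>
    proof (rule measurable_If_set)
      show "(\<lambda>\<omega>. g \<omega> \<theta>) \<in> borel_measurable M"
        using g by (intro measurable_F_M[of _ T]) (simp add: L2FT_Lip_def)
      show "Ng \<inter> space M \<in> events" using Ng by auto
    qed simp
    show "X T \<in> borel_measurable M" using X by (intro meas TT) (simp add: L2F_cont_def)
    show "continuous_on UNIV (\<lambda>\<theta>. if \<omega> \<in> Ng then 0 else g \<omega> \<theta>)" if "\<omega> \<in> space M" for \<omega>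
      using lip_g[of \<omega>] that by (cases "\<omega> \<in> Ng") (auto intro: lipschitz_on_continuous_on)
  qed
  have C_m: "(\<lambda>\<omega>. LINT s:{t..T}|lborel. C s \<omega>) \<in> borel_measurable M" if t: "t \<in> {0..T}" for t
  proof -
    \<comment> \<open>A parameter integral is measurable once its integrand is jointly measurable on
      the whole line, hence the extension by 0 outside \<open>{0..T}\<close>.\<close>
    have "(\<lambda>x. (snd x, fst x)) \<in> measurable (M \<Otimes>\<^sub>M lborel) (borel \<Otimes>\<^sub>M M)" by measurable
    from measurable_compose[OF this extend_process_measurable[OF T Cj]]
    have [measurable]: "(\<lambda>x. if snd x \<in> {0..T} then C (snd x) (fst x) else 0) \<in> borel_measurable (M \<Otimes>\<^sub>M lborel)"
      by simp
    have "(\<lambda>x. indicator {t..T} (snd x) *\<^sub>R (if snd x \<in> {0..T} then C (snd x) (fst x) else 0)) \<in> borel_measurable (M \<Otimes>\<^sub>M lborel)"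
      by (intro borel_measurable_scaleR) measurable
    then have "(\<lambda>(\<omega>, s). indicator {t..T} s *\<^sub>R (if s \<in> {0..T} then C s \<omega> else 0)) \<in> borel_measurable (M \<Otimes>\<^sub>M lborel)"
      by (simp add: split_beta)
    then have "(\<lambda>\<omega>. \<integral>s. indicator {t..T} s *\<^sub>R (if s \<in> {0..T} then C s \<omega> else 0) \<partial>lborel) \<in> borel_measurable M"
      by (rule lborel.borel_measurable_lebesgue_integral)
    also have "(\<lambda>\<omega>. \<integral>s. indicator {t..T} s *\<^sub>R (if s \<in> {0..T} then C s \<omega> else 0) \<partial>lborel) =
        (\<lambda>\<omega>. LINT s:{t..T}|lborel. C s \<omega>)"
      unfolding set_lebesgue_integral_def using t by (intro ext Bochner_Integration.integral_cong) (auto simp: indicator_def)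
    finally show ?thesis .
  qed
  show ?thesis
  proof (rule that[of N0 R])
    show "N0 \<in> null_sets M" by fact
    show "R t \<omega> = y t \<omega> - backward_rhs M W T f g X y z t \<omega>" if "\<omega> \<in> space M - N0" for t \<omega>
      using that by (simp add: R_def N0_def G_def C_def U_def I_def backward_rhs_def set_integral_compose_off)
    show "continuous_on {0..T} (\<lambda>t. R t \<omega>)" if \<omega>: "\<omega> \<in> space M" for \<omega>
    proof (cases "\<omega> \<in> N0")
      case False
      have "continuous_on {0..T} (\<lambda>t. y t \<omega>)" using y \<omega> by (simp add: L2F_cont_def)
      moreover have "continuous_on {0..T} (\<lambda>t. I t \<omega>)" using I \<omega> by (simp add: is_ito_integral_def)
      moreover have "continuous_on {0..T} (\<lambda>t. LINT s:{t..T}|lborel. C s \<omega>)"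
        using int[of \<omega>] \<omega> False by (intro continuous_on_set_integral) (auto simp: N0_def)
      ultimately show ?thesis
        using False by (simp add: R_def) (intro continuous_intros; assumption)
    qed (simp add: R_def)
    show "R t \<in> borel_measurable M" if t: "t \<in> {0..T}" for t
      unfolding R_def[abs_def]
    proof (rule measurable_If_set)
      have "y t \<in> borel_measurable M" using y by (intro meas t) (simp add: L2F_cont_def)
      moreover have "I t \<in> borel_measurable M" "I T \<in> borel_measurable M"
        using I by (auto intro!: meas t TT simp: is_ito_integral_def)
      ultimately show "(\<lambda>\<omega>. y t \<omega> - (G \<omega> + (LINT s:{t..T}|lborel. C s \<omega>) - (I T \<omega> - I t \<omega>))) \<in> borel_measurable M"
        by (intro borel_measurable_diff borel_measurable_add G_m C_m[OF t])
      show "N0 \<inter> space M \<in> events" using N0 by auto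
    qed simp
  qed
qed

text \<open>Frees the loss from the choice in its definition: by uniqueness any solution of the
  forward equation may be inserted.\<close>

lemma BML_eq:
  fixes y :: "real \<Rightarrow> 'a \<Rightarrow> real ^ 'm" and X :: "real \<Rightarrow> 'a \<Rightarrow> real ^ 'n"
  assumes T: "0 \<le> T" and b: "b \<in> L2F_Lip M W T" and \<sigma>: "\<sigma> \<in> L2F_Lip M W T"
    and yz: "(y, z) \<in> M_space M W T" and sol: "forward_solution M W T x0 b \<sigma> y z X"
    and \<mu>: "space \<mu> = {0..T}"
  shows "BML M W T x0 b \<sigma> f g \<mu> (y, z) =
    (\<integral>\<^sup>+t. msq M (\<lambda>\<omega>. y t \<omega> - backward_rhs M W T f g X y z t \<omega>) \<partial>\<mu>)"
proof -
  define X' where "X' = (SOME X. forward_solution M W T x0 b \<sigma> y z X)"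
  have "forward_solution M W T x0 b \<sigma> y z X'"
    using someI[of "\<lambda>X. forward_solution M W T x0 b \<sigma> y z X", OF sol] by (simp add: X'_def)
  then have eq: "AE \<omega> in M. \<forall>t\<in>{0..T}. X' t \<omega> = X t \<omega>"
    by (rule forward_solution_unique[OF T b \<sigma> yz _ sol])
  show ?thesis
    unfolding BML_def prod.case Let_def X'_def[symmetric]
  proof (rule nn_integral_cong)
    fix t assume "t \<in> space \<mu>"
    then have t: "t \<in> {0..T}" using \<mu> by simp
    show "msq M (\<lambda>\<omega>. y t \<omega> - backward_rhs M W T f g X' y z t \<omega>) =
        msq M (\<lambda>\<omega>. y t \<omega> - backward_rhs M W T f g X y z t \<omega>)"
    proof (rule nn_integral_cong_AE)
      show "AE \<omega> in M. sqn (y t \<omega> - backward_rhs M W T f g X' y z t \<omega>) =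
          sqn (y t \<omega> - backward_rhs M W T f g X y z t \<omega>)"
        using eq
      proof eventually_elim
        case (elim \<omega>)
        then show ?case using backward_rhs_cong[of T X' \<omega> X t M W f g y z] t by simp
      qed
    qed
  qed
qed

end

section \<open>Vanishing of the minimal loss, and identification of the minimizer\<close>

theorem theorem6:
  fixes M :: "'a measure" and W :: "real \<Rightarrow> 'a \<Rightarrow> real ^ 'd"
    and T T0 L0 Lg :: real and \<mu> :: "real measure" and x0 :: "real ^ 'n"
    and b :: "real \<Rightarrow> 'a \<Rightarrow> (real ^ 'n) \<times> (real ^ 'm) \<times> (real ^ 'd ^ 'm) \<Rightarrow> real ^ 'n"
    and \<sigma> :: "real \<Rightarrow> 'a \<Rightarrow> (real ^ 'n) \<times> (real ^ 'm) \<times> (real ^ 'd ^ 'm) \<Rightarrow> real ^ 'd ^ 'n"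
    and f :: "real \<Rightarrow> 'a \<Rightarrow> (real ^ 'n) \<times> (real ^ 'm) \<times> (real ^ 'd ^ 'm) \<Rightarrow> real ^ 'm"
    and g :: "'a \<Rightarrow> real ^ 'n \<Rightarrow> real ^ 'm"
    and X xs :: "real \<Rightarrow> 'a \<Rightarrow> real ^ 'n"
    and Y ys :: "real \<Rightarrow> 'a \<Rightarrow> real ^ 'm"
    and Z zs :: "real \<Rightarrow> 'a \<Rightarrow> real ^ 'd ^ 'm"
  assumes "prob_space M" and "complete_measure M" and "brownian_motion M W"
    and "sets \<mu> = sets (restrict_space borel {0..T})" and "sigma_finite_measure \<mu>"
    and "fbsde_coefficients M W T L0 Lg b \<sigma> f g"
    and "0 < T0"
    and "\<And>T' x. T' \<in> {0<..T0} \<Longrightarrow> fbsde_coefficients M W T' L0 Lg b \<sigma> f g \<Longrightarrow>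
           fbsde_uniquely_solvable M W T' x b \<sigma> f g"
    and "T \<in> {0<..T0}"
    and "fbsde_solution M W T x0 b \<sigma> f g X Y Z"
    and "is_arg_min (BML M W T x0 b \<sigma> f g \<mu>) (\<lambda>p. p \<in> M_space M W T) (ys, zs)"
    and "forward_solution M W T x0 b \<sigma> ys zs xs"
  shows "BML M W T x0 b \<sigma> f g \<mu> (ys, zs) = 0 \<and>
    (AE (t, \<omega>) in \<mu> \<Otimes>\<^sub>M M.
       xs t \<omega> = forward_rhs M W T x0 b \<sigma> xs ys zs t \<omega> \<and>
       ys t \<omega> = backward_rhs M W T f g xs ys zs t \<omega>) \<and>
    (absolutely_continuous \<mu> (restrict_space lborel {0..T}) \<and>
     absolutely_continuous (restrict_space lborel {0..T}) \<mu> \<longrightarrow>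
       dist_M M T \<mu> (ys, zs) (Y, Z) = 0 \<and>
       fbsde_solution M W T x0 b \<sigma> f g xs ys zs)"
proof -
  interpret prob_space M by fact
  interpret brownian_space M W by unfold_locales fact
  interpret \<mu>: sigma_finite_measure \<mu> by fact
  interpret P: pair_sigma_finite \<mu> M ..
  have T: "0 < T" "0 \<le> T" using assms(9) by auto
  have coeff: "b \<in> L2F_Lip M W T" "\<sigma> \<in> L2F_Lip M W T" "f \<in> L2F_Lip M W T" "g \<in> L2FT_Lip M W T"
    using assms(6) by (auto simp: fbsde_coefficients_def)
  have space_\<mu>: "space \<mu> = {0..T}"
    using sets_eq_imp_space_eq[OF assms(4)] by (simp add: space_restrict_space)
  have YZ: "(Y, Z) \<in> M_space M W T" and sol: "forward_solution M W T x0 b \<sigma> Y Z X"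
    and bwd: "\<And>t. t \<in> {0..T} \<Longrightarrow> AE \<omega> in M. Y t \<omega> = backward_rhs M W T f g X Y Z t \<omega>"
    using assms(10) by (auto simp: fbsde_solution_def forward_solution_def)
  have yz: "(ys, zs) \<in> M_space M W T"
    and min: "\<not> BML M W T x0 b \<sigma> f g \<mu> (Y, Z) < BML M W T x0 b \<sigma> f g \<mu> (ys, zs)"
    using assms(11) YZ by (auto simp: is_arg_min_def)
  have xs: "xs \<in> L2F_cont M W T" using assms(12) by (simp add: forward_solution_def)

  \<comment> \<open>Minimality only excludes a strictly smaller loss, so one competitor with loss 0
    forces the minimum to be 0.\<close>
  have "BML M W T x0 b \<sigma> f g \<mu> (Y, Z) = (\<integral>\<^sup>+t. 0 \<partial>\<mu>)"
    unfolding BML_eq[OF T(2) coeff(1,2) YZ sol space_\<mu>]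
  proof (rule nn_integral_cong)
    fix t assume "t \<in> space \<mu>"
    then have "AE \<omega> in M. sqn (Y t \<omega> - backward_rhs M W T f g X Y Z t \<omega>) = 0"
      using bwd[of t] space_\<mu> by (auto elim: eventually_mono)
    then have "msq M (\<lambda>\<omega>. Y t \<omega> - backward_rhs M W T f g X Y Z t \<omega>) = (\<integral>\<^sup>+\<omega>. 0 \<partial>M)"
      by (rule nn_integral_cong_AE)
    then show "msq M (\<lambda>\<omega>. Y t \<omega> - backward_rhs M W T f g X Y Z t \<omega>) = 0" by simp
  qed
  with min have BML0: "BML M W T x0 b \<sigma> f g \<mu> (ys, zs) = 0" by simp

  obtain N R where N: "N \<in> null_sets M"
    and R: "\<And>t \<omega>. \<omega> \<in> space M - N \<Longrightarrow> R t \<omega> = ys t \<omega> - backward_rhs M W T f g xs ys zs t \<omega>"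
    and R_cont: "\<And>\<omega>. \<omega> \<in> space M \<Longrightarrow> continuous_on {0..T} (\<lambda>t. R t \<omega>)"
    and R_m: "\<And>t. t \<in> {0..T} \<Longrightarrow> R t \<in> borel_measurable M"
    by (rule backward_residual[OF T(2) coeff(3,4) yz xs]) blast
  have R_eq: "AE \<omega> in M. \<forall>t. R t \<omega> = ys t \<omega> - backward_rhs M W T f g xs ys zs t \<omega>"
    using AE_not_in[OF N] AE_space by eventually_elim (simp add: R)
  have "jointly_measurable M T R"
    by (rule continuous_process_measurable[OF T(2) R_m R_cont])
  \<comment> \<open>\<open>\<mu>\<close> lives on the Borel sets of \<open>{0..T}\<close>, so joint
    measurability transfers unchanged.\<close>
  then have R_j: "(\<lambda>(t, \<omega>). R t \<omega>) \<in> borel_measurable (\<mu> \<Otimes>\<^sub>M M)"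
    by (simp add: measurable_cong_sets[OF sets_pair_measure_cong[OF assms(4) refl] refl])
  then have R_j': "(\<lambda>x. R (fst x) (snd x)) \<in> borel_measurable (\<mu> \<Otimes>\<^sub>M M)"
    by (simp add: split_beta)
  have R2_j: "(\<lambda>(t, \<omega>). sqn (R t \<omega>)) \<in> borel_measurable (\<mu> \<Otimes>\<^sub>M M)"
    using R_j' by (simp add: split_beta)
  define h where "h t = msq M (\<lambda>\<omega>. R t \<omega>)" for t
  have h_m: "h \<in> borel_measurable \<mu>"
    unfolding h_def[abs_def] by (rule borel_measurable_nn_integral[OF R2_j])
  have "(\<integral>\<^sup>+t. h t \<partial>\<mu>) = BML M W T x0 b \<sigma> f g \<mu> (ys, zs)"
    unfolding BML_eq[OF T(2) coeff(1,2) yz assms(12) space_\<mu>] h_def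
    using R_eq by (intro nn_integral_cong nn_integral_cong_AE) (auto elim: eventually_mono)
  then have h0: "(\<integral>\<^sup>+t. h t \<partial>\<mu>) = 0" using BML0 by simp

  \<comment> \<open>An exceptional set of \<open>\<omega>\<close> alone lifts to a cylinder that is
    null for the product, whatever \<open>Q\<close> is elsewhere; thus the equations themselves need
    not be known to be jointly measurable.\<close>
  have AE_snd: "AE x in \<mu> \<Otimes>\<^sub>M M. Q (snd x)" if Q: "AE \<omega> in M. Q \<omega>" for Q
  proof -
    obtain N' where N': "N' \<in> null_sets M" "\<And>\<omega>. \<omega> \<in> space M - N' \<Longrightarrow> Q \<omega>"
      by (rule AE_E3[OF Q]) blast
    have [measurable]: "N' \<in> sets M" using N' by auto
    have "AE x in \<mu> \<Otimes>\<^sub>M M. snd x \<notin> N'"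
    proof (rule P.AE_pair_measure)
      show "{x \<in> space (\<mu> \<Otimes>\<^sub>M M). snd x \<notin> N'} \<in> sets (\<mu> \<Otimes>\<^sub>M M)" by measurable
    qed (use AE_not_in[OF N'(1)] in simp)
    then show ?thesis
      using AE_space by eventually_elim (auto simp: space_pair_measure intro: N'(2))
  qed
  have "(\<integral>\<^sup>+x. sqn (R (fst x) (snd x)) \<partial>(\<mu> \<Otimes>\<^sub>M M)) = 0"
    using h0 R_j' unfolding h_def by (subst nn_integral_fst[symmetric]) simp_all
  then have "AE x in \<mu> \<Otimes>\<^sub>M M. R (fst x) (snd x) = 0"
    using R_j' by (subst (asm) nn_integral_0_iff_AE) simp_all
  moreover have "AE x in \<mu> \<Otimes>\<^sub>M M. \<forall>t. R t (snd x) = ys t (snd x) - backward_rhs M W T f g xs ys zs t (snd x)"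
    by (rule AE_snd[OF R_eq])
  moreover have "AE x in \<mu> \<Otimes>\<^sub>M M. \<forall>t\<in>{0..T}. xs t (snd x) = forward_rhs M W T x0 b \<sigma> xs ys zs t (snd x)"
    by (rule AE_snd[OF forward_solution_AE_all[OF T(2) coeff(1,2) yz assms(12)]])
  ultimately have ae: "AE x in \<mu> \<Otimes>\<^sub>M M. xs (fst x) (snd x) = forward_rhs M W T x0 b \<sigma> xs ys zs (fst x) (snd x) \<and>
      ys (fst x) (snd x) = backward_rhs M W T f g xs ys zs (fst x) (snd x)"
    using AE_space
    by eventually_elim (simp add: space_pair_measure space_\<mu> mem_Times_iff)

  have part3: "dist_M M T \<mu> (ys, zs) (Y, Z) = 0 \<and> fbsde_solution M W T x0 b \<sigma> f g xs ys zs"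
    if ac: "absolutely_continuous \<mu> (restrict_space lborel {0..T})"
  proof
    have "AE t in \<mu>. h t = 0" using h0 h_m by (simp add: nn_integral_0_iff_AE)
    moreover have "{t \<in> space \<mu>. h t \<noteq> 0} \<in> sets \<mu>" using h_m by measurable
    ultimately have "{t \<in> space \<mu>. h t \<noteq> 0} \<in> null_sets \<mu>"
      by (subst AE_iff_null_sets) (auto elim: eventually_mono)
    \<comment> \<open>With the arguments in this order, absolute continuity says that a
      \<open>\<mu>\<close>-null set is Lebesgue null. Hence the zeros of \<open>h\<close> are dense
      in \<open>{0..T}\<close>.\<close>
    then have "{t \<in> {0..T}. h t \<noteq> 0} \<in> null_sets (restrict_space lborel {0..T})"
      using ac by (auto simp: absolutely_continuous_def space_\<mu>)
    then have "{t \<in> {0..T}. h t \<noteq> 0} \<in> null_sets lborel"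
      by (simp add: null_sets_restrict_space)
    moreover have "{0..T} - {t \<in> {0..T}. h t = 0} = {t \<in> {0..T}. h t \<noteq> 0}" by auto
    ultimately have cl: "{0..T} \<subseteq> closure {t \<in> {0..T}. h t = 0}"
      by (intro closure_cofull_Icc[OF T(1)]) simp
    have "AE \<omega> in M. \<forall>t\<in>{0..T}. R t \<omega> = 0"
    proof (rule AE_continuous_eq_0[OF _ _ cl])
      show "AE \<omega> in M. continuous_on {0..T} (\<lambda>t. R t \<omega>)" using R_cont by (intro AE_I2)
      show "AE \<omega> in M. R t \<omega> = 0" if "t \<in> {t \<in> {0..T}. h t = 0}" for t
        using that R_m[of t] unfolding h_def by (auto simp: nn_integral_0_iff_AE)
    qed auto
    then have bwd': "AE \<omega> in M. \<forall>t\<in>{0..T}. ys t \<omega> = backward_rhs M W T f g xs ys zs t \<omega>"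
      using R_eq by eventually_elim simp
    show fb: "fbsde_solution M W T x0 b \<sigma> f g xs ys zs"
      unfolding fbsde_solution_def
    proof (intro conjI ballI xs yz)
      fix t assume t: "t \<in> {0..T}"
      have "AE \<omega> in M. xs t \<omega> = forward_rhs M W T x0 b \<sigma> xs ys zs t \<omega>"
        using assms(12) t by (simp add: forward_solution_def)
      with bwd' show "AE \<omega> in M. xs t \<omega> = forward_rhs M W T x0 b \<sigma> xs ys zs t \<omega> \<and>
          ys t \<omega> = backward_rhs M W T f g xs ys zs t \<omega>"
        by eventually_elim (use t in auto)
    qed
    have uniq: "fbsde_uniquely_solvable M W T x0 b \<sigma> f g"
      by (rule assms(8)[OF assms(9,6)])
    have eq: "AE \<omega> in M. \<forall>t\<in>{0..T}. xs t \<omega> = X t \<omega> \<and> ys t \<omega> = Y t \<omega>"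
        "AE (t, \<omega>) in restrict_space lborel {0..T} \<Otimes>\<^sub>M M. zs t \<omega> = Z t \<omega>"
      using uniq fb assms(10) unfolding fbsde_uniquely_solvable_def by blast+
    have sf: "sigma_finite_measure (restrict_space lborel {0..T})"
      by (rule sigma_finite_measure_restrict_space) (auto intro: lborel.sigma_finite_measure_axioms)
    interpret L: sigma_finite_measure "restrict_space lborel {0..T}" by (rule sf)
    interpret LM: pair_sigma_finite "restrict_space lborel {0..T}" M ..
    have "AE t in restrict_space lborel {0..T}. AE \<omega> in M. zs t \<omega> = Z t \<omega>"
      using LM.AE_pair[OF eq(2)] by simp
    then have "AE t in lborel. t \<in> {0..T} \<longrightarrow> (AE \<omega> in M. zs t \<omega> = Z t \<omega>)"
      by (subst (asm) AE_restrict_space_iff) auto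
    then have "energy M T (\<lambda>t \<omega>. zs t \<omega> - Z t \<omega>) = (\<integral>\<^sup>+t. 0 \<partial>(lborel :: real measure))"
      unfolding energy_def
    proof (intro nn_integral_cong_AE, eventually_elim)
      case (elim t)
      show ?case
      proof (cases "t \<in> {0..T}")
        case True
        then have "msq M (\<lambda>\<omega>. zs t \<omega> - Z t \<omega>) = (\<integral>\<^sup>+\<omega>. 0 \<partial>M)"
          using elim by (intro nn_integral_cong_AE) (auto elim: eventually_mono)
        then show ?thesis by simp
      qed simp
    qed
    then have e0: "energy M T (\<lambda>t \<omega>. zs t \<omega> - Z t \<omega>) = 0" by simp
    have "adapted_process M W T zs" "adapted_process M W T Z"
      using yz YZ by (auto simp: M_space_def L2F_iff)
    then have zj: "(\<lambda>(t, \<omega>). zs t \<omega> - Z t \<omega>) \<in> borel_measurable (restrict_space borel {0..T} \<Otimes>\<^sub>M M)"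
      by (intro adapted_process_joint[where W=W] adapted_process_diff)
    \<comment> \<open>Swapping the order of integration gives one null set of paths that serves
      every starting time \<open>t\<close> of the inner integral in the distance.\<close>
    have z0: "AE \<omega> in M. (\<integral>\<^sup>+s\<in>{0..T}. sqn (zs s \<omega> - Z s \<omega>) \<partial>lborel) = 0"
      using e0 energy_section_measurable[OF T(2) zj] unfolding energy_swap[OF T(2) zj]
      by (simp add: nn_integral_0_iff_AE)
    have "dist_M M T \<mu> (ys, zs) (Y, Z) = (\<integral>\<^sup>+t. 0 \<partial>\<mu>)"
      unfolding dist_M_def prod.case
    proof (rule nn_integral_cong)
      fix t assume "t \<in> space \<mu>"
      then have t: "t \<in> {0..T}" by (simp add: space_\<mu>)
      have "(\<integral>\<^sup>+\<omega>. sqn (ys t \<omega> - Y t \<omega>) +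
          (\<integral>\<^sup>+s\<in>{t..T}. sqn (zs s \<omega> - Z s \<omega>) \<partial>lborel) \<partial>M) = (\<integral>\<^sup>+\<omega>. 0 \<partial>M)"
      proof (rule nn_integral_cong_AE)
        show "AE \<omega> in M. sqn (ys t \<omega> - Y t \<omega>) +
          (\<integral>\<^sup>+s\<in>{t..T}. sqn (zs s \<omega> - Z s \<omega>) \<partial>lborel) = 0"
          using eq(1) z0
        proof eventually_elim
          case (elim \<omega>)
          have "(\<integral>\<^sup>+s\<in>{t..T}. sqn (zs s \<omega> - Z s \<omega>) \<partial>lborel) \<le>
              (\<integral>\<^sup>+s\<in>{0..T}. sqn (zs s \<omega> - Z s \<omega>) \<partial>lborel)"
            using t by (intro nn_integral_mono) (auto simp: indicator_def)
          then show ?case using elim t by simp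
        qed
      qed
      then show "(\<integral>\<^sup>+\<omega>. sqn (ys t \<omega> - Y t \<omega>) +
          (\<integral>\<^sup>+s\<in>{t..T}. sqn (zs s \<omega> - Z s \<omega>) \<partial>lborel) \<partial>M) = 0" by simp
    qed
    then show "dist_M M T \<mu> (ys, zs) (Y, Z) = 0" by simp
  qed
  show ?thesis
    using BML0 ae part3 by (simp add: split_beta)
qed

end
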